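(* Let $\mathcal Y=(0,+\infty)\cup(0,+\infty)\cup(0,+\infty)$ be the tricrystal junction, let $c_1,c_2,c_3>0$ and $\lambda\in\mathbb R$. For any $\Psi\in H^1(\mathcal Y)\times L^2(\mathcal Y)$ there exists $T>0$ such that the sine-Gordon equation $\mathbf w_t=JE\mathbf w+F(\mathbf w)$ (with the $\delta'$-interaction of parameter $\lambda$ at the vertex) has a unique solution $\mathbf w\in C([0,T];H^1(\mathcal Y)\times L^2(\mathcal Y))$ satisfying $\mathbf w(0)=\Psi$. For each $T_0\in(0,T)$ the data-to-solution mapping $$\Psi\in H^1(\mathcal Y)\times L^2(\mathcal Y)\ \mapsto\ \mathbf w\in C([0,T_0];H^1(\mathcal Y)\times L^2(\mathcal Y))$$ is at least of class $C^2$.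
   Context: $\mathcal Y$ consists of three edges $E_j=(0,\infty)$, $j=1,2,3$, attached at a common vertex $\nu=0$. $L^2(\mathcal Y)=\bigoplus_{j=1}^3L^2(0,\infty)$ and $H^m(\mathcal Y)=\bigoplus_{j=1}^3H^m(0,\infty)$ with the natural norms (no vertex condition is imposed in $H^m(\mathcal Y)$). For $\mathbf w=(u,v)^\top$, $u=(u_1,u_2,u_3)^\top$, $v=(v_1,v_2,v_3)^\top$, $u_j,v_j:E_j\to\mathbb R$, $$J=\begin{pmatrix}0&I_3\\-I_3&0\end{pmatrix},\qquad E=\begin{pmatrix}\mathcal T_\lambda&0\\0&I_3\end{pmatrix},\qquad F(\mathbf w)=(0,0,0,-\sin u_1,-\sin u_2,-\sin u_3)^\top,$$ where $\mathcal T_\lambda=\big((-c_j^2\frac{d^2}{dx^2})\delta_{j,k}\big)_{1\le j,k\le3}$ has domain $$D(\mathcal T_\lambda)=\Big\{(v_j)_{j=1}^3\in H^2(\mathcal Y):\ c_1v_1'(0+)=c_2v_2'(0+)=c_3v_3'(0+),\ \sum_{j=1}^3c_jv_j(0+)=\lambda c_1v_1'(0+)\Big\}.$$ The operator $JE$ acts in $H^1(\mathcal Y)\times L^2(\mathcal Y)$ with domain $D(\mathcal T_\lambda)\times H^1(\mathcal Y)$, and the equation is understood as the semilinear evolution equation governed by the semigroup generated by $JE$ on $H^1(\mathcal Y)\times L^2(\mathcal Y)$.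
   Formalization: For λ = 0 the claim is not asserted unconditionally: there D(T_0) lies in the proper closed subspace {Σ c_j v_j(0+) = 0} of H^1(Y), so JE is not densely defined and generates no semigroup on H^1×L^2; for every λ ≠ 0 the full claim is proved, including that JE generates a semigroup. *)

theory Defs
  imports "HOL-Analysis.Analysis"
begin

section \<open>The space $L^2(0,\infty)$\<close>

abbreviation halfline :: "real measure" where
  "halfline \<equiv> lebesgue_on {0<..}"

definition square_integrable :: "(real \<Rightarrow> real) \<Rightarrow> bool" where
  "square_integrable f \<longleftrightarrow>
     f \<in> borel_measurable halfline \<and> integrable halfline (\<lambda>x. (f x)\<^sup>2)"

lemma square_integrable_mult:
  assumes "square_integrable f" "square_integrable g"
  shows "integrable halfline (\<lambda>x. f x * g x)"
proof (rule Bochner_Integration.integrable_bound)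
  show "integrable halfline (\<lambda>x. (f x)\<^sup>2 + (g x)\<^sup>2)"
    using assms by (simp add: square_integrable_def)
  show "(\<lambda>x. f x * g x) \<in> borel_measurable halfline"
    using assms unfolding square_integrable_def by (intro borel_measurable_times) auto
  have "\<bar>a * b\<bar> \<le> a\<^sup>2 + b\<^sup>2" for a b :: real
  proof -
    have "2 * (\<bar>a\<bar> * \<bar>b\<bar>) \<le> a\<^sup>2 + b\<^sup>2"
      using sum_squares_bound[of "\<bar>a\<bar>" "\<bar>b\<bar>"] by simp
    moreover have "0 \<le> \<bar>a\<bar> * \<bar>b\<bar>" by simp
    ultimately show ?thesis unfolding abs_mult by linarith
  qed
  then show "AE x in halfline. norm (f x * g x) \<le> norm ((f x)\<^sup>2 + (g x)\<^sup>2)"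
    by simp
qed

lemma square_integrable_zero: "square_integrable (\<lambda>x. 0)"
  by (simp add: square_integrable_def)

lemma square_integrable_add:
  assumes "square_integrable f" "square_integrable g"
  shows "square_integrable (\<lambda>x. f x + g x)"
  using assms square_integrable_mult[OF assms]
  by (auto simp: square_integrable_def power2_sum mult.assoc intro: borel_measurable_add)

lemma square_integrable_scale:
  assumes "square_integrable f"
  shows "square_integrable (\<lambda>x. r * f x)"
  using assms
  by (auto simp: square_integrable_def power_mult_distrib intro: borel_measurable_times)

lemma square_integrable_minus:
  assumes "square_integrable f"
  shows "square_integrable (\<lambda>x. - f x)"
  using square_integrable_scale[OF assms, of "-1"] by simp

lemma square_integrable_sin:
  assumes "square_integrable f"
  shows "square_integrable (\<lambda>x. sin (f x))"
  unfolding square_integrable_def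
proof
  show meas: "(\<lambda>x. sin (f x)) \<in> borel_measurable halfline"
    using assms measurable_compose[of f halfline borel sin borel]
    by (simp add: square_integrable_def)
  show "integrable halfline (\<lambda>x. (sin (f x))\<^sup>2)"
  proof (rule Bochner_Integration.integrable_bound)
    show "integrable halfline (\<lambda>x. (f x)\<^sup>2)"
      using assms by (simp add: square_integrable_def)
    show "(\<lambda>x. (sin (f x))\<^sup>2) \<in> borel_measurable halfline"
      using meas by simp
    show "AE x in halfline. norm ((sin (f x))\<^sup>2) \<le> norm ((f x)\<^sup>2)"
      using abs_sin_x_le_abs_x by (auto simp: abs_le_square_iff)
  qed
qed

quotient_type l2 = "real \<Rightarrow> real" / partial:
  "\<lambda>f g. square_integrable f \<and> square_integrable g \<and> (AE x in halfline. f x = g x)"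
proof (rule part_equivpI)
  show "\<exists>f. square_integrable f \<and> square_integrable f \<and> (AE x in halfline. f x = f x)"
    using square_integrable_zero by auto
  show "symp (\<lambda>f g. square_integrable f \<and> square_integrable g \<and> (AE x in halfline. f x = g x))"
    by (rule sympI) auto
  show "transp (\<lambda>f g. square_integrable f \<and> square_integrable g \<and> (AE x in halfline. f x = g x))"
    by (rule transpI) auto
qed

instantiation l2 :: real_inner
begin

lift_definition zero_l2 :: l2 is "\<lambda>x. 0"
  by (simp add: square_integrable_zero)

lift_definition plus_l2 :: "l2 \<Rightarrow> l2 \<Rightarrow> l2" is "\<lambda>f g x. f x + g x"
  by (auto intro: square_integrable_add)

lift_definition uminus_l2 :: "l2 \<Rightarrow> l2" is "\<lambda>f x. - f x"
  by (auto intro: square_integrable_minus)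

definition minus_l2 :: "l2 \<Rightarrow> l2 \<Rightarrow> l2" where
  "minus_l2 u v = u + (- v)"

lift_definition scaleR_l2 :: "real \<Rightarrow> l2 \<Rightarrow> l2" is "\<lambda>r f x. r * f x"
  by (auto intro: square_integrable_scale)

lift_definition inner_l2 :: "l2 \<Rightarrow> l2 \<Rightarrow> real" is "\<lambda>f g. LINT x|halfline. f x * g x"
  by (rule integral_cong_AE)
    (auto simp: square_integrable_def intro: borel_measurable_times)

definition norm_l2 :: "l2 \<Rightarrow> real" where
  "norm_l2 u = sqrt (inner u u)"

definition dist_l2 :: "l2 \<Rightarrow> l2 \<Rightarrow> real" where
  "dist_l2 u v = norm (u - v)"

definition sgn_l2 :: "l2 \<Rightarrow> l2" where
  "sgn_l2 u = inverse (norm u) *\<^sub>R u"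

definition uniformity_l2 :: "(l2 \<times> l2) filter" where
  "uniformity_l2 = (INF e\<in>{0<..}. principal {(u, v). dist u v < e})"

definition open_l2 :: "l2 set \<Rightarrow> bool" where
  "open_l2 U \<longleftrightarrow> (\<forall>u\<in>U. eventually (\<lambda>(u', v). u' = u \<longrightarrow> v \<in> U) uniformity)"

instance
proof
  fix u v w :: l2 and r s :: real
  show "u + v + w = u + (v + w)" "u + v = v + u" "0 + u = u" "- u + u = 0"
    by (transfer, simp add: square_integrable_add square_integrable_zero add_ac)+
  show "u - v = u + (- v)" by (simp add: minus_l2_def)
  show "r *\<^sub>R (u + v) = r *\<^sub>R u + r *\<^sub>R v" "(r + s) *\<^sub>R u = r *\<^sub>R u + s *\<^sub>R u"
    by (transfer, auto intro!: square_integrable_add square_integrable_scale simp: algebra_simps)+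
  show "r *\<^sub>R s *\<^sub>R u = (r * s) *\<^sub>R u" "1 *\<^sub>R u = u"
    by (transfer, auto intro!: square_integrable_scale simp: algebra_simps)+
  show "dist u v = norm (u - v)" by (simp add: dist_l2_def)
  show "sgn u = inverse (norm u) *\<^sub>R u" by (simp add: sgn_l2_def)
  show "(uniformity :: (l2 \<times> l2) filter) = (INF e\<in>{0<..}. principal {(u, v). dist u v < e})"
    by (simp add: uniformity_l2_def)
  show "open U \<longleftrightarrow> (\<forall>u\<in>U. eventually (\<lambda>(u', v). u' = u \<longrightarrow> v \<in> U) uniformity)" for U :: "l2 set"
    by (simp add: open_l2_def)
  show "inner u v = inner v u" by transfer (simp add: mult.commute)
  show "inner (u + v) w = inner u w + inner v w"
    by transfer (simp add: distrib_right square_integrable_mult)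
  show "inner (r *\<^sub>R u) v = r * inner u v"
    by transfer (simp add: mult.assoc square_integrable_mult)
  show "0 \<le> inner u u" by transfer simp
  show "inner u u = 0 \<longleftrightarrow> u = 0"
  proof transfer
    fix f :: "real \<Rightarrow> real"
    assume f: "square_integrable f \<and> square_integrable f \<and> (AE x in halfline. f x = f x)"
    then have "integrable halfline (\<lambda>x. f x * f x)" by (simp add: square_integrable_mult)
    then have "(LINT x|halfline. f x * f x) = 0 \<longleftrightarrow> (AE x in halfline. f x * f x = 0)"
      by (intro integral_nonneg_eq_0_iff_AE) auto
    then show "(LINT x|halfline. f x * f x) = 0 \<longleftrightarrow>
      square_integrable f \<and> square_integrable (\<lambda>x. 0) \<and> (AE x in halfline. f x = 0)"
      using f by (simp add: square_integrable_zero)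
  qed
  show "norm u = sqrt (inner u u)" by (simp add: norm_l2_def)
qed

end

text \<open>The class of a square integrable function (unspecified for other functions).\<close>

definition l2_class :: "(real \<Rightarrow> real) \<Rightarrow> l2" where
  "l2_class f = abs_l2 f"

lift_definition sin_l2 :: "l2 \<Rightarrow> l2" is "\<lambda>f x. sin (f x)"
  by (auto intro: square_integrable_sin)


section \<open>The space $H^1(0,\infty)$\<close>

definition C1_test_function :: "(real \<Rightarrow> real) \<Rightarrow> (real \<Rightarrow> real) \<Rightarrow> bool" where
  "C1_test_function \<phi> \<phi>' \<longleftrightarrow>
     (\<forall>x. (\<phi> has_real_derivative \<phi>' x) (at x)) \<and> continuous_on UNIV \<phi>' \<and>
     (\<exists>a>0. \<exists>b. \<forall>x. x \<notin> {a..b} \<longrightarrow> \<phi> x = 0)"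

text \<open>
  \<open>g\<close> is the weak derivative of \<open>u\<close> on \<open>(0,\<infinity>)\<close>. Test functions of class $C^1_c(0,\infty)$ give the
  same notion as those of class $C^\infty_c(0,\infty)$. The inner products are integrals
  over \<open>(0,\<infinity>)\<close>.
\<close>

definition weak_derivative :: "l2 \<Rightarrow> l2 \<Rightarrow> bool" where
  "weak_derivative u g \<longleftrightarrow>
     (\<forall>\<phi> \<phi>'. C1_test_function \<phi> \<phi>' \<longrightarrow> inner u (l2_class \<phi>') = - inner g (l2_class \<phi>))"

text \<open>
  An element of $H^1(0,\infty)$ is stored as the pair \<open>(u, u')\<close>; as \<open>u'\<close> is determined by \<open>u\<close>, this is
  the subspace of $L^2(0,\infty)$ of functions with a weak derivative in $L^2(0,\infty)$. The inner
  product inherited from the product is $\langle u,v\rangle + \langle u',v'\rangle$.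
\<close>

typedef h1 = "{(u, u'). weak_derivative u u'}"
  by (rule exI[of _ "(0, 0)"]) (simp add: weak_derivative_def)

lifting_forget l2.lifting
setup_lifting type_definition_h1

lift_definition h1_fun :: "h1 \<Rightarrow> l2" is fst .
lift_definition h1_deriv :: "h1 \<Rightarrow> l2" is snd .

instantiation h1 :: real_inner
begin

lift_definition zero_h1 :: h1 is 0
  by (simp add: weak_derivative_def zero_prod_def)

lift_definition plus_h1 :: "h1 \<Rightarrow> h1 \<Rightarrow> h1" is "(+)"
  by (auto simp: weak_derivative_def inner_add_left)

lift_definition uminus_h1 :: "h1 \<Rightarrow> h1" is uminus
  by (auto simp: weak_derivative_def)

lift_definition minus_h1 :: "h1 \<Rightarrow> h1 \<Rightarrow> h1" is "(-)"
  by (auto simp: weak_derivative_def inner_diff_left)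

lift_definition scaleR_h1 :: "real \<Rightarrow> h1 \<Rightarrow> h1" is "scaleR"
  by (auto simp: weak_derivative_def)

lift_definition inner_h1 :: "h1 \<Rightarrow> h1 \<Rightarrow> real" is inner .

definition norm_h1 :: "h1 \<Rightarrow> real" where
  "norm_h1 u = sqrt (inner u u)"

definition dist_h1 :: "h1 \<Rightarrow> h1 \<Rightarrow> real" where
  "dist_h1 u v = norm (u - v)"

definition sgn_h1 :: "h1 \<Rightarrow> h1" where
  "sgn_h1 u = inverse (norm u) *\<^sub>R u"

definition uniformity_h1 :: "(h1 \<times> h1) filter" where
  "uniformity_h1 = (INF e\<in>{0<..}. principal {(u, v). dist u v < e})"

definition open_h1 :: "h1 set \<Rightarrow> bool" where
  "open_h1 U \<longleftrightarrow> (\<forall>u\<in>U. eventually (\<lambda>(u', v). u' = u \<longrightarrow> v \<in> U) uniformity)"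

instance
proof
  fix u v w :: h1 and r s :: real
  show "u + v + w = u + (v + w)" "u + v = v + u" "0 + u = u" "- u + u = 0" "u - v = u + (- v)"
    by (transfer, simp add: add_ac)+
  show "r *\<^sub>R (u + v) = r *\<^sub>R u + r *\<^sub>R v" "(r + s) *\<^sub>R u = r *\<^sub>R u + s *\<^sub>R u"
    by (transfer, simp add: scaleR_add_right scaleR_add_left)+
  show "r *\<^sub>R s *\<^sub>R u = (r * s) *\<^sub>R u" "1 *\<^sub>R u = u"
    by (transfer, simp)+
  show "dist u v = norm (u - v)" by (simp add: dist_h1_def)
  show "sgn u = inverse (norm u) *\<^sub>R u" by (simp add: sgn_h1_def)
  show "(uniformity :: (h1 \<times> h1) filter) = (INF e\<in>{0<..}. principal {(u, v). dist u v < e})"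
    by (simp add: uniformity_h1_def)
  show "open U \<longleftrightarrow> (\<forall>u\<in>U. eventually (\<lambda>(u', v). u' = u \<longrightarrow> v \<in> U) uniformity)" for U :: "h1 set"
    by (simp add: open_h1_def)
  show "inner u v = inner v u" by transfer (simp add: inner_commute)
  show "inner (u + v) w = inner u w + inner v w" by transfer (simp add: inner_add_left)
  show "inner (r *\<^sub>R u) v = r * inner u v" by transfer simp
  show "0 \<le> inner u u" by transfer simp
  show "inner u u = 0 \<longleftrightarrow> u = 0" by transfer (simp only: inner_eq_zero_iff)
  show "norm u = sqrt (inner u u)" by (simp add: norm_h1_def)
qed

end

text \<open>The value \<open>u(0+)\<close>: the limit at \<open>0\<close> of the continuous representative of \<open>u\<close>.\<close>

definition trace0 :: "h1 \<Rightarrow> real" where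
  "trace0 u = (THE a. \<exists>f. square_integrable f \<and> l2_class f = h1_fun u \<and>
                 continuous_on {0<..} f \<and> (f \<longlongrightarrow> a) (at_right 0))"


section \<open>The sine-Gordon system on the tricrystal junction\<close>

text \<open>
  The three edges are indexed by the elements \<open>1\<close>, \<open>2\<close>, \<open>3\<close> of the numeral type \<open>3\<close>. The norms on
  vectors and on pairs are the Euclidean ones, that is, those of the Hilbert space direct sums.
\<close>

type_synonym L2Y = "l2 ^ 3"
type_synonym H1Y = "h1 ^ 3"
type_synonym X = "H1Y \<times> L2Y"

definition funY :: "H1Y \<Rightarrow> L2Y" where
  "funY u = (\<chi> j. h1_fun (u $ j))"

definition derivY :: "H1Y \<Rightarrow> L2Y" where
  "derivY u = (\<chi> j. h1_deriv (u $ j))"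

text \<open>
  Unbounded operators are given by their graphs. In \<open>T_op\<close>, \<open>p\<close> is the derivative of \<open>v\<close> as an
  element of $H^1(\mathcal Y)$, so that \<open>v\<close> is in $H^2(\mathcal Y)$ and \<open>derivY p\<close> is its second
  derivative.
\<close>

definition T_op :: "real ^ 3 \<Rightarrow> real \<Rightarrow> (L2Y \<times> L2Y) set" where
  "T_op c lam = {(funY v, (\<chi> j. - ((c $ j)\<^sup>2 *\<^sub>R (derivY p $ j)))) | v p.
     funY p = derivY v \<and>
     c $ 1 * trace0 (p $ 1) = c $ 2 * trace0 (p $ 2) \<and>
     c $ 2 * trace0 (p $ 2) = c $ 3 * trace0 (p $ 3) \<and>
     (\<Sum>j\<in>UNIV. c $ j * trace0 (v $ j)) = lam * c $ 1 * trace0 (p $ 1)}"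

definition E_op :: "real ^ 3 \<Rightarrow> real \<Rightarrow> ((L2Y \<times> L2Y) \<times> (L2Y \<times> L2Y)) set" where
  "E_op c lam = {((u, v), (a, v)) | u v a. (u, a) \<in> T_op c lam}"

definition J_op :: "L2Y \<times> L2Y \<Rightarrow> L2Y \<times> L2Y" where
  "J_op = (\<lambda>(a, b). (b, - a))"

definition embX :: "X \<Rightarrow> L2Y \<times> L2Y" where
  "embX = (\<lambda>(u, v). (funY u, v))"

text \<open>
  $JE$ as an operator in $H^1(\mathcal Y)\times L^2(\mathcal Y)$. As $JE(u,v) = (v,-\mathcal T_\lambda u)$,
  requiring the value to lie in this space amounts to \<open>v\<close> being in $H^1(\mathcal Y)$, so the domain
  is $D(\mathcal T_\lambda)\times H^1(\mathcal Y)$.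
\<close>

definition JE :: "real ^ 3 \<Rightarrow> real \<Rightarrow> (X \<times> X) set" where
  "JE c lam = {(w, z). \<exists>y. (embX w, y) \<in> E_op c lam \<and> embX z = J_op y}"

definition F :: "X \<Rightarrow> X" where
  "F = (\<lambda>(u, v). (0, \<chi> j. - sin_l2 (h1_fun (u $ j))))"


section \<open>Semigroups, mild solutions, and maps of class $C^2$\<close>

text \<open>Only the values of \<open>W\<close> on \<open>[0,\<infinity>)\<close> matter.\<close>

definition C0_semigroup :: "(real \<Rightarrow> 'a \<Rightarrow>\<^sub>L 'a::real_normed_vector) \<Rightarrow> bool" where
  "C0_semigroup W \<longleftrightarrow>
     W 0 = id_blinfun \<and> (\<forall>s\<ge>0. \<forall>t\<ge>0. W (s + t) = W s o\<^sub>L W t) \<and>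
     (\<forall>x. continuous_on {0..} (\<lambda>t. W t x))"

definition generator :: "(real \<Rightarrow> 'a \<Rightarrow>\<^sub>L 'a::real_normed_vector) \<Rightarrow> ('a \<times> 'a) set" where
  "generator W = {(x, y). ((\<lambda>t. (W t x - x) /\<^sub>R t) \<longlongrightarrow> y) (at_right 0)}"

definition generates :: "('a \<times> 'a) set \<Rightarrow> (real \<Rightarrow> 'a \<Rightarrow>\<^sub>L 'a::real_normed_vector) \<Rightarrow> bool" where
  "generates A W \<longleftrightarrow> C0_semigroup W \<and> generator W = A"

text \<open>
  $C([0,T];X)$ with the supremum norm, realised isometrically inside the bounded continuous functions
  on the real line by extending a path to be constant on each side of \<open>[0,T]\<close>.
\<close>

definition C_path :: "real \<Rightarrow> (real \<Rightarrow>\<^sub>C 'a::real_normed_vector) set" where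
  "C_path T = {w. \<forall>t. apply_bcontfun w t = apply_bcontfun w (max 0 (min t T))}"

text \<open>Solutions of $w_t = Aw + f(w)$ on \<open>[0,T]\<close>, with \<open>W\<close> the semigroup generated by \<open>A\<close>.\<close>

definition solution_on ::
  "(real \<Rightarrow> 'a \<Rightarrow>\<^sub>L 'a::real_normed_vector) \<Rightarrow> ('a \<Rightarrow> 'a) \<Rightarrow> real \<Rightarrow> (real \<Rightarrow>\<^sub>C 'a) \<Rightarrow> bool" where
  "solution_on W f T w \<longleftrightarrow> w \<in> C_path T \<and>
     (\<forall>t\<in>{0..T}. ((\<lambda>s. W (t - s) (f (apply_bcontfun w s))) has_integral
        (apply_bcontfun w t - W t (apply_bcontfun w 0))) {0..t})"

definition C2_map :: "('a::real_normed_vector \<Rightarrow> 'b::real_normed_vector) \<Rightarrow> bool" where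
  "C2_map f \<longleftrightarrow>
     (\<exists>(f' :: 'a \<Rightarrow> 'a \<Rightarrow>\<^sub>L 'b) (f'' :: 'a \<Rightarrow> 'a \<Rightarrow>\<^sub>L ('a \<Rightarrow>\<^sub>L 'b)).
        (\<forall>x. (f has_derivative blinfun_apply (f' x)) (at x)) \<and>
        (\<forall>x. (f' has_derivative blinfun_apply (f'' x)) (at x)) \<and>
        continuous_on UNIV f'')"

end

theory Submission
  imports Defs
begin

text \<open>
  $\mathcal T_\lambda$ is the operator of the symmetric form
  $\sum_j c_j^2\langle u_j',\varphi_j'\rangle+\frac1\lambda\big(\sum_j c_ju_j(0+)\big)\big(\sum_j c_j\varphi_j(0+)\big)$
  on $H^1(\mathcal Y)$: the vertex conditions are its natural boundary conditions. Since
  $u(0+)^2=-2\langle u,u'\rangle$, the form is coercive up to a multiple of the $L^2$ norm, so $JE$ is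
  quasi-dissipative with full range for an energy inner product equivalent to that of
  $H^1(\mathcal Y)\times L^2(\mathcal Y)$, and the Yosida approximation gives the semigroup.

  For the semilinear equation only the $C_0$-semigroup property matters. As $H^1(0,\infty)$ embeds into the
  bounded functions, \<open>F\<close> is of class $C^2$ with globally bounded and Lipschitz derivatives, hence so is the
  substitution operator $w\mapsto F\circ w$ on bounded continuous functions. Duhamel's formula is a fixed point
  equation $w=L\Psi+K(w)$ with \<open>L\<close> bounded linear and, for small \<open>T\<close>, $\|K'\|\le\frac12$. The
  derivatives of $\Psi\mapsto w$ solve linear fixed point equations $A=B+K'(w)A$ of the same kind in spaces of
  bounded operators.
\<close>

section \<open>Fixed points depending smoothly on a parameter\<close>

text \<open>Two obstacles shape the proof. The vertex term of the form carries the factor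
  1/\<lambda>. For \<lambda> = 0 the condition that the sum of the \<open>c $ j * v_j(0+)\<close>
  vanishes survives limits in H^1, so the domain of \<open>JE\<close> is not dense and no
  C_0-semigroup has it as its generator. Hence generation is proved for \<lambda> \<noteq> 0, while
  well-posedness is proved for every semigroup that \<open>JE\<close> generates. The sine is not
  Frechet differentiable as a substitution operator of L^2 into itself. Differentiability comes from
  measuring one factor of the Taylor remainder in the sup norm and the other in L^2, which is
  possible because the first component lives in H^1. As all bounds on the nonlinearity are global,
  one existence time serves all initial data, and the solution map is a total function on the phase
  space. The energy is only equivalent to the given norm; semigroup estimates are therefore made for
  a bilinear form and translated to the norm at the price of a constant factor.\<close>

definition blinfun_precomp :: "('a::real_normed_vector \<Rightarrow>\<^sub>L 'b::real_normed_vector) \<Rightarrow> ('b \<Rightarrow>\<^sub>L 'c::real_normed_vector) \<Rightarrow>\<^sub>L ('a \<Rightarrow>\<^sub>L 'c)"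
  where "blinfun_precomp A = Blinfun (\<lambda>T. T o\<^sub>L A)"

definition blinfun_postcomp :: "('b::real_normed_vector \<Rightarrow>\<^sub>L 'c::real_normed_vector) \<Rightarrow> ('a::real_normed_vector \<Rightarrow>\<^sub>L 'b) \<Rightarrow>\<^sub>L ('a \<Rightarrow>\<^sub>L 'c)"
  where "blinfun_postcomp T = Blinfun (\<lambda>A. T o\<^sub>L A)"

lemma blinfun_precomp_apply [simp]: "blinfun_precomp A T = T o\<^sub>L A"
  unfolding blinfun_precomp_def
  by (simp add: bounded_linear_Blinfun_apply bounded_bilinear.bounded_linear_left[OF bounded_bilinear_blinfun_compose])

lemma blinfun_postcomp_apply [simp]: "blinfun_postcomp T A = T o\<^sub>L A"
  unfolding blinfun_postcomp_def
  by (simp add: bounded_linear_Blinfun_apply bounded_bilinear.bounded_linear_right[OF bounded_bilinear_blinfun_compose])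

lemma norm_blinfun_precomp: "norm (blinfun_precomp A) \<le> norm A"
  by (rule norm_blinfun_bound) (auto simp: mult.commute norm_blinfun_compose)

lemma norm_blinfun_postcomp: "norm (blinfun_postcomp T) \<le> norm T"
  by (rule norm_blinfun_bound) (auto simp: norm_blinfun_compose)

lemma blinfun_precomp_diff: "blinfun_precomp A - blinfun_precomp B = blinfun_precomp (A - B)"
  by (rule blinfun_eqI)
    (simp add: blinfun.diff_left bounded_bilinear.diff_right[OF bounded_bilinear_blinfun_compose])

lemma blinfun_postcomp_diff: "blinfun_postcomp A - blinfun_postcomp B = blinfun_postcomp (A - B)"
  by (rule blinfun_eqI)
    (simp add: blinfun.diff_left bounded_bilinear.diff_left[OF bounded_bilinear_blinfun_compose])

lemma tendsto_blinfun_precomp: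
  assumes "(f \<longlongrightarrow> A) G"
  shows "((\<lambda>x. blinfun_precomp (f x)) \<longlongrightarrow> blinfun_precomp A) G"
proof (rule LIM_zero_cancel, rule tendsto_norm_zero_cancel, rule tendsto_sandwich[OF _ _ tendsto_const])
  show "\<forall>\<^sub>F x in G. norm (blinfun_precomp (f x) - blinfun_precomp A) \<le> norm (f x - A)"
    by (simp add: blinfun_precomp_diff norm_blinfun_precomp)
  show "((\<lambda>x. norm (f x - A)) \<longlongrightarrow> 0) G"
    using assms by (simp add: LIM_zero tendsto_norm_zero)
qed auto

text \<open>Takes the place of (1 - T)^(-1) B. Differentiating w = L p + K w once or twice leads to
  affine equations of this shape, and the bound 1/2 makes the right-hand side a contraction in
  \<open>A\<close>.\<close>

lemma blinfun_affine_fixpoint_ex: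
  fixes B :: "'p::real_normed_vector \<Rightarrow>\<^sub>L 'e::banach" and T :: "'e \<Rightarrow>\<^sub>L 'e"
  assumes "norm T \<le> 1/2"
  shows "\<exists>A. A = B + (T o\<^sub>L A)"
proof -
  have "\<exists>!A. B + (T o\<^sub>L A) = A"
  proof (rule banach_fix_type[of "1/2"])
    show "\<forall>x y. dist (B + (T o\<^sub>L x)) (B + (T o\<^sub>L y)) \<le> 1 / 2 * dist x y"
    proof (intro allI)
      fix x y :: "'p \<Rightarrow>\<^sub>L 'e"
      have "dist (B + (T o\<^sub>L x)) (B + (T o\<^sub>L y)) = norm (T o\<^sub>L (x - y))"
        by (simp add: dist_norm bounded_bilinear.diff_right[OF bounded_bilinear_blinfun_compose])
      also have "\<dots> \<le> norm T * norm (x - y)" by (rule norm_blinfun_compose)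
      also have "\<dots> \<le> 1/2 * dist x y"
        using assms by (simp add: dist_norm mult_right_mono del: times_divide_eq_left)
      finally show "dist (B + (T o\<^sub>L x)) (B + (T o\<^sub>L y)) \<le> 1 / 2 * dist x y" .
    qed
  qed auto
  then show ?thesis by metis
qed

text \<open>Subtracting the equations gives A1 - A2 = (B1 - B2) + T1 (A1 - A2) + (T1 - T2) A2; the
  middle term is absorbed on the left, which costs the factor 2. The estimate gives continuity of
  both derivatives of the solution map, and the Lipschitz bound needed to differentiate the first
  one.\<close>

lemma blinfun_affine_fixpoint_diff:
  fixes A1 A2 B1 B2 :: "'p::real_normed_vector \<Rightarrow>\<^sub>L 'e::real_normed_vector"
  assumes "norm T1 \<le> 1/2" "A1 = B1 + (T1 o\<^sub>L A1)" "A2 = B2 + (T2 o\<^sub>L A2)"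
  shows "norm (A1 - A2) \<le> 2 * (norm (B1 - B2) + norm (T1 - T2) * norm A2)"
proof -
  have "A1 - A2 = (B1 + (T1 o\<^sub>L A1)) - (B2 + (T2 o\<^sub>L A2))"
    by (rule arg_cong2[where f = "(-)"]) (rule assms)+
  also have "\<dots> = (B1 - B2) + (T1 o\<^sub>L (A1 - A2)) + ((T1 - T2) o\<^sub>L A2)"
    by (simp add: bounded_bilinear.diff_right[OF bounded_bilinear_blinfun_compose]
      bounded_bilinear.diff_left[OF bounded_bilinear_blinfun_compose])
  finally have "A1 - A2 = \<dots>" .
  then have "norm (A1 - A2) \<le> norm (B1 - B2) + norm (T1 o\<^sub>L (A1 - A2)) + norm ((T1 - T2) o\<^sub>L A2)"
    by (metis norm_triangle_mono norm_triangle_ineq order_refl)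
  also have "\<dots> \<le> norm (B1 - B2) + 1/2 * norm (A1 - A2) + norm (T1 - T2) * norm A2"
    using norm_blinfun_compose[of T1 "A1 - A2"] norm_blinfun_compose[of "T1 - T2" A2]
      mult_right_mono[OF assms(1) norm_ge_zero[of "A1 - A2"]] by linarith
  finally show ?thesis by simp
qed

text \<open>The candidate \<open>ds\<close> already solves the linearized equation, so the error r =
  s q - s p - ds (q - p) equals the Taylor remainder of \<open>f\<close> at (q, s q) plus D2 r, and
  half of r is absorbed. The Lipschitz bound turns smallness relative to the joint increment into
  smallness relative to q - p.\<close>

lemma fixpoint_has_derivative:
  fixes f :: "'p::real_normed_vector \<Rightarrow> 'e::real_normed_vector \<Rightarrow> 'e"
  assumes f: "((\<lambda>x. f (fst x) (snd x)) has_derivative (\<lambda>x. D1 (fst x) + D2 (snd x))) (at (p, s p))"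
    and s: "\<And>q. s q = f q (s q)"
    and lip: "\<forall>\<^sub>F q in at p. norm (s q - s p) \<le> C * norm (q - p)"
    and D2: "\<And>k. norm (D2 k) \<le> norm k / 2" "linear D2"
    and ds: "bounded_linear ds" "\<And>h. ds h = D1 h + D2 (ds h)"
  shows "(s has_derivative ds) (at p)"
  unfolding has_derivative_at_alt
proof (intro conjI ds(1) allI impI)
  fix e :: real assume "e > 0"
  define C' where "C' = 1 + \<bar>C\<bar>"
  have C': "C' > 0" "C \<le> C'" by (auto simp: C'_def)
  \<comment> \<open>Absorbing D2 r doubles the error, and the joint increment is at most C' times
    \<open>norm (q - p)\<close>; the divisor 2 C' pays for both.\<close>
  define e' where "e' = e / (2 * C')"
  have "e' > 0" using \<open>e > 0\<close> C' by (simp add: e'_def)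
  with f[unfolded has_derivative_at_alt] obtain d where "d > 0" and d:
    "\<And>y. norm (y - (p, s p)) < d \<Longrightarrow> norm (f (fst y) (snd y) - f p (s p) -
        (D1 (fst (y - (p, s p))) + D2 (snd (y - (p, s p))))) \<le> e' * norm (y - (p, s p))"
    by (metis fst_conv snd_conv)
  obtain d' where "d' > 0" and d': "\<And>q. q \<noteq> p \<Longrightarrow> norm (q - p) < d' \<Longrightarrow> norm (s q - s p) \<le> C * norm (q - p)"
    using lip unfolding eventually_at by (auto simp: dist_norm)
  show "\<exists>d>0. \<forall>y. norm (y - p) < d \<longrightarrow> norm (s y - s p - ds (y - p)) \<le> e * norm (y - p)"
  proof (intro exI[of _ "min d' (d / C')"] conjI allI impI)
    show "min d' (d / C') > 0" using \<open>d > 0\<close> \<open>d' > 0\<close> C' by simp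
    fix q assume "norm (q - p) < min d' (d / C')"
    then have q: "norm (q - p) < d / C'" and q': "norm (q - p) < d'" by auto
    have lip: "norm (s q - s p) \<le> C * norm (q - p)"
      using d'[OF _ q'] by (cases "q = p") auto
    have "norm ((q, s q) - (p, s p)) \<le> norm (q - p) + norm (s q - s p)"
      using norm_Pair_le[of "q - p" "s q - s p"] by simp
    also have "\<dots> \<le> norm (q - p) + C * norm (q - p)" using lip by simp
    also have "\<dots> \<le> norm (q - p) + \<bar>C\<bar> * norm (q - p)" by (simp add: mult_right_mono)
    also have "\<dots> = C' * norm (q - p)" by (simp add: C'_def algebra_simps)
    finally have z: "norm ((q, s q) - (p, s p)) \<le> C' * norm (q - p)" .
    also have "\<dots> < d" using q C' by (simp add: field_simps)
    finally have "norm (f q (s q) - f p (s p) - (D1 (q - p) + D2 (s q - s p))) \<le> e' * norm ((q, s q) - (p, s p))"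
      using d[of "(q, s q)"] by simp
    also have "\<dots> \<le> e' * (C' * norm (q - p))" using z \<open>e' > 0\<close> by simp
    also have "\<dots> = e / 2 * norm (q - p)" using C' by (simp add: e'_def)
    finally have 1: "norm (f q (s q) - f p (s p) - (D1 (q - p) + D2 (s q - s p))) \<le> e / 2 * norm (q - p)" .
    let ?r = "s q - s p - ds (q - p)"
    have "?r = f q (s q) - f p (s p) - (D1 (q - p) + D2 (ds (q - p)))"
      by (rule arg_cong2[where f = "(-)"], rule arg_cong2[where f = "(-)"]) (rule s ds(2))+
    also have "\<dots> = (f q (s q) - f p (s p) - (D1 (q - p) + D2 (s q - s p))) + D2 ?r"
      by (simp add: linear_diff[OF D2(2)])
    finally have "?r = \<dots>" .
    then have "norm ?r \<le> norm (f q (s q) - f p (s p) - (D1 (q - p) + D2 (s q - s p))) + norm (D2 ?r)"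
      by (metis norm_triangle_ineq)
    then show "norm ?r \<le> e * norm (q - p)"
      using 1 D2(1)[of ?r] by simp
  qed
qed

text \<open>\<open>fixpoint_has_derivative\<close> is used for \<open>S\<close> and then for
  \<open>S'\<close>, which is itself the fixed point of A \<mapsto> L + K'(S q) A with parameter q.
  The same bound on \<open>K'\<close> serves both times, because the linearization in A is
  composition with K'(S p).\<close>

theorem fixpoint_C2_map:
  fixes L :: "'p::real_normed_vector \<Rightarrow>\<^sub>L 'e::banach" and K :: "'e \<Rightarrow> 'e"
  assumes K': "\<And>x. (K has_derivative blinfun_apply (K' x)) (at x)"
    and K'': "\<And>x. (K' has_derivative blinfun_apply (K'' x)) (at x)"
    and cont: "continuous_on UNIV K''"
    and small: "\<And>x. norm (K' x) \<le> 1/2"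
    and S: "\<And>p. S p = L p + K (S p)"
  shows "C2_map S"
proof -
  have lipK: "norm (K x - K y) \<le> 1/2 * norm (x - y)" for x y
    by (rule differentiable_bound[of UNIV K "\<lambda>x. blinfun_apply (K' x)"])
      (use K' small in \<open>auto simp: norm_blinfun.rep_eq\<close>)
  have lipS: "norm (S q - S p) \<le> (2 * norm L) * norm (q - p)" for p q
  proof -
    have "S q - S p = (L q + K (S q)) - (L p + K (S p))"
      by (rule arg_cong2[where f = "(-)"]) (rule S)+
    also have "\<dots> = L (q - p) + (K (S q) - K (S p))"
      by (simp add: blinfun.diff_right)
    finally have "S q - S p = \<dots>" .
    then have "norm (S q - S p) \<le> norm (L (q - p)) + norm (K (S q) - K (S p))"
      by (metis norm_triangle_ineq)
    then show ?thesis using lipK[of "S q" "S p"] norm_blinfun[of L "q - p"] by simp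
  qed
  have "\<forall>p. \<exists>A. A = L + (K' (S p) o\<^sub>L A)"
    using blinfun_affine_fixpoint_ex[OF small] by blast
  from choice[OF this] obtain S' where "\<forall>p. S' p = L + (K' (S p) o\<^sub>L S' p)" ..
  note S' = this[rule_format]
  have dS: "(S has_derivative blinfun_apply (S' p)) (at p)" for p
  proof (rule fixpoint_has_derivative[where f = "\<lambda>q w. L q + K w" and ?D1.0 = "blinfun_apply L"
        and ?D2.0 = "blinfun_apply (K' (S p))"])
    have K2: "((\<lambda>x. K (snd x)) has_derivative (\<lambda>x. K' (S p) (snd x))) (at (p, S p))"
      by (rule has_derivative_compose[of snd snd "(p, S p)" UNIV K, simplified]) (use K' in \<open>auto intro!: derivative_eq_intros\<close>)
    show "((\<lambda>x. L (fst x) + K (snd x)) has_derivative (\<lambda>x. L (fst x) + K' (S p) (snd x))) (at (p, S p))"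
      by (intro has_derivative_add K2 bounded_linear.has_derivative[OF blinfun.bounded_linear_right]
         has_derivative_fst has_derivative_ident)
    show "norm (K' (S p) k) \<le> norm k / 2" for k
      using norm_blinfun[of "K' (S p)" k] mult_right_mono[OF small[of "S p"] norm_ge_zero[of k]] by simp
    show "linear (blinfun_apply (K' (S p)))"
      by (intro blinfun.bounded_linear_right bounded_linear.linear)
    show "S' p h = L h + K' (S p) (S' p h)" for h
      by (subst S') (simp add: blinfun.add_left)
  qed (use S lipS blinfun.bounded_linear_right in \<open>auto intro: always_eventually\<close>)
  have contS: "continuous_on UNIV S"
    by (meson dS continuous_at_imp_continuous_on has_derivative_continuous)
  have "continuous_on UNIV K'"
    by (meson K'' continuous_at_imp_continuous_on has_derivative_continuous)
  then have contK'S: "continuous_on UNIV (\<lambda>p. K' (S p))"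
    using contS continuous_on_compose2 by blast
  have dK'S: "((\<lambda>p. K' (S p)) has_derivative (\<lambda>h. K'' (S p) (S' p h))) (at p)" for p
    by (rule has_derivative_compose[OF dS K''])
  define B where "B p = blinfun_precomp (S' p) o\<^sub>L (K'' (S p) o\<^sub>L S' p)" for p
  have T: "norm (blinfun_postcomp (K' (S p)) :: ('p \<Rightarrow>\<^sub>L 'e) \<Rightarrow>\<^sub>L ('p \<Rightarrow>\<^sub>L 'e)) \<le> 1/2" for p
    using norm_blinfun_postcomp small order_trans by blast
  have "\<forall>p. \<exists>A. A = B p + (blinfun_postcomp (K' (S p)) o\<^sub>L A)"
    using blinfun_affine_fixpoint_ex[OF T] by blast
  from choice[OF this] obtain S'' where "\<forall>p. S'' p = B p + (blinfun_postcomp (K' (S p)) o\<^sub>L S'' p)" ..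
  note S'' = this[rule_format]
  have S'cont: "(S' \<longlongrightarrow> S' p) (at p)" for p
  proof (rule LIM_zero_cancel, rule tendsto_norm_zero_cancel, rule tendsto_sandwich[OF _ _ tendsto_const])
    show "\<forall>\<^sub>F q in at p. norm (S' q - S' p) \<le> 2 * (norm (K' (S q) - K' (S p)) * norm (S' p))"
      using blinfun_affine_fixpoint_diff[OF small S' S'] by auto
    have "((\<lambda>q. K' (S q)) \<longlongrightarrow> K' (S p)) (at p)"
      using contK'S by (simp add: continuous_on_def)
    then show "((\<lambda>q. 2 * (norm (K' (S q) - K' (S p)) * norm (S' p))) \<longlongrightarrow> 0) (at p)"
      by (intro tendsto_mult_right_zero tendsto_mult_left_zero tendsto_norm_zero LIM_zero)
  qed auto
  have dS': "(S' has_derivative blinfun_apply (S'' p)) (at p)" for p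
  proof -
    let ?g = "\<lambda>q. K' (S q)" and ?D = "\<lambda>h. K'' (S p) (S' p h)"
    \<comment> \<open>\<open>K''\<close> carries no global bound here, so the Lipschitz estimate is
      local: the first-order expansion of q \<mapsto> K'(S q) at p with tolerance 1 yields the
      constant 1 + \<open>onorm ?D\<close>.\<close>
    have "\<forall>\<^sub>F q in at p. norm (S' q - S' p) \<le> 2 * ((1 + onorm ?D) * norm (S' p)) * norm (q - p)"
    proof -
      have bl: "bounded_linear ?D" using dK'S has_derivative_bounded_linear by blast
      obtain d where "d > 0" and d: "\<And>q. norm (q - p) < d \<Longrightarrow> norm (?g q - ?g p - ?D (q - p)) \<le> 1 * norm (q - p)"
        using dK'S[of p] unfolding has_derivative_at_alt by (meson zero_less_one)
      have "norm (S' q - S' p) \<le> 2 * ((1 + onorm ?D) * norm (S' p)) * norm (q - p)" if "norm (q - p) < d" for q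
      proof -
        have "norm (?g q - ?g p) \<le> norm (?g q - ?g p - ?D (q - p)) + norm (?D (q - p))"
          using norm_triangle_ineq[of "?g q - ?g p - ?D (q - p)" "?D (q - p)"] by simp
        also have "\<dots> \<le> (1 + onorm ?D) * norm (q - p)"
          using d[OF that] onorm[OF bl, of "q - p"] by (simp add: algebra_simps)
        finally have "norm (?g q - ?g p) * norm (S' p) \<le> (1 + onorm ?D) * norm (q - p) * norm (S' p)"
          by (rule mult_right_mono) simp
        moreover have "norm (S' q - S' p) \<le> 2 * (norm (L - L) + norm (?g q - ?g p) * norm (S' p))"
          by (rule blinfun_affine_fixpoint_diff[OF small S' S'])
        ultimately show ?thesis by (simp add: mult_ac)
      qed
      then show ?thesis using \<open>d > 0\<close> unfolding eventually_at by (auto simp: dist_norm)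
    qed
    note lipS' = this
    show ?thesis
    proof (rule fixpoint_has_derivative[where f = "\<lambda>q A. L + (K' (S q) o\<^sub>L A)" and ?D1.0 = "blinfun_apply (B p)"
        and ?D2.0 = "\<lambda>A. K' (S p) o\<^sub>L A", OF _ _ lipS'])
      have 1: "((\<lambda>x. K' (S (fst x))) has_derivative (\<lambda>x. K'' (S p) (S' p (fst x)))) (at (p, S' p))"
        by (rule has_derivative_compose[of fst fst "(p, S' p)" UNIV "\<lambda>q. K' (S q)", simplified])
          (use dK'S in \<open>auto intro!: derivative_eq_intros\<close>)
      have 2: "(snd has_derivative snd) (at (p, S' p))" by (auto intro!: derivative_eq_intros)
      show "((\<lambda>x. L + (K' (S (fst x)) o\<^sub>L snd x)) has_derivative
          (\<lambda>x. B p (fst x) + (K' (S p) o\<^sub>L snd x))) (at (p, S' p))"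
        using has_derivative_add[OF has_derivative_const bounded_bilinear.FDERIV[OF bounded_bilinear_blinfun_compose 1 2]]
        by (simp add: B_def add.commute)
      show "norm (K' (S p) o\<^sub>L A) \<le> norm A / 2" for A :: "'p \<Rightarrow>\<^sub>L 'e"
        using norm_blinfun_compose[of "K' (S p)" A] mult_right_mono[OF small[of "S p"] norm_ge_zero[of A]] by simp
      show "linear ((o\<^sub>L) (K' (S p)))"
        by (simp add: bounded_bilinear.bounded_linear_right[OF bounded_bilinear_blinfun_compose] bounded_linear.linear)
      show "S'' p h = B p h + (K' (S p) o\<^sub>L S'' p h)" for h
        by (subst S'') (simp add: blinfun.add_left)
    qed (use S' blinfun.bounded_linear_right in auto)
  qed
  have "continuous_on UNIV S''"
    unfolding continuous_on_def
  proof
    fix p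
    have BB: "(B \<longlongrightarrow> B p) (at p)"
    proof -
      have "((\<lambda>q. K'' (S q)) \<longlongrightarrow> K'' (S p)) (at p)"
        using continuous_on_compose2[OF cont contS] by (simp add: continuous_on_def)
      then show ?thesis unfolding B_def
        by (intro bounded_bilinear.tendsto[OF bounded_bilinear_blinfun_compose] tendsto_blinfun_precomp S'cont)
    qed
    have "((\<lambda>q. K' (S q)) \<longlongrightarrow> K' (S p)) (at p)"
      using contK'S by (simp add: continuous_on_def)
    with BB have lim: "((\<lambda>q. 2 * (norm (B q - B p) + norm (K' (S q) - K' (S p)) * norm (S'' p))) \<longlongrightarrow> 0) (at p)"
      by (intro tendsto_mult_right_zero tendsto_add_zero tendsto_mult_left_zero tendsto_norm_zero LIM_zero)
    show "(S'' \<longlongrightarrow> S'' p) (at p within UNIV)"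
    proof (rule LIM_zero_cancel, rule tendsto_norm_zero_cancel, rule tendsto_sandwich[OF _ _ tendsto_const lim])
      show "\<forall>\<^sub>F q in at p. norm (S'' q - S'' p) \<le> 2 * (norm (B q - B p) + norm (K' (S q) - K' (S p)) * norm (S'' p))"
      proof (rule always_eventually, rule allI)
        fix q
        have "norm (S'' q - S'' p) \<le> 2 * (norm (B q - B p) +
            norm (blinfun_postcomp (K' (S q)) - (blinfun_postcomp (K' (S p)) :: ('p \<Rightarrow>\<^sub>L 'e) \<Rightarrow>\<^sub>L ('p \<Rightarrow>\<^sub>L 'e))) * norm (S'' p))"
          by (rule blinfun_affine_fixpoint_diff[OF T S'' S''])
        also have "\<dots> \<le> 2 * (norm (B q - B p) + norm (K' (S q) - K' (S p)) * norm (S'' p))"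
          unfolding blinfun_postcomp_diff
          by (intro mult_left_mono add_left_mono mult_right_mono norm_blinfun_postcomp) auto
        finally show "norm (S'' q - S'' p) \<le> 2 * (norm (B q - B p) + norm (K' (S q) - K' (S p)) * norm (S'' p))" .
      qed
    qed auto
  qed
  with dS dS' show ?thesis unfolding C2_map_def by blast
qed

section \<open>Substitution operators on bounded continuous functions\<close>

text \<open>The quadratic remainders and the Lipschitz bound are global, so that the class is stable under
  substitution into bounded continuous functions on a noncompact space.\<close>

definition C2_bounded ::
  "('a::real_normed_vector \<Rightarrow> 'b::real_normed_vector) \<Rightarrow> ('a \<Rightarrow> 'a \<Rightarrow>\<^sub>L 'b) \<Rightarrow> ('a \<Rightarrow> 'a \<Rightarrow>\<^sub>L 'a \<Rightarrow>\<^sub>L 'b) \<Rightarrow> real \<Rightarrow> bool"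
  where "C2_bounded f f' f'' C \<longleftrightarrow>
     (\<forall>x h. norm (f (x + h) - f x - f' x h) \<le> C * (norm h)\<^sup>2) \<and>
     (\<forall>x h. norm (f' (x + h) - f' x - f'' x h) \<le> C * (norm h)\<^sup>2) \<and>
     (\<forall>x y. norm (f'' x - f'' y) \<le> C * norm (x - y)) \<and>
     (\<forall>x. norm (f' x) \<le> C) \<and> (\<forall>x. norm (f'' x) \<le> C)"

lemma C2_boundedD:
  fixes f :: "'a::real_normed_vector \<Rightarrow> 'b::real_normed_vector"
  assumes "C2_bounded f f' f'' C"
  shows "norm (f (x + h) - f x - f' x h) \<le> C * (norm h)\<^sup>2"
    and "norm (f' (x + h) - f' x - f'' x h) \<le> C * (norm h)\<^sup>2"
    and "norm (f'' x - f'' y) \<le> C * norm (x - y)" and "norm (f' x) \<le> C" and "norm (f'' x) \<le> C"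
  using assms unfolding C2_bounded_def by blast+

lemma has_derivative_quadratic_remainder:
  fixes f :: "'a::real_normed_vector \<Rightarrow> 'b::real_normed_vector"
  assumes "\<And>h. norm (f (x + h) - f x - f' h) \<le> C * (norm h)\<^sup>2" "bounded_linear f'"
  shows "(f has_derivative f') (at x)"
  unfolding has_derivative_at_alt
proof (intro conjI assms(2) allI impI)
  fix e :: real assume "e > 0"
  show "\<exists>d>0. \<forall>y. norm (y - x) < d \<longrightarrow> norm (f y - f x - f' (y - x)) \<le> e * norm (y - x)"
  proof (intro exI[of _ "e / (\<bar>C\<bar> + 1)"] conjI allI impI)
    show "e / (\<bar>C\<bar> + 1) > 0" using \<open>e > 0\<close> by simp
    fix y assume y: "norm (y - x) < e / (\<bar>C\<bar> + 1)"
    have "(\<bar>C\<bar> + 1) * norm (y - x) \<le> e"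
      using y by (simp add: field_simps)
    moreover have "C * norm (y - x) \<le> (\<bar>C\<bar> + 1) * norm (y - x)"
      by (intro mult_right_mono) auto
    ultimately have "C * norm (y - x) * norm (y - x) \<le> e * norm (y - x)"
      by (intro mult_right_mono) auto
    then show "norm (f y - f x - f' (y - x)) \<le> e * norm (y - x)"
      using assms(1)[of "y - x"] by (simp add: power2_eq_square mult.assoc)
  qed
qed

lemma C2_bounded_nonneg: "C2_bounded f f' f'' C \<Longrightarrow> 0 \<le> C"
  unfolding C2_bounded_def using norm_ge_zero order_trans by blast

lemma C2_bounded_has_derivative:
  fixes f :: "'a::real_normed_vector \<Rightarrow> 'b::real_normed_vector"
  assumes "C2_bounded f f' f'' C"
  shows "(f has_derivative blinfun_apply (f' x)) (at x)" "(f' has_derivative blinfun_apply (f'' x)) (at x)"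
  using assms unfolding C2_bounded_def
  by (auto intro!: has_derivative_quadratic_remainder[where C = C] blinfun.bounded_linear_right)

lemma C2_bounded_lipschitz:
  fixes f :: "'a::real_normed_vector \<Rightarrow> 'b::real_normed_vector"
  assumes "C2_bounded f f' f'' C"
  shows "norm (f x - f y) \<le> C * norm (x - y)" "norm (f' x - f' y) \<le> C * norm (x - y)"
proof -
  have D: "norm (f' x) \<le> C" "norm (f'' x) \<le> C" for x using assms by (auto simp: C2_bounded_def)
  show "norm (f x - f y) \<le> C * norm (x - y)"
    by (rule differentiable_bound[of UNIV f "\<lambda>x. blinfun_apply (f' x)"])
      (use C2_bounded_has_derivative[OF assms] D in \<open>auto simp: norm_blinfun.rep_eq[symmetric]\<close>)
  show "norm (f' x - f' y) \<le> C * norm (x - y)"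
    by (rule differentiable_bound[of UNIV f' "\<lambda>x. blinfun_apply (f'' x)"])
      (use C2_bounded_has_derivative[OF assms] D in \<open>auto simp: norm_blinfun.rep_eq[symmetric]\<close>)
qed

lemma continuous_on_lipschitz:
  fixes f :: "'a::real_normed_vector \<Rightarrow> 'b::real_normed_vector"
  assumes "\<And>x y. norm (f x - f y) \<le> C * norm (x - y)"
  shows "continuous_on S f"
proof -
  have "continuous_on UNIV f" unfolding continuous_on_def
  proof
    fix x :: 'a
    have "((\<lambda>y. C * norm (y - x)) \<longlongrightarrow> 0) (at x)"
      by (intro tendsto_mult_right_zero tendsto_norm_zero LIM_zero tendsto_ident_at)
    then have "((\<lambda>y. f y - f x) \<longlongrightarrow> 0) (at x)"
      by (rule Lim_null_comparison[rotated]) (use assms in auto)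
    then show "(f \<longlongrightarrow> f x) (at x within UNIV)"
      by (rule LIM_zero_cancel)
  qed
  then show ?thesis using continuous_on_subset by blast
qed

lemma C2_bounded_continuous_on:
  fixes f :: "'a::real_normed_vector \<Rightarrow> 'b::real_normed_vector"
  assumes "C2_bounded f f' f'' C"
  shows "continuous_on S f" "continuous_on S f'" "continuous_on S f''"
proof -
  have "norm (f'' x - f'' y) \<le> C * norm (x - y)" for x y using assms by (auto simp: C2_bounded_def)
  then show "continuous_on S f''" by (rule continuous_on_lipschitz)
qed (rule continuous_on_lipschitz, rule C2_bounded_lipschitz[OF assms])+

lemma C2_bounded_blinfun:
  fixes V :: "'b::real_normed_vector \<Rightarrow>\<^sub>L 'c::real_normed_vector"
  assumes f: "C2_bounded f f' f'' C"
  shows "C2_bounded (\<lambda>x. V (f x)) (\<lambda>x. V o\<^sub>L f' x) (\<lambda>x. blinfun_postcomp V o\<^sub>L f'' x) (norm V * C)"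
  unfolding C2_bounded_def
proof (intro conjI allI)
  have C: "norm (V z) \<le> norm V * D" if "norm z \<le> D" for z :: 'b and D
    using norm_blinfun[of V z] mult_left_mono[OF that norm_ge_zero[of V]] by linarith
  have C': "norm (V o\<^sub>L z) \<le> norm V * D" if "norm z \<le> D" for z :: "'a \<Rightarrow>\<^sub>L 'b" and D
    using norm_blinfun_compose[of V z] mult_left_mono[OF that norm_ge_zero[of V]] by linarith
  have C'': "norm (blinfun_postcomp V o\<^sub>L z) \<le> norm V * D" if "norm z \<le> D" for z :: "'a \<Rightarrow>\<^sub>L ('a \<Rightarrow>\<^sub>L 'b)" and D
    by (rule norm_blinfun_compose[THEN order_trans], rule mult_mono[OF norm_blinfun_postcomp that]) auto
  note D = C2_boundedD[OF f]
  fix x h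
  show "norm (V (f (x + h)) - V (f x) - (V o\<^sub>L f' x) h) \<le> norm V * C * (norm h)\<^sup>2"
    using C[OF D(1)[of x h]] by (simp add: blinfun.diff_right mult.assoc)
  show "norm ((V o\<^sub>L f' (x + h)) - (V o\<^sub>L f' x) - (blinfun_postcomp V o\<^sub>L f'' x) h) \<le> norm V * C * (norm h)\<^sup>2"
    using C'[OF D(2)[of x h]]
    by (simp add: bounded_bilinear.diff_right[OF bounded_bilinear_blinfun_compose] mult.assoc)
  show "norm ((blinfun_postcomp V o\<^sub>L f'' x) - (blinfun_postcomp V o\<^sub>L f'' h)) \<le> norm V * C * norm (x - h)"
    using C''[OF D(3)[of x h]]
    by (simp add: bounded_bilinear.diff_right[OF bounded_bilinear_blinfun_compose] mult.assoc)
  show "norm (V o\<^sub>L f' x) \<le> norm V * C" by (rule C'[OF D(4)])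
  show "norm (blinfun_postcomp V o\<^sub>L f'' x) \<le> norm V * C" by (rule C''[OF D(5)])
qed

text \<open>The derivative of substitution by f at w is pointwise application of f' o w. Having this
  product as a bounded linear map in each argument allows the second derivative to be written as a
  composition of two copies of it.\<close>

definition bcontfun_app :: "('t::topological_space \<Rightarrow>\<^sub>C ('a::real_normed_vector \<Rightarrow>\<^sub>L 'b::real_normed_vector)) \<Rightarrow>\<^sub>L ('t \<Rightarrow>\<^sub>C 'a) \<Rightarrow>\<^sub>L ('t \<Rightarrow>\<^sub>C 'b)"
  where "bcontfun_app = Blinfun (\<lambda>g. Blinfun (\<lambda>h. Bcontfun (\<lambda>t. blinfun_apply (apply_bcontfun g t) (apply_bcontfun h t))))"

lemma bcontfun_app:
  fixes g :: "'t::topological_space \<Rightarrow>\<^sub>C ('a::real_normed_vector \<Rightarrow>\<^sub>L 'b::real_normed_vector)"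
    and h :: "'t \<Rightarrow>\<^sub>C 'a"
  shows bcontfun_app_apply [simp]: "apply_bcontfun (blinfun_apply (blinfun_apply bcontfun_app g) h) t = g t (h t)"
    and norm_bcontfun_app: "norm (bcontfun_app g) \<le> norm g"
    and norm_bcontfun_app1: "norm (bcontfun_app :: ('t \<Rightarrow>\<^sub>C ('a \<Rightarrow>\<^sub>L 'b)) \<Rightarrow>\<^sub>L _) \<le> 1"
proof -
  have nb: "norm (g t (h t)) \<le> norm g * norm h"
    for g :: "'t \<Rightarrow>\<^sub>C ('a \<Rightarrow>\<^sub>L 'b)" and h :: "'t \<Rightarrow>\<^sub>C 'a" and t
    using norm_blinfun[of "g t" "h t"] mult_mono[OF norm_bounded[of g t] norm_bounded[of h t]] by auto
  have mem: "(\<lambda>t. g t (h t)) \<in> bcontfun" for g :: "'t \<Rightarrow>\<^sub>C ('a \<Rightarrow>\<^sub>L 'b)" and h :: "'t \<Rightarrow>\<^sub>C 'a"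
    by (rule bcontfun_normI[OF _ nb])
      (intro bounded_bilinear.continuous_on[OF bounded_bilinear_blinfun_apply] continuous_on_apply_bcontfun)
  define P where "P g h = Bcontfun (\<lambda>t::'t. blinfun_apply (apply_bcontfun g t :: 'a \<Rightarrow>\<^sub>L 'b) (apply_bcontfun h t))" for g h
  have app: "apply_bcontfun (P g h) t = g t (h t)" for g :: "'t \<Rightarrow>\<^sub>C ('a \<Rightarrow>\<^sub>L 'b)" and h t
    using mem by (simp add: P_def Bcontfun_inverse)
  have nP: "norm (P g h) \<le> norm g * norm h" for g h
    by (rule norm_bound) (simp add: app nb)
  have bb: "bounded_bilinear P"
  proof
    show "\<exists>K. \<forall>g h. norm (P g h) \<le> norm g * norm h * K"
      by (intro exI[of _ 1]) (simp add: nP)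
  qed (rule bcontfun_eqI, simp add: app blinfun.add_left blinfun.add_right blinfun.scaleR_left blinfun.scaleR_right)+
  have inner: "blinfun_apply (Blinfun (P g)) h = P g h" for g h
    using bounded_bilinear.bounded_linear_right[OF bb] by (simp add: bounded_linear_Blinfun_apply)
  have nPg: "norm (Blinfun (P g)) \<le> norm g" for g
    by (rule norm_blinfun_bound) (auto simp: inner nP)
  have "bounded_linear (\<lambda>g. Blinfun (P g))"
  proof (rule bounded_linear_intro[where K = 1])
    show "Blinfun (P (x + y)) = Blinfun (P x) + Blinfun (P y)" for x y
      by (rule blinfun_eqI) (simp add: inner blinfun.add_left bounded_bilinear.add_left[OF bb])
    show "Blinfun (P (r *\<^sub>R x)) = r *\<^sub>R Blinfun (P x)" for r x
      by (rule blinfun_eqI) (simp add: inner blinfun.scaleR_left bounded_bilinear.scaleR_left[OF bb])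
  qed (simp add: nPg)
  then have outer: "bcontfun_app g = Blinfun (P g)" for g
    unfolding bcontfun_app_def P_def[symmetric] by (simp add: bounded_linear_Blinfun_apply)
  show "apply_bcontfun (blinfun_apply (blinfun_apply bcontfun_app g) h) t = g t (h t)"
    by (simp add: outer inner app)
  have **: "norm (bcontfun_app g) \<le> norm g" for g :: "'t \<Rightarrow>\<^sub>C ('a \<Rightarrow>\<^sub>L 'b)"
    by (simp add: outer nPg)
  then show "norm (bcontfun_app g) \<le> norm g" .
  show "norm (bcontfun_app :: ('t \<Rightarrow>\<^sub>C ('a \<Rightarrow>\<^sub>L 'b)) \<Rightarrow>\<^sub>L _) \<le> 1"
    by (rule norm_blinfun_bound) (auto simp: **)
qed

definition bcontfun_subst :: "('a \<Rightarrow> 'b) \<Rightarrow> ('t::topological_space \<Rightarrow>\<^sub>C 'a::real_normed_vector) \<Rightarrow> ('t \<Rightarrow>\<^sub>C 'b::real_normed_vector)"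
  where "bcontfun_subst f w = Bcontfun (\<lambda>t. f (apply_bcontfun w t))"

text \<open>\<open>Bcontfun\<close> returns the intended function only if f o w is bounded and
  continuous. A Lipschitz f ensures this, since the norm of f (w t) is at most |C| times the norm of
  w plus the norm of f 0.\<close>

lemma bcontfun_subst_apply:
  fixes f :: "'a::real_normed_vector \<Rightarrow> 'b::real_normed_vector"
  assumes "\<And>x y. norm (f x - f y) \<le> C * norm (x - y)"
  shows "apply_bcontfun (bcontfun_subst f w) t = f (apply_bcontfun w t)"
proof -
  have "(\<lambda>t. f (w t)) \<in> bcontfun"
  proof (rule bcontfun_normI)
    show "continuous_on UNIV (\<lambda>t. f (w t))"
      using continuous_on_compose2[OF continuous_on_lipschitz[OF assms, of UNIV] continuous_on_apply_bcontfun] by simp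
    fix t
    have "norm (f (w t)) \<le> norm (f (w t) - f 0) + norm (f 0)"
      using norm_triangle_ineq[of "f (w t) - f 0" "f 0"] by simp
    also have "norm (f (w t) - f 0) \<le> C * norm (w t)" using assms[of "w t" 0] by simp
    also have "\<dots> \<le> \<bar>C\<bar> * norm w"
      by (intro mult_mono norm_bounded) auto
    finally show "norm (f (w t)) \<le> \<bar>C\<bar> * norm w + norm (f 0)" by simp
  qed
  then show ?thesis by (simp add: bcontfun_subst_def Bcontfun_inverse)
qed

text \<open>The remainder estimates hold at every t with a constant depending neither on t nor on
  the value w t, so they pass to the supremum norm with the same \<open>C\<close>.\<close>

lemma C2_bounded_bcontfun_subst:
  fixes f :: "'a::real_normed_vector \<Rightarrow> 'b::real_normed_vector"
  assumes f: "C2_bounded f f' f'' C"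
  shows "C2_bounded (bcontfun_subst f :: ('t::topological_space \<Rightarrow>\<^sub>C 'a) \<Rightarrow> _)
     (\<lambda>w. bcontfun_app (bcontfun_subst f' w))
     (\<lambda>w. bcontfun_app o\<^sub>L bcontfun_app (bcontfun_subst f'' w)) C"
proof -
  have C: "0 \<le> C" using f by (rule C2_bounded_nonneg)
  note D = C2_boundedD[OF f]
  note app [simp] = bcontfun_subst_apply[OF C2_bounded_lipschitz(1)[OF f]]
    bcontfun_subst_apply[OF C2_bounded_lipschitz(2)[OF f]] bcontfun_subst_apply[OF D(3)]
  have sq: "C * (norm (h t))\<^sup>2 \<le> C * (norm h)\<^sup>2" for h :: "'t \<Rightarrow>\<^sub>C 'a" and t
    using C norm_bounded[of h t] by (intro mult_left_mono power_mono) auto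
  have N1: "norm (bcontfun_app z) \<le> D" if "norm z \<le> D" for z :: "'t \<Rightarrow>\<^sub>C 'a \<Rightarrow>\<^sub>L 'b" and D
    using norm_bcontfun_app that order_trans by blast
  have N2: "norm ((bcontfun_app :: ('t \<Rightarrow>\<^sub>C 'a \<Rightarrow>\<^sub>L 'b) \<Rightarrow>\<^sub>L _) o\<^sub>L bcontfun_app z) \<le> D" if "norm z \<le> D" for z :: "'t \<Rightarrow>\<^sub>C 'a \<Rightarrow>\<^sub>L 'a \<Rightarrow>\<^sub>L 'b" and D
  proof -
    have "norm ((bcontfun_app :: ('t \<Rightarrow>\<^sub>C 'a \<Rightarrow>\<^sub>L 'b) \<Rightarrow>\<^sub>L _) o\<^sub>L bcontfun_app z) \<le> 1 * norm z"
      by (rule norm_blinfun_compose[THEN order_trans])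
        (intro mult_mono norm_bcontfun_app1 norm_bcontfun_app, auto)
    then show ?thesis using that by simp
  qed
  show ?thesis
    unfolding C2_bounded_def
  proof (intro conjI allI)
    fix w h :: "'t \<Rightarrow>\<^sub>C 'a"
    show "norm (bcontfun_subst f (w + h) - bcontfun_subst f w - bcontfun_app (bcontfun_subst f' w) h) \<le> C * (norm h)\<^sup>2"
      by (rule norm_bound) (use order_trans[OF D(1) sq] in auto)
    have "norm (bcontfun_subst f' (w + h) - bcontfun_subst f' w - bcontfun_app (bcontfun_subst f'' w) h) \<le> C * (norm h)\<^sup>2"
      by (rule norm_bound) (use order_trans[OF D(2) sq] in auto)
    from N1[OF this] show "norm (bcontfun_app (bcontfun_subst f' (w + h)) - bcontfun_app (bcontfun_subst f' w)
        - (bcontfun_app o\<^sub>L bcontfun_app (bcontfun_subst f'' w)) h) \<le> C * (norm h)\<^sup>2"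
      by (simp add: blinfun.diff_right)
    have "norm (bcontfun_subst f'' w - bcontfun_subst f'' h) \<le> C * norm (w - h)"
    proof (rule norm_bound)
      fix t
      have "C * norm (w t - h t) \<le> C * norm (w - h)"
        using C norm_bounded[of "w - h" t] by (intro mult_left_mono) auto
      then show "norm (apply_bcontfun (bcontfun_subst f'' w - bcontfun_subst f'' h) t) \<le> C * norm (w - h)"
        using D(3)[of "w t" "h t"] by simp
    qed
    from N2[OF this] show "norm ((bcontfun_app o\<^sub>L bcontfun_app (bcontfun_subst f'' w)) -
        (bcontfun_app o\<^sub>L bcontfun_app (bcontfun_subst f'' h))) \<le> C * norm (w - h)"
      by (simp add: blinfun.diff_right bounded_bilinear.diff_right[OF bounded_bilinear_blinfun_compose])
    show "norm (bcontfun_app (bcontfun_subst f' w)) \<le> C"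
      by (intro N1 norm_bound) (use D(4) in auto)
    show "norm (bcontfun_app o\<^sub>L bcontfun_app (bcontfun_subst f'' w)) \<le> C"
      by (intro N2 norm_bound) (use D(5) in auto)
  qed
qed

section \<open>Semilinear evolution equations\<close>

text \<open>The open sets \<open>G n\<close>, on which some operator exceeds n, have no common
  point. By Baire's theorem they cannot all be dense, so one of them misses a ball, and the bound n
  on that ball scales to a bound on the operators.\<close>

lemma uniform_boundedness:
  fixes W :: "'i \<Rightarrow> 'a::banach \<Rightarrow>\<^sub>L 'b::real_normed_vector"
  assumes bdd: "\<And>x. \<exists>C. \<forall>i\<in>I. norm (W i x) \<le> C"
  shows "\<exists>C. \<forall>i\<in>I. norm (W i) \<le> C"
proof -
  define G where "G n = {x. \<exists>i\<in>I. norm (W i x) > real n}" for n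
  have op: "open (G n)" for n
  proof -
    have "G n = (\<Union>i\<in>I. {x. norm (W i x) > real n})" by (auto simp: G_def)
    also have "open \<dots>"
      by (intro open_UN ballI open_Collect_less continuous_intros linear_continuous_on blinfun.bounded_linear_right)
    finally show ?thesis .
  qed
  have "\<exists>n. closure (G n) \<noteq> UNIV"
  proof (rule ccontr)
    assume "\<not> ?thesis"
    then have "euclidean closure_of \<Inter>(range G) = topspace euclidean"
      using op by (intro Baire_category) (auto simp: completely_metrizable_space_euclidean)
    then have "\<Inter>(range G) \<noteq> {}" by auto
    then obtain x where x: "\<And>n. x \<in> G n" by auto
    obtain C where C: "\<forall>i\<in>I. norm (W i x) \<le> C" using bdd by blast
    obtain n where "C \<le> real n" using real_arch_simple by blast
    moreover obtain i where "i \<in> I" "norm (W i x) > real n" using x[of n] by (auto simp: G_def)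
    ultimately show False using C by force
  qed
  then obtain n x0 where "x0 \<notin> closure (G n)" by auto
  then obtain e where "e > 0" and e: "ball x0 e \<inter> G n = {}"
    using closure_approachable[of x0 "G n"] by (force simp: dist_commute not_less)
  \<comment> \<open>A vector of norm e/2 is the difference of two points of the ball, where all
    values are at most n.\<close>
  have "norm (W i) \<le> (2 * real n) / (e / 2)" if "i \<in> I" for i
  proof (rule norm_blinfun_bound)
    show "0 \<le> (2 * real n) / (e / 2)" using \<open>e > 0\<close> by simp
    have notG: "norm (W i y) \<le> n" if "y \<in> ball x0 e" for y
    proof -
      have "y \<notin> G n" using e that by blast
      then show ?thesis using \<open>i \<in> I\<close> unfolding G_def mem_Collect_eq by (meson not_less)
    qed
    fix x
    show "norm (W i x) \<le> 2 * real n / (e / 2) * norm x"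
    proof (cases "x = 0")
      case False
      define r where "r = (e / 2) / norm x"
      have r: "r > 0" using False \<open>e > 0\<close> by (simp add: r_def)
      have "norm (r *\<^sub>R x) < e" using False \<open>e > 0\<close> by (simp add: r_def)
      then have 1: "norm (W i (x0 + r *\<^sub>R x)) \<le> n" by (intro notG) (simp add: dist_norm)
      have 2: "norm (W i x0) \<le> n" using \<open>e > 0\<close> by (intro notG) simp
      have "r *\<^sub>R W i x = W i (x0 + r *\<^sub>R x) - W i x0"
        by (simp add: blinfun.add_right blinfun.scaleR_right)
      then have "norm (r *\<^sub>R W i x) \<le> n + n"
        using norm_triangle_ineq4[of "W i (x0 + r *\<^sub>R x)" "W i x0"] 1 2 by simp
      then have "r * norm (W i x) \<le> 2 * n" using r by simp
      then show ?thesis using False \<open>e > 0\<close> by (simp add: r_def field_simps)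
    qed simp
  qed
  then show ?thesis by blast
qed

instance bcontfun :: (metric_space, banach) banach ..

section \<open>Orbits and Duhamel integrals as bounded operators into the path space\<close>

definition clamp_time :: "real \<Rightarrow> real \<Rightarrow> real" where
  "clamp_time T t = max 0 (min t T)"

lemma clamp_time_mem: "0 \<le> T \<Longrightarrow> T \<le> 1 \<Longrightarrow> clamp_time T t \<in> {0..T} \<and> clamp_time T t \<in> {0..1}"
  by (auto simp: clamp_time_def)

lemma clamp_time_id: "t \<in> {0..T} \<Longrightarrow> clamp_time T t = t"
  by (auto simp: clamp_time_def)

lemma continuous_on_clamp_time: "continuous_on S (clamp_time T)"
  unfolding clamp_time_def by (intro continuous_intros)

text \<open>The definition of \<open>C0_semigroup\<close> gives continuity of single orbits only.
  Each orbit is bounded on the compact interval, and uniform boundedness turns this into a bound in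
  operator norm.\<close>

lemma C0_semigroup_bounded:
  fixes W :: "real \<Rightarrow> 'a::banach \<Rightarrow>\<^sub>L 'a"
  assumes "C0_semigroup W"
  shows "\<exists>M\<ge>0. \<forall>t\<in>{0..1}. norm (W t) \<le> M"
proof -
  have "\<exists>C. \<forall>t\<in>{0..1}. norm (W t x) \<le> C" for x
  proof -
    have "continuous_on {0..1} (\<lambda>t. W t x)"
      using assms unfolding C0_semigroup_def by (auto intro: continuous_on_subset)
    then have "bounded ((\<lambda>t. W t x) ` {0..1})"
      by (intro compact_imp_bounded compact_continuous_image) auto
    then show ?thesis by (auto simp: bounded_iff)
  qed
  from uniform_boundedness[OF this] obtain M where M: "\<forall>t\<in>{0..1}. norm (W t) \<le> M" by blast
  then have "0 \<le> M" by (meson atLeastAtMost_iff norm_ge_zero order_trans order_refl zero_le_one)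
  with M show ?thesis by blast
qed

text \<open>In W t y - W s x = W t (y - x) + (W t x - W s x) the first term is controlled by the
  uniform operator bound, the second by strong continuity.\<close>

lemma C0_semigroup_continuous_on:
  fixes W :: "real \<Rightarrow> 'a::banach \<Rightarrow>\<^sub>L 'a"
  assumes W: "C0_semigroup W"
  shows "continuous_on ({0..1} \<times> UNIV) (\<lambda>p. W (fst p) (snd p))"
  unfolding continuous_on_def
proof
  fix p :: "real \<times> 'a" assume p: "p \<in> {0..1} \<times> UNIV"
  let ?F = "at p within ({0..1} \<times> UNIV)"
  obtain M where M: "\<And>t. t \<in> {0..1} \<Longrightarrow> norm (W t) \<le> M"
    using C0_semigroup_bounded[OF W] by blast
  have fs: "(fst \<longlongrightarrow> fst p) ?F" "(snd \<longlongrightarrow> snd p) ?F"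
    by (intro tendsto_fst tendsto_snd tendsto_ident_at)+
  have c: "continuous_on {0..1} (\<lambda>t. W t (snd p))"
    using W unfolding C0_semigroup_def by (auto intro: continuous_on_subset)
  have "((\<lambda>q. W (fst q) (snd p)) \<longlongrightarrow> W (fst p) (snd p)) ?F"
    by (rule continuous_on_tendsto_compose[OF c fs(1)])
      (use p in \<open>auto simp: eventually_at_filter intro!: always_eventually\<close>)
  then have "((\<lambda>q. M * norm (snd q - snd p) + norm (W (fst q) (snd p) - W (fst p) (snd p))) \<longlongrightarrow> 0) ?F"
    using fs(2) by (intro tendsto_add_zero tendsto_mult_right_zero tendsto_norm_zero LIM_zero)
  moreover have "\<forall>\<^sub>F q in ?F. norm (W (fst q) (snd q) - W (fst p) (snd p))
      \<le> M * norm (snd q - snd p) + norm (W (fst q) (snd p) - W (fst p) (snd p))"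
    unfolding eventually_at_filter
  proof (rule always_eventually, intro allI impI)
    fix q :: "real \<times> 'a" assume "q \<in> {0..1} \<times> UNIV"
    then have "norm (W (fst q) (snd q - snd p)) \<le> M * norm (snd q - snd p)"
      by (intro norm_blinfun[THEN order_trans] mult_right_mono M) auto
    then show "norm (W (fst q) (snd q) - W (fst p) (snd p))
      \<le> M * norm (snd q - snd p) + norm (W (fst q) (snd p) - W (fst p) (snd p))"
      using norm_triangle_ineq[of "W (fst q) (snd q - snd p)" "W (fst q) (snd p) - W (fst p) (snd p)"]
      by (simp add: blinfun.diff_right)
  qed
  ultimately have "((\<lambda>q. W (fst q) (snd q) - W (fst p) (snd p)) \<longlongrightarrow> 0) ?F"
    by (rule Lim_null_comparison[rotated])
  then show "((\<lambda>p. W (fst p) (snd p)) \<longlongrightarrow> W (fst p) (snd p)) ?F" by (rule LIM_zero_cancel)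
qed

definition orbit_path :: "(real \<Rightarrow> 'a::banach \<Rightarrow>\<^sub>L 'a) \<Rightarrow> real \<Rightarrow> 'a \<Rightarrow>\<^sub>L (real \<Rightarrow>\<^sub>C 'a)" where
  "orbit_path W T = Blinfun (\<lambda>x. Bcontfun (\<lambda>t. blinfun_apply (W (clamp_time T t)) x))"

lemma orbit_path_apply:
  assumes W: "C0_semigroup W" and T: "0 \<le> T" "T \<le> 1"
  shows "apply_bcontfun (blinfun_apply (orbit_path W T) x) t = W (clamp_time T t) x"
proof -
  obtain M where M: "\<And>t. t \<in> {0..1} \<Longrightarrow> norm (W t) \<le> M"
    using C0_semigroup_bounded[OF W] by blast
  have b: "norm (W (clamp_time T t) x) \<le> norm x * M" for t x
    using mult_right_mono[OF M[of "clamp_time T t"] norm_ge_zero[of x]] norm_blinfun[of "W (clamp_time T t)" x]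
      clamp_time_mem[OF T, of t] by (simp add: mult.commute)
  define P where "P x = Bcontfun (\<lambda>t. blinfun_apply (W (clamp_time T t)) x)" for x
  have "(\<lambda>t. W (clamp_time T t) x) \<in> bcontfun" for x
  proof (rule bcontfun_normI[OF _ b])
    have "continuous_on {0..} (\<lambda>t. W t x)" using W by (simp add: C0_semigroup_def)
    then show "continuous_on UNIV (\<lambda>t. W (clamp_time T t) x)"
      by (rule continuous_on_compose2[OF _ continuous_on_clamp_time]) (auto simp: clamp_time_def)
  qed
  then have P: "apply_bcontfun (P x) t = W (clamp_time T t) x" for x t
    by (simp add: P_def Bcontfun_inverse)
  have "bounded_linear P"
    by (rule bounded_linear_intro[where K = M])
      (auto intro!: bcontfun_eqI norm_bound simp: P blinfun.add_right blinfun.scaleR_right b)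
  then have "blinfun_apply (orbit_path W T) x = P x"
    unfolding orbit_path_def P_def[symmetric] by (simp add: bounded_linear_Blinfun_apply)
  then show ?thesis by (simp add: P)
qed

text \<open>The substitution $s = tr$ turns the convolution into an integral over a fixed interval of a function
  depending continuously on $t$.\<close>

definition convolution_path :: "(real \<Rightarrow> 'a::banach \<Rightarrow>\<^sub>L 'a) \<Rightarrow> real \<Rightarrow> (real \<Rightarrow>\<^sub>C 'a) \<Rightarrow>\<^sub>L (real \<Rightarrow>\<^sub>C 'a)" where
  "convolution_path W T = Blinfun (\<lambda>g. Bcontfun (\<lambda>t. clamp_time T t *\<^sub>R
     integral {0..1} (\<lambda>r. blinfun_apply (W (clamp_time T t * (1 - r))) (apply_bcontfun g (clamp_time T t * r)))))"

lemma convolution_path: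
  fixes W :: "real \<Rightarrow> 'a::banach \<Rightarrow>\<^sub>L 'a"
  assumes W: "C0_semigroup W" and T: "0 \<le> T" "T \<le> 1"
  shows convolution_path_has_integral: "((\<lambda>s. W (clamp_time T t - s) (apply_bcontfun g s)) has_integral
      apply_bcontfun (blinfun_apply (convolution_path W T) g) t) {0..clamp_time T t}"
    and norm_convolution_path: "0 \<le> M \<Longrightarrow> (\<And>t. t \<in> {0..1} \<Longrightarrow> norm (W t) \<le> M) \<Longrightarrow> norm (convolution_path W T) \<le> M * T"
proof -
  define h where "h g t r = blinfun_apply (W (clamp_time T t * (1 - r))) (apply_bcontfun g (clamp_time T t * r))" for g t r
  define P where "P g = Bcontfun (\<lambda>t. clamp_time T t *\<^sub>R integral {0..1} (h g t))" for g
  have mem: "clamp_time T t * (1 - r) \<in> {0..1}" if "r \<in> {0..1}" for t r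
    using that clamp_time_mem[OF T, of t] by (auto intro: mult_le_one)
  have hcont: "continuous_on (UNIV \<times> cbox 0 1) (\<lambda>(t, r). h g t r)" for g
  proof -
    have "continuous_on (UNIV \<times> cbox 0 1) (\<lambda>p. (clamp_time T (fst p) * (1 - snd p), apply_bcontfun g (clamp_time T (fst p) * snd p)))"
      by (intro continuous_intros continuous_on_compose2[OF continuous_on_clamp_time[of UNIV]]
         continuous_on_compose2[OF continuous_on_apply_bcontfun[of UNIV]]) auto
    from continuous_on_compose2[OF C0_semigroup_continuous_on[OF W] this] mem
    show ?thesis by (fastforce simp: h_def case_prod_beta)
  qed
  have hc: "continuous_on {0..1} (h g t)" for g t
  proof -
    have "continuous_on {0..1} (\<lambda>r. case (t, r) of (t, r) \<Rightarrow> h g t r)"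
      by (rule continuous_on_compose2[OF hcont[of g]]) (auto intro!: continuous_intros)
    then show ?thesis by simp
  qed
  have hi: "h g t integrable_on {0..1}" for g t
    using hc by (rule integrable_continuous_interval)
  have bound: "norm (clamp_time T t *\<^sub>R integral {0..1} (h g t)) \<le> norm g * (M * T)"
    if "0 \<le> M" "\<And>t. t \<in> {0..1} \<Longrightarrow> norm (W t) \<le> M" for M g t
  proof -
    have "norm (integral {0..1} (h g t)) \<le> (M * norm g) * (1 - 0)"
    proof (rule integral_bound[OF _ hc])
      fix r :: real assume "r \<in> {0..1}"
      then show "norm (h g t r) \<le> M * norm g"
        unfolding h_def
        by (intro norm_blinfun[THEN order_trans] mult_mono that mem norm_bounded) (auto simp: that)
    qed simp
    then have "clamp_time T t * norm (integral {0..1} (h g t)) \<le> T * (M * norm g)"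
      using clamp_time_mem[OF T, of t] by (intro mult_mono) (auto simp: that)
    then show ?thesis using clamp_time_mem[OF T, of t] by (simp add: mult_ac)
  qed
  obtain M0 where M0: "0 \<le> M0" "\<And>t. t \<in> {0..1} \<Longrightarrow> norm (W t) \<le> M0"
    using C0_semigroup_bounded[OF W] by blast
  have P: "apply_bcontfun (P g) t = clamp_time T t *\<^sub>R integral {0..1} (h g t)" for g t
  proof -
    have "(\<lambda>t. clamp_time T t *\<^sub>R integral {0..1} (h g t)) \<in> bcontfun"
    proof (rule bcontfun_normI[OF _ bound[OF M0]])
      show "continuous_on UNIV (\<lambda>t. clamp_time T t *\<^sub>R integral {0..1} (h g t))"
        using integral_continuous_on_param[OF hcont[of g]]
        by (intro continuous_on_scaleR continuous_on_clamp_time) auto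
    qed
    then show ?thesis by (simp add: P_def Bcontfun_inverse)
  qed
  have lin: "bounded_linear P"
  proof (rule bounded_linear_intro[where K = "M0 * T"])
    fix f g :: "real \<Rightarrow>\<^sub>C 'a" and r
    have "h (f + g) t = (\<lambda>r. h f t r + h g t r)" for t by (auto simp: h_def blinfun.add_right)
    then show "P (f + g) = P f + P g"
      by (intro bcontfun_eqI) (simp add: P integral_add[OF hi hi] scaleR_add_right)
    have "h (r *\<^sub>R f) t = (\<lambda>s. r *\<^sub>R h f t s)" for t by (auto simp: h_def blinfun.scaleR_right)
    then show "P (r *\<^sub>R f) = r *\<^sub>R P f"
      by (intro bcontfun_eqI) (simp add: P)
    show "norm (P f) \<le> norm f * (M0 * T)"
      by (rule norm_bound) (use bound[OF M0] in \<open>simp add: P\<close>)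
  qed
  have conv: "blinfun_apply (convolution_path W T) g = P g" for g
    using lin unfolding convolution_path_def h_def[symmetric] P_def[symmetric, abs_def]
    by (simp add: bounded_linear_Blinfun_apply flip: P_def)
  show "norm (convolution_path W T) \<le> M * T" if "0 \<le> M" "\<And>t. t \<in> {0..1} \<Longrightarrow> norm (W t) \<le> M"
  proof (rule norm_blinfun_bound)
    fix g show "norm (convolution_path W T g) \<le> M * T * norm g"
      unfolding conv by (rule norm_bound) (use bound[OF that] in \<open>simp add: P mult_ac\<close>)
  qed (use that T in simp)
  show "((\<lambda>s. W (clamp_time T t - s) (apply_bcontfun g s)) has_integral
      apply_bcontfun (blinfun_apply (convolution_path W T) g) t) {0..clamp_time T t}"
  \<comment> \<open>Undoing the substitution s = t r divides by the clamped time. At time 0 the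
    interval is degenerate and the integral vanishes.\<close>
  proof (cases "clamp_time T t = 0")
    case True
    then show ?thesis by (auto simp: conv P)
  next
    case False
    let ?c = "clamp_time T t"
    have c: "?c > 0" using False by (auto simp: clamp_time_def)
    have "(h g t has_integral integral {0..1} (h g t)) {0..1}" using hi by blast
    then have "((\<lambda>x. h g t ((1/?c) *\<^sub>R x + 0)) has_integral (integral {0..1} (h g t) /\<^sub>R (1/?c) ^ DIM(real)))
       (cbox ((0 - 0) /\<^sub>R (1/?c)) ((1 - 0) /\<^sub>R (1/?c)))"
      using c by (intro has_integral_affinity') auto
    moreover have "h g t ((1/?c) *\<^sub>R x + 0) = W (?c - x) (apply_bcontfun g x)" for x
      using c by (simp add: h_def algebra_simps)
    ultimately show ?thesis using c by (simp add: conv P)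
  qed
qed

text \<open>Uniqueness of the integral identifies the Duhamel term with
  \<open>convolution_path\<close>. Conversely, a fixed point belongs to \<open>C_path\<close>
  automatically: both terms see t only through \<open>clamp_time\<close>, and for the convolution
  this is again uniqueness of the integral.\<close>

lemma solution_on_iff_fixpoint:
  fixes W :: "real \<Rightarrow> 'a::banach \<Rightarrow>\<^sub>L 'a"
  assumes W: "C0_semigroup W" and T: "0 < T" "T \<le> 1"
    and f: "\<And>x y. norm (f x - f y) \<le> C * norm (x - y)"
  shows "solution_on W f T w \<and> apply_bcontfun w 0 = x \<longleftrightarrow>
     w = orbit_path W T x + convolution_path W T (bcontfun_subst f w)"
proof -
  have T': "0 \<le> T" using T by simp
  note sub = bcontfun_subst_apply[OF f]
  note conv = convolution_path_has_integral[OF W T' T(2), of _ "bcontfun_subst f w", unfolded sub]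
  note orb = orbit_path_apply[OF W T' T(2)]
  have W0: "W 0 = id_blinfun" using W by (simp add: C0_semigroup_def)
  show ?thesis
  proof
    assume w: "solution_on W f T w \<and> apply_bcontfun w 0 = x"
    show "w = orbit_path W T x + convolution_path W T (bcontfun_subst f w)"
    proof (rule bcontfun_eqI)
      fix t
      let ?c = "clamp_time T t"
      have c: "?c \<in> {0..T}" using clamp_time_mem[OF T' T(2)] by simp
      have wt: "apply_bcontfun w t = apply_bcontfun w ?c"
        using w by (simp add: solution_on_def C_path_def clamp_time_def)
      have "((\<lambda>s. W (?c - s) (f (apply_bcontfun w s))) has_integral
          (apply_bcontfun w ?c - W ?c x)) {0..?c}"
        using w c by (auto simp: solution_on_def)
      from has_integral_unique[OF this conv[of t]]
      show "apply_bcontfun w t = apply_bcontfun (orbit_path W T x + convolution_path W T (bcontfun_subst f w)) t"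
        by (simp add: orb wt algebra_simps)
    qed
  next
    assume w: "w = orbit_path W T x + convolution_path W T (bcontfun_subst f w)"
    have wt: "apply_bcontfun w t = W (clamp_time T t) x + apply_bcontfun (convolution_path W T (bcontfun_subst f w)) t" for t
      using arg_cong[OF w, of "\<lambda>w. apply_bcontfun w t"] by (simp add: orb)
    have cl: "clamp_time T (clamp_time T t) = clamp_time T t" for t
      using T by (auto simp: clamp_time_def)
    have "apply_bcontfun (convolution_path W T (bcontfun_subst f w)) t =
        apply_bcontfun (convolution_path W T (bcontfun_subst f w)) (clamp_time T t)" for t
      using has_integral_unique[OF conv[of t] conv[of "clamp_time T t", unfolded cl]] .
    then have "w \<in> C_path T"
      unfolding C_path_def clamp_time_def[symmetric] using wt cl by auto
    moreover have w0: "apply_bcontfun w 0 = x"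
    proof -
      have "clamp_time T 0 = 0" using T by (simp add: clamp_time_def)
      then show ?thesis using wt[of 0] conv[of 0] by (simp add: W0 has_integral_iff)
    qed
    moreover have "((\<lambda>s. W (t - s) (f (apply_bcontfun w s))) has_integral
        (apply_bcontfun w t - W t (apply_bcontfun w 0))) {0..t}" if "t \<in> {0..T}" for t
      using conv[of t] wt[of t] clamp_time_id[OF that] by (simp add: w0)
    ultimately show "solution_on W f T w \<and> apply_bcontfun w 0 = x"
      by (auto simp: solution_on_def)
  qed
qed

text \<open>Since the bounds in \<open>C2_bounded\<close> are global, the contraction acts on the
  whole path space rather than on an invariant ball, so one \<open>T\<close> works for all data and
  \<open>S\<close> is defined everywhere.\<close>

theorem semilinear_wellposed:
  fixes W :: "real \<Rightarrow> 'a::banach \<Rightarrow>\<^sub>L 'a"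
  assumes W: "C0_semigroup W" and f: "C2_bounded f f' f'' C"
  shows "\<exists>T>0. \<forall>T\<^sub>0. 0 < T\<^sub>0 \<and> T\<^sub>0 \<le> T \<longrightarrow>
    (\<exists>S :: 'a \<Rightarrow> (real \<Rightarrow>\<^sub>C 'a).
      (\<forall>x w. solution_on W f T\<^sub>0 w \<and> apply_bcontfun w 0 = x \<longleftrightarrow> w = S x) \<and> C2_map S)"
proof -
  obtain M where M: "0 \<le> M" "\<And>t. t \<in> {0..1} \<Longrightarrow> norm (W t) \<le> M"
    using C0_semigroup_bounded[OF W] by blast
  have C: "0 \<le> C" using f by (rule C2_bounded_nonneg)
  \<comment> \<open>This makes M T C at most 1/2, the contraction constant. The summand 1 keeps the
    denominator positive and T \<le> 1, the range on which \<open>M\<close> bounds the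
    semigroup.\<close>
  define T where "T = 1 / (2 * (M * C + 1))"
  have MC: "0 \<le> M * C" using M C by simp
  have T: "0 < T" "T \<le> 1" "M * T * C \<le> 1/2"
    using MC by (auto simp: T_def field_simps)
  have "\<exists>S :: 'a \<Rightarrow> (real \<Rightarrow>\<^sub>C 'a).
      (\<forall>x w. solution_on W f T\<^sub>0 w \<and> apply_bcontfun w 0 = x \<longleftrightarrow> w = S x) \<and> C2_map S"
    if T0: "0 < T\<^sub>0" "T\<^sub>0 \<le> T" for T\<^sub>0
  proof -
    let ?V = "convolution_path W T\<^sub>0"
    let ?K = "\<lambda>w. ?V (bcontfun_subst f w)"
    have T1: "T\<^sub>0 \<le> 1" using T T0 by simp
    note K = C2_bounded_blinfun[OF C2_bounded_bcontfun_subst[OF f], of ?V]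
    have "norm ?V * C \<le> M * T\<^sub>0 * C"
      using norm_convolution_path[OF W _ T1 M] T0 C by (intro mult_right_mono) auto
    also have "\<dots> \<le> M * T * C" using T0 M C by (intro mult_right_mono mult_left_mono) auto
    finally have small: "norm ?V * C \<le> 1/2" using T by simp
    have lip: "norm (?K v - ?K w) \<le> 1/2 * norm (v - w)" for v w
      using C2_bounded_lipschitz(1)[OF K, of v w] mult_right_mono[OF small norm_ge_zero[of "v - w"]] by linarith
    have ex1: "\<exists>!w. orbit_path W T\<^sub>0 x + ?K w = w" for x
      by (rule banach_fix_type[of "1/2"]) (use lip in \<open>auto simp: dist_norm\<close>)
    define S where "S x = (THE w. orbit_path W T\<^sub>0 x + ?K w = w)" for x
    have S: "S x = orbit_path W T\<^sub>0 x + ?K (S x)" for x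
      using theI'[OF ex1[of x]] by (simp add: S_def)
    have uniq: "w = orbit_path W T\<^sub>0 x + ?K w \<longleftrightarrow> w = S x" for w x
      using ex1[of x] S[of x] by metis
    have "C2_map S"
    proof (rule fixpoint_C2_map[where K = ?K])
      show "norm (?V o\<^sub>L bcontfun_app (bcontfun_subst f' x)) \<le> 1/2" for x
        using K small unfolding C2_bounded_def by (meson order_trans)
      show "S x = orbit_path W T\<^sub>0 x + ?K (S x)" for x by (rule S)
    next
      show "(?K has_derivative blinfun_apply (?V o\<^sub>L bcontfun_app (bcontfun_subst f' w))) (at w)" for w
        by (rule C2_bounded_has_derivative(1)[OF K])
      show "((\<lambda>w. ?V o\<^sub>L bcontfun_app (bcontfun_subst f' w)) has_derivative
          blinfun_apply (blinfun_postcomp ?V o\<^sub>L (bcontfun_app o\<^sub>L bcontfun_app (bcontfun_subst f'' w)))) (at w)" for w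
        by (rule C2_bounded_has_derivative(2)[OF K])
    qed (rule C2_bounded_continuous_on(3)[OF K])
    moreover have "solution_on W f T\<^sub>0 w \<and> apply_bcontfun w 0 = x \<longleftrightarrow> w = S x" for w x
      by (rule trans[OF solution_on_iff_fixpoint[OF W T0(1) T1 C2_bounded_lipschitz(1)[OF f]] uniq])
    ultimately show ?thesis by (intro exI[of _ S] conjI allI)
  qed
  then show ?thesis using T(1) by (intro exI[of _ T] conjI allI impI) simp_all
qed

section \<open>Exponentials of bounded operators\<close>

text \<open>Bounded operators are not an instance of the class of normed algebras, because \<open>norm 1 = 1\<close>
  fails on the trivial space. A type copy over nontrivial spaces makes \<^const>\<open>exp\<close> available.\<close>

typedef (overloaded) 'a endo = "UNIV :: ('a::{real_normed_vector, perfect_space} \<Rightarrow>\<^sub>L 'a) set"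
  morphisms of_endo Endo ..

setup_lifting type_definition_endo

instantiation endo :: ("{real_normed_vector, perfect_space}") real_normed_algebra_1
begin

lift_definition zero_endo :: "'a endo" is 0 .
lift_definition one_endo :: "'a endo" is id_blinfun .
lift_definition plus_endo :: "'a endo \<Rightarrow> 'a endo \<Rightarrow> 'a endo" is "(+)" .
lift_definition minus_endo :: "'a endo \<Rightarrow> 'a endo \<Rightarrow> 'a endo" is "(-)" .
lift_definition uminus_endo :: "'a endo \<Rightarrow> 'a endo" is uminus .
lift_definition times_endo :: "'a endo \<Rightarrow> 'a endo \<Rightarrow> 'a endo" is "(o\<^sub>L)" .
lift_definition scaleR_endo :: "real \<Rightarrow> 'a endo \<Rightarrow> 'a endo" is "(*\<^sub>R)" .
lift_definition norm_endo :: "'a endo \<Rightarrow> real" is norm .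

definition dist_endo :: "'a endo \<Rightarrow> 'a endo \<Rightarrow> real" where
  "dist_endo u v = norm (u - v)"

definition sgn_endo :: "'a endo \<Rightarrow> 'a endo" where
  "sgn_endo u = inverse (norm u) *\<^sub>R u"

definition uniformity_endo :: "('a endo \<times> 'a endo) filter" where
  "uniformity_endo = (INF e\<in>{0<..}. principal {(u, v). dist u v < e})"

definition open_endo :: "'a endo set \<Rightarrow> bool" where
  "open_endo U \<longleftrightarrow> (\<forall>u\<in>U. eventually (\<lambda>(u', v). u' = u \<longrightarrow> v \<in> U) uniformity)"

instance
proof
  fix u v w :: "'a endo" and r s :: real
  show "u + v + w = u + (v + w)" "u + v = v + u" "0 + u = u" "- u + u = 0" "u - v = u + - v"
    by (transfer, simp)+
  show "r *\<^sub>R (u + v) = r *\<^sub>R u + r *\<^sub>R v" "(r + s) *\<^sub>R u = r *\<^sub>R u + s *\<^sub>R u"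
    by (transfer, simp add: scaleR_add_right scaleR_add_left)+
  show "r *\<^sub>R s *\<^sub>R u = (r * s) *\<^sub>R u" "1 *\<^sub>R u = u" by (transfer, simp)+
  show "u * v * w = u * (v * w)" "1 * u = u" "u * 1 = u"
    by (transfer, rule blinfun_eqI, simp)+
  show "(u + v) * w = u * w + v * w" "u * (v + w) = u * v + u * w"
    by (transfer, rule blinfun_eqI, simp add: blinfun.add_left blinfun.add_right)+
  show "r *\<^sub>R u * v = r *\<^sub>R (u * v)" "u * r *\<^sub>R v = r *\<^sub>R (u * v)"
    by (transfer, rule blinfun_eqI, simp add: blinfun.scaleR_left blinfun.scaleR_right)+
  show "dist u v = norm (u - v)" by (simp add: dist_endo_def)
  show "sgn u = inverse (norm u) *\<^sub>R u" by (simp add: sgn_endo_def)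
  show "(uniformity :: ('a endo \<times> 'a endo) filter) = (INF e\<in>{0<..}. principal {(u, v). dist u v < e})"
    by (simp add: uniformity_endo_def)
  show "open U \<longleftrightarrow> (\<forall>u\<in>U. eventually (\<lambda>(u', v). u' = u \<longrightarrow> v \<in> U) uniformity)" for U :: "'a endo set"
    by (simp add: open_endo_def)
  show "norm u = 0 \<longleftrightarrow> u = 0" "norm (u + v) \<le> norm u + norm v" "norm (r *\<^sub>R u) = \<bar>r\<bar> * norm u"
    by (transfer, simp add: norm_triangle_ineq)+
  show "norm (u * v) \<le> norm u * norm v" by transfer (rule norm_blinfun_compose)
  show "norm (1 :: 'a endo) = 1" by transfer simp
  show "(0 :: 'a endo) \<noteq> 1"
  proof
    assume "(0 :: 'a endo) = 1"
    then have "(0 :: 'a \<Rightarrow>\<^sub>L 'a) = id_blinfun" by transfer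
    then have "norm (0 :: 'a \<Rightarrow>\<^sub>L 'a) = norm (id_blinfun :: 'a \<Rightarrow>\<^sub>L 'a)" by (rule arg_cong)
    then show False by simp
  qed
qed

end

lemma bounded_linear_of_endo: "bounded_linear of_endo"
  by (rule bounded_linear_intro[where K = 1]) (simp_all add: plus_endo.rep_eq scaleR_endo.rep_eq norm_endo.rep_eq)

instance endo :: ("{banach, perfect_space}") banach
proof
  fix X :: "nat \<Rightarrow> 'a endo" assume "Cauchy X"
  then have "Cauchy (\<lambda>n. of_endo (X n))"
    by (rule bounded_linear.Cauchy[OF bounded_linear_of_endo])
  then obtain L where L: "(\<lambda>n. of_endo (X n)) \<longlonglongrightarrow> L"
    by (auto simp: Cauchy_convergent_iff convergent_def)
  have "(\<lambda>n. norm (X n - Endo L)) \<longlonglongrightarrow> 0"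
    using tendsto_norm_zero[OF LIM_zero[OF L]] by (simp add: norm_endo.rep_eq minus_endo.rep_eq Endo_inverse)
  then have "X \<longlonglongrightarrow> Endo L"
    by (rule tendsto_norm_zero_cancel[THEN LIM_zero_cancel])
  then show "convergent X" by (rule convergentI)
qed

lemma exp_commute:
  fixes x y :: "'a::{real_normed_algebra_1, banach}"
  assumes "x * y = y * x"
  shows "exp x * y = y * exp x"
proof -
  have "(\<Sum>n. x ^ n /\<^sub>R fact n) * y = (\<Sum>n. (x ^ n /\<^sub>R fact n) * y)"
    by (rule suminf_mult2) (rule summable_exp_generic)
  also have "\<dots> = (\<Sum>n. y * (x ^ n /\<^sub>R fact n))"
    by (simp add: power_commuting_commutes[OF assms])
  also have "\<dots> = y * (\<Sum>n. x ^ n /\<^sub>R fact n)"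
    by (rule suminf_mult) (rule summable_exp_generic)
  finally show ?thesis by (simp add: exp_def)
qed

definition exp_blinfun :: "('a::{banach, perfect_space} \<Rightarrow>\<^sub>L 'a) \<Rightarrow> real \<Rightarrow> 'a \<Rightarrow>\<^sub>L 'a"
  where "exp_blinfun A t = of_endo (exp (t *\<^sub>R Endo A))"

lemma exp_blinfun_0 [simp]: "exp_blinfun A 0 = id_blinfun"
  by (simp add: exp_blinfun_def one_endo.rep_eq)

lemma exp_blinfun_add: "exp_blinfun A (s + t) = exp_blinfun A s o\<^sub>L exp_blinfun A t"
  by (simp add: exp_blinfun_def times_endo.rep_eq[symmetric] scaleR_add_left exp_add_commuting)

lemma exp_blinfun_commute:
  assumes "A o\<^sub>L B = B o\<^sub>L A"
  shows "exp_blinfun A t o\<^sub>L B = B o\<^sub>L exp_blinfun A t"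
proof -
  have "Endo A * Endo B = Endo B * Endo A"
    using assms by (simp add: of_endo_inject[symmetric] times_endo.rep_eq Endo_inverse)
  then have "exp (t *\<^sub>R Endo A) * Endo B = Endo B * exp (t *\<^sub>R Endo A)"
    by (intro exp_commute) simp
  then show ?thesis
    by (simp add: of_endo_inject[symmetric] times_endo.rep_eq Endo_inverse exp_blinfun_def)
qed

lemma exp_blinfun_commute_apply:
  assumes "A o\<^sub>L B = B o\<^sub>L A"
  shows "exp_blinfun A t (B x) = B (exp_blinfun A t x)"
  using arg_cong[OF exp_blinfun_commute[OF assms], of "\<lambda>f. blinfun_apply f x"] by simp

lemma exp_blinfun_has_vector_derivative:
  "(exp_blinfun A has_vector_derivative (exp_blinfun A t o\<^sub>L A)) (at t within S)"
  using bounded_linear.has_vector_derivative[OF bounded_linear_of_endo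
      exp_scaleR_has_vector_derivative_right[of "Endo A" t S]]
  by (simp add: exp_blinfun_def[abs_def] times_endo.rep_eq Endo_inverse)

lemma exp_blinfun_apply_has_vector_derivative:
  "((\<lambda>t. exp_blinfun A t x) has_vector_derivative exp_blinfun A t (A x)) (at t within S)"
  using bounded_linear.has_vector_derivative[OF blinfun.bounded_linear_left
      exp_blinfun_has_vector_derivative[of A t S], of x]
  by simp

section \<open>The Hille-Yosida theorem for an equivalent inner product\<close>

text \<open>The direct method: the parallelogram identity \<open>midp\<close> makes every minimizing
  sequence of b(x,x) - 2 l(x) Cauchy. The closed subspace allows two uses: projection onto the
  closure of a domain, and, with the whole space, the solution of a resolvent equation. The norm
  need not be the one induced by \<open>b\<close>.\<close>

lemma coercive_minimizer:
  fixes b :: "'a::banach \<Rightarrow> 'a \<Rightarrow> real"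
  assumes bb: "bounded_bilinear b" and sym: "\<And>x y. b x y = b y x"
    and co: "0 < \<delta>" "\<And>x. \<delta> * (norm x)\<^sup>2 \<le> b x x"
    and K: "subspace K" "closed K" and l: "bounded_linear l"
  shows "\<exists>u\<in>K. \<forall>\<phi>\<in>K. b u \<phi> = (l \<phi> :: real)"
proof -
  interpret b: bounded_bilinear b by (rule bb)
  interpret l: bounded_linear l by (rule l)
  define J where "J x = b x x - 2 * l x" for x
  have midp: "J x + J y = 2 * J ((1/2) *\<^sub>R (x + y)) + 1/2 * b (x - y) (x - y)" for x y
    by (simp add: J_def b.add_left b.add_right b.diff_left b.diff_right b.scaleR_left b.scaleR_right
        l.add l.scaleR sym[of y x] field_simps)
  obtain B where B: "\<And>x. norm (l x) \<le> norm x * B" using l.bounded by blast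
  \<comment> \<open>Completing the square: -B^2/\<delta> is the minimum of \<delta> t^2 - 2 B
    t.\<close>
  have bdd: "- (B\<^sup>2 / \<delta>) \<le> J x" for x
  proof -
    have "2 * l x \<le> 2 * norm x * B" using B[of x] by simp
    moreover have "\<delta> * (norm x - B / \<delta>)\<^sup>2 = \<delta> * (norm x)\<^sup>2 - 2 * norm x * B + B\<^sup>2 / \<delta>"
    proof -
      obtain r where "B = \<delta> * r" using co(1) by (metis less_irrefl nonzero_mult_div_cancel_left times_divide_eq_right)
      then show ?thesis using co(1) by (simp add: power2_diff power2_eq_square algebra_simps)
    qed
    then have "2 * norm x * B \<le> \<delta> * (norm x)\<^sup>2 + B\<^sup>2 / \<delta>"
      using co(1) by (smt (verit) mult_nonneg_nonneg zero_le_power2)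
    ultimately show ?thesis using co(2)[of x] by (simp add: J_def)
  qed
  then have bdd_below: "bdd_below (J ` K)" by (auto intro!: bdd_belowI)
  define m where "m = (INF x\<in>K. J x)"
  have m: "m \<le> J x" if "x \<in> K" for x unfolding m_def by (rule cINF_lower[OF bdd_below that])
  have ne: "K \<noteq> {}" using subspace_0[OF K(1)] by auto
  have "\<exists>x\<in>K. J x < m + inverse (real (Suc n))" for n
    using cINF_less_iff[OF ne bdd_below, of "m + inverse (real (Suc n))"] by (simp add: m_def)
  then obtain X where X: "\<And>n. X n \<in> K" "\<And>n. J (X n) < m + inverse (real (Suc n))" by metis
  have dist: "\<delta> * (norm (x - y))\<^sup>2 \<le> 2 * (J x - m) + 2 * (J y - m)" if "x \<in> K" "y \<in> K" for x y
  proof -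
    have "(1/2) *\<^sub>R (x + y) \<in> K" using that K(1) by (simp add: subspace_add subspace_scale)
    then show ?thesis using m co(2)[of "x - y"] midp[of x y] by fastforce
  qed
  have "Cauchy X"
  proof (rule CauchyI)
    fix e :: real assume "e > 0"
    obtain N where N: "inverse (real (Suc N)) < \<delta> * e\<^sup>2 / 4"
      using reals_Archimedean[of "\<delta> * e\<^sup>2 / 4"] co \<open>e > 0\<close> by auto
    show "\<exists>M. \<forall>m\<ge>M. \<forall>n\<ge>M. norm (X m - X n) < e"
    proof (intro exI[of _ N] allI impI)
      fix i j assume "N \<le> i" "N \<le> j"
      then have "inverse (real (Suc i)) \<le> inverse (real (Suc N))" "inverse (real (Suc j)) \<le> inverse (real (Suc N))"
        by (auto simp: field_simps)
      then have "\<delta> * (norm (X i - X j))\<^sup>2 < \<delta> * e\<^sup>2"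
        using dist[OF X(1)[of i] X(1)[of j]] X(2)[of i] X(2)[of j] N
        unfolding less_divide_eq_numeral1 by argo
      then have "(norm (X i - X j))\<^sup>2 < e\<^sup>2" using co by simp
      then show "norm (X i - X j) < e" using \<open>e > 0\<close> by (simp add: power2_less_imp_less)
    qed
  qed
  then obtain u where u: "X \<longlonglongrightarrow> u" by (auto simp: Cauchy_convergent_iff convergent_def)
  then have uK: "u \<in> K" using K(2) X(1) closed_sequentially by blast
  have "(\<lambda>n. J (X n)) \<longlonglongrightarrow> J u"
    unfolding J_def by (intro tendsto_diff tendsto_mult tendsto_const b.tendsto l.tendsto u)
  moreover have "(\<lambda>n. m + inverse (real (Suc n))) \<longlonglongrightarrow> m + 0"
    by (intro tendsto_add tendsto_const LIMSEQ_inverse_real_of_nat)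
  ultimately have "J u \<le> m + 0"
    by (rule LIMSEQ_le) (use X(2) less_imp_le in blast)
  then have min: "J u \<le> J x" if "x \<in> K" for x using m[OF that] by simp
  have "b u \<phi> = l \<phi>" if "\<phi> \<in> K" for \<phi>
  proof (rule ccontr)
    assume ne: "b u \<phi> \<noteq> l \<phi>"
    define d where "d = b u \<phi> - l \<phi>"
    define c where "c = b \<phi> \<phi>"
    have c: "c \<ge> 0" using co(1) co(2)[of \<phi>] by (smt (verit) c_def mult_nonneg_nonneg zero_le_power2)
    \<comment> \<open>Up to the \<open>+ 1\<close> this is the minimizer along the line through u in
      direction \<phi>. The \<open>+ 1\<close> avoids division by zero and still makes the increment
      of J equal to -t^2 (c + 2), which is negative for t \<noteq> 0.\<close>
    define t where "t = - d / (c + 1)"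
    have "u + t *\<^sub>R \<phi> \<in> K" using uK that K(1) by (simp add: subspace_add subspace_scale)
    from min[OF this] have "0 \<le> t\<^sup>2 * c + 2 * t * d"
      by (simp add: J_def b.add_left b.add_right b.scaleR_left b.scaleR_right l.add l.scaleR
          sym[of \<phi> u] c_def d_def power2_eq_square algebra_simps)
    also have "\<dots> = - (t\<^sup>2 * (c + 2))"
    proof -
      have d: "d = - t * (c + 1)" using c by (simp add: t_def)
      show ?thesis by (subst d) (simp add: power2_eq_square algebra_simps)
    qed
    also have "\<dots> < 0" using ne c by (auto simp: d_def t_def intro!: mult_pos_pos)
    finally show False by simp
  qed
  then show ?thesis using uK by blast
qed

lemma subspace_closure:
  fixes S :: "'a::real_normed_vector set"
  assumes S: "subspace S"
  shows "subspace (closure S)"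
  unfolding subspace_def
proof (intro conjI ballI allI)
  show "0 \<in> closure S" using subspace_0[OF S] closure_subset by blast
next
  fix x y assume "x \<in> closure S" "y \<in> closure S"
  then obtain f g where "\<forall>n. f n \<in> S" "f \<longlonglongrightarrow> x" "\<forall>n. g n \<in> S" "g \<longlonglongrightarrow> y"
    unfolding closure_sequential by blast
  then show "x + y \<in> closure S"
    unfolding closure_sequential by (intro exI[of _ "\<lambda>n. f n + g n"]) (simp add: tendsto_add subspace_add[OF S])
next
  fix c :: real and x assume "x \<in> closure S"
  then obtain f where "\<forall>n. f n \<in> S" "f \<longlonglongrightarrow> x"
    unfolding closure_sequential by blast
  then show "c *\<^sub>R x \<in> closure S"
    unfolding closure_sequential by (intro exI[of _ "\<lambda>n. c *\<^sub>R f n"]) (simp add: tendsto_scaleR subspace_scale[OF S])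
qed

text \<open>\<open>A\<close> is the graph of an operator, so \<open>range\<close> expresses
  surjectivity of n - A for large n, and \<open>single_valued\<close> must be stated separately. The
  form \<open>e\<close> is an inner product equivalent to the norm but in general not inducing it.
  The sort \<open>perfect_space\<close> gives access to exponentials of bounded operators.\<close>

locale m_dissipative =
  fixes A :: "('a::{banach, perfect_space} \<times> 'a) set" and e :: "'a \<Rightarrow> 'a \<Rightarrow> real" and \<delta> \<omega> n0 :: real
  assumes bilin: "bounded_bilinear e" and sym: "\<And>x y. e x y = e y x"
    and coercive: "0 < \<delta>" "\<And>x. \<delta> * (norm x)\<^sup>2 \<le> e x x"
    and sub: "subspace A"
    and dissipative: "0 < \<omega>" "\<And>x y. (x, y) \<in> A \<Longrightarrow> e y x \<le> \<omega> * e x x"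
    and range: "\<And>n y. n0 \<le> n \<Longrightarrow> \<exists>x. (x, n *\<^sub>R x - y) \<in> A"
    and single_valued: "\<And>y. (0, y) \<in> A \<Longrightarrow> y = 0"
begin

sublocale e: bounded_bilinear e by (rule bilin)

lemma e_nonneg [simp]: "0 \<le> e x x"
  using coercive by (meson mult_nonneg_nonneg less_imp_le order_trans zero_le_power2)

lemma e_eq_0_iff [simp]: "e x x = 0 \<longleftrightarrow> x = 0"
proof
  assume "e x x = 0"
  then have "\<delta> * (norm x)\<^sup>2 \<le> 0" using coercive(2)[of x] by simp
  then have "(norm x)\<^sup>2 \<le> 0" using coercive(1) by (simp add: mult_le_0_iff)
  then show "x = 0" by simp
qed (simp add: e.zero_left)

lemma cauchy_schwarz: "(e x y)\<^sup>2 \<le> e x x * e y y"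
proof (cases "y = 0")
  case False
  then have y: "0 < e y y" using e_nonneg[of y] e_eq_0_iff[of y] by linarith
  define t where "t = e x y / e y y"
  have t: "e x y = t * e y y" using False by (simp add: t_def)
  have "0 \<le> e (x - t *\<^sub>R y) (x - t *\<^sub>R y)" by simp
  also have "\<dots> = e x x - 2 * t * e x y + t\<^sup>2 * e y y"
    by (simp add: e.diff_left e.diff_right e.scaleR_left e.scaleR_right sym[of y x] power2_eq_square algebra_simps)
  also have "\<dots> = e x x - t\<^sup>2 * e y y" by (simp add: t power2_eq_square)
  finally have "t\<^sup>2 * e y y * e y y \<le> e x x * e y y" using y by (intro mult_right_mono) auto
  then show ?thesis by (simp add: t power2_eq_square mult_ac)
qed (simp add: e.zero_right)

lemma e_le:
  assumes "0 \<le> r" "e x x \<le> r\<^sup>2 * e y y"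
  shows "\<bar>e x y\<bar> \<le> r * e y y"
proof (rule power2_le_imp_le)
  have "(e x y)\<^sup>2 \<le> (r\<^sup>2 * e y y) * e y y"
    using cauchy_schwarz[of x y] mult_right_mono[OF assms(2) e_nonneg[of y]] by linarith
  then show "\<bar>e x y\<bar>\<^sup>2 \<le> (r * e y y)\<^sup>2" by (simp add: power2_eq_square mult_ac)
qed (use assms in simp)

definition M where "M = (SOME K. K > 0 \<and> (\<forall>x. e x x \<le> K * (norm x)\<^sup>2))"

lemma M: "M > 0" "e x x \<le> M * (norm x)\<^sup>2"
proof -
  obtain K where K: "K > 0" "\<And>x y. norm (e x y) \<le> norm x * norm y * K" using e.pos_bounded by blast
  have "e x x \<le> K * (norm x)\<^sup>2" for x
    using K(2)[of x x] by (simp add: power2_eq_square mult_ac abs_le_iff)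
  then have "\<exists>K. K > 0 \<and> (\<forall>x. e x x \<le> K * (norm x)\<^sup>2)" using K(1) by blast
  from someI_ex[OF this] show "M > 0" "e x x \<le> M * (norm x)\<^sup>2" by (auto simp: M_def)
qed

text \<open>The square root of the ratio of the two equivalence constants: an energy bound with
  factor r becomes a norm bound with factor r C.\<close>

definition C where "C = sqrt (M / \<delta>)"

lemma C_pos: "C > 0" using M(1) coercive(1) by (simp add: C_def)

lemma norm_le_energy:
  assumes "0 \<le> r" "e x x \<le> r\<^sup>2 * e y y"
  shows "norm x \<le> r * C * norm y"
proof (rule power2_le_imp_le)
  have "\<delta> * (norm x)\<^sup>2 \<le> r\<^sup>2 * (M * (norm y)\<^sup>2)"
    using coercive(2)[of x] assms(2) mult_left_mono[OF M(2)[of y] zero_le_power2[of r]] by linarith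
  then have "(norm x)\<^sup>2 \<le> r\<^sup>2 * (M * (norm y)\<^sup>2) / \<delta>"
    using coercive(1) by (simp add: field_simps)
  also have "\<dots> = (r * C * norm y)\<^sup>2"
    using M(1) coercive(1) by (simp add: C_def power_mult_distrib)
  finally show "(norm x)\<^sup>2 \<le> (r * C * norm y)\<^sup>2" .
qed (use assms C_pos in simp)

text \<open>Above 2 \<omega> one has n - \<omega> \<ge> n/2, which yields the resolvent bound 2/n in
  the energy.\<close>

definition n1 where "n1 = max n0 (2 * \<omega>)"

lemma n1: "n1 > 0" "n1 \<le> n \<Longrightarrow> n0 \<le> n" "n1 \<le> n \<Longrightarrow> 2 * \<omega> \<le> n" "n1 \<le> n \<Longrightarrow> 0 < n"
  using dissipative(1) by (auto simp: n1_def)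

section \<open>Resolvents and density of the domain\<close>

lemma A_lin:
  "(x, y) \<in> A \<Longrightarrow> (x', y') \<in> A \<Longrightarrow> (x + x', y + y') \<in> A"
  "(x, y) \<in> A \<Longrightarrow> (r *\<^sub>R x, r *\<^sub>R y) \<in> A"
  "(x, y) \<in> A \<Longrightarrow> (x', y') \<in> A \<Longrightarrow> (x - x', y - y') \<in> A"
  "(0, 0) \<in> A"
  using subspace_add[OF sub, of "(x, y)" "(x', y')"] subspace_scale[OF sub, of "(x, y)" r]
    subspace_diff[OF sub, of "(x, y)" "(x', y')"] subspace_0[OF sub] by (auto simp: zero_prod_def)

text \<open>The resolvent (n - A)^(-1), picked by choice because \<open>range\<close> only asserts
  existence; uniqueness follows from dissipativity in \<open>R_unique\<close>.\<close>

definition R where "R n y = (SOME x. (x, n *\<^sub>R x - y) \<in> A)"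

lemma R: "n1 \<le> n \<Longrightarrow> (R n y, n *\<^sub>R R n y - y) \<in> A"
  unfolding R_def by (rule someI_ex) (use range n1 in blast)

lemma eigen_trivial:
  assumes "(d, n *\<^sub>R d) \<in> A" "n1 \<le> n"
  shows "d = 0"
proof -
  have "n * e d d \<le> \<omega> * e d d" using dissipative(2)[OF assms(1)] by (simp add: e.scaleR_left)
  then have "(n - \<omega>) * e d d \<le> 0" by (simp add: algebra_simps)
  moreover have "n - \<omega> > 0" using n1(3)[OF assms(2)] dissipative(1) by simp
  ultimately have "e d d \<le> 0" by (simp add: mult_le_0_iff)
  then show ?thesis using e_nonneg[of d] e_eq_0_iff[of d] by linarith
qed

lemma R_unique:
  assumes "n1 \<le> n" "(x, n *\<^sub>R x - y) \<in> A"
  shows "R n y = x"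
proof -
  have "(R n y - x, n *\<^sub>R (R n y - x)) \<in> A"
    using A_lin(3)[OF R[OF assms(1), of y] assms(2)] by (simp add: algebra_simps)
  from eigen_trivial[OF this assms(1)] show ?thesis by simp
qed

text \<open>For x = R n y dissipativity reads n e(x,x) - e(y,x) \<le> \<omega> e(x,x), hence (n/2)
  e(x,x) \<le> e(y,x). Cauchy-Schwarz for \<open>e\<close> finishes after cancelling e(x,x).\<close>

lemma R_energy:
  assumes n: "n1 \<le> n"
  shows "(n / 2)\<^sup>2 * e (R n y) (R n y) \<le> e y y"
proof -
  let ?x = "R n y"
  have nw: "n / 2 \<le> n - \<omega>" "0 < n" using n1(3)[OF n] n1(4)[OF n] by auto
  have "n * e ?x ?x - e y ?x \<le> \<omega> * e ?x ?x"
    using dissipative(2)[OF R[OF n, of y]] by (simp add: e.diff_left e.scaleR_left)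
  moreover have "n / 2 * e ?x ?x \<le> (n - \<omega>) * e ?x ?x" by (rule mult_right_mono[OF nw(1)]) simp
  ultimately have "n / 2 * e ?x ?x \<le> e y ?x" by (simp add: algebra_simps)
  then have "(n / 2 * e ?x ?x)\<^sup>2 \<le> (e y ?x)\<^sup>2" using nw by (intro power_mono) auto
  also have "\<dots> \<le> e y y * e ?x ?x" by (rule cauchy_schwarz)
  finally have *: "((n / 2)\<^sup>2 * e ?x ?x) * e ?x ?x \<le> e y y * e ?x ?x"
    by (simp add: power2_eq_square mult_ac)
  show ?thesis
  proof (cases "?x = 0")
    case False
    then have "0 < e ?x ?x" using e_nonneg[of ?x] e_eq_0_iff[of ?x] by linarith
    then show ?thesis using * by simp
  qed (simp add: e.zero_left)
qed

lemma R_bound: "n1 \<le> n \<Longrightarrow> norm (R n y) \<le> norm y * (2 / n * C)"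
proof -
  assume n: "n1 \<le> n"
  have n': "n > 0" using n n1 by simp
  have "e (R n y) (R n y) \<le> (2 / n)\<^sup>2 * e y y"
    using R_energy[OF n, of y] n' by (simp add: field_simps)
  from norm_le_energy[OF _ this] show ?thesis using n' by (simp add: mult_ac)
qed

lemma bounded_linear_R: "n1 \<le> n \<Longrightarrow> bounded_linear (R n)"
proof (rule bounded_linear_intro[where K = "2 / n * C"])
  assume n: "n1 \<le> n"
  show "R n (x + y) = R n x + R n y" for x y
    by (rule R_unique[OF n]) (use A_lin(1)[OF R[OF n, of x] R[OF n, of y]] in \<open>simp add: algebra_simps\<close>)
  show "R n (r *\<^sub>R x) = r *\<^sub>R R n x" for r x
    by (rule R_unique[OF n]) (use A_lin(2)[OF R[OF n, of x], of r] in \<open>simp add: algebra_simps\<close>)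
qed (rule R_bound)

lemma R_resolvent:
  assumes n: "n1 \<le> n" and m: "n1 \<le> m"
  shows "R n y - R m y = (m - n) *\<^sub>R R n (R m y)"
proof -
  let ?x = "R m y" and ?v = "R n y"
  have "(?v - ?x, (n *\<^sub>R ?v - y) - (m *\<^sub>R ?x - y)) \<in> A" by (rule A_lin(3)[OF R[OF n] R[OF m]])
  then have "(?v - ?x, n *\<^sub>R (?v - ?x) - (m - n) *\<^sub>R ?x) \<in> A" by (simp add: algebra_simps)
  from R_unique[OF n this] show ?thesis
    using linear_scale[OF bounded_linear.linear[OF bounded_linear_R[OF n]]] by simp
qed

text \<open>The resolvent identity read in both orders gives the same left-hand side up to sign. The
  result makes the Yosida approximations commute, on which their comparison in \<open>E_diff\<close>
  rests.\<close>

lemma R_commute: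
  assumes n: "n1 \<le> n" and m: "n1 \<le> m"
  shows "R n (R m y) = R m (R n y)"
proof (cases "n = m")
  case False
  have "(m - n) *\<^sub>R R n (R m y) = (m - n) *\<^sub>R R m (R n y)"
    using R_resolvent[OF n m, of y] R_resolvent[OF m n, of y]
    by (metis minus_diff_eq scaleR_minus_left)
  then show ?thesis using False by simp
qed simp

text \<open>Let u be the e-orthogonal projection of y onto the closure of the domain and d = y - u.
  The point x = R n1 d lies in the domain, so e(d,x) = 0, and dissipativity forces x = 0. Then (0,
  -d) belongs to the graph and d = 0.\<close>

lemma dense_domain: "closure (Domain A) = UNIV"
proof -
  let ?D = "Domain A"
  have "subspace ?D"
    unfolding subspace_def using A_lin by blast
  then have K: "subspace (closure ?D)" by (rule subspace_closure)
  have "y \<in> closure ?D" for y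
  proof -
    obtain u where u: "u \<in> closure ?D" "\<And>\<phi>. \<phi> \<in> closure ?D \<Longrightarrow> e u \<phi> = e y \<phi>"
      using coercive_minimizer[OF bilin sym coercive K closed_closure e.bounded_linear_right[of y]] by blast
    define d where "d = y - u"
    let ?x = "R n1 d"
    have x: "(?x, n1 *\<^sub>R ?x - d) \<in> A" by (rule R) simp
    then have "?x \<in> closure ?D" using closure_subset by (blast intro: DomainI)
    then have "e d ?x = 0" by (simp add: d_def e.diff_left u(2))
    then have "n1 * e ?x ?x \<le> \<omega> * e ?x ?x"
      using dissipative(2)[OF x] by (simp add: e.diff_left e.scaleR_left)
    then have "(n1 - \<omega>) * e ?x ?x \<le> 0" by (simp add: algebra_simps)
    moreover have "n1 - \<omega> > 0" using n1(3)[of n1] dissipative(1) by simp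
    ultimately have "e ?x ?x \<le> 0" by (simp add: mult_le_0_iff)
    then have "?x = 0" using e_nonneg[of ?x] e_eq_0_iff[of ?x] by linarith
    then have "(0, - d) \<in> A" using x by simp
    then have "- d = 0" by (rule single_valued)
    then show ?thesis using u(1) by (simp add: d_def)
  qed
  then show ?thesis by blast
qed

section \<open>Yosida approximations\<close>

definition \<nu> where "\<nu> k = n1 + real k"

lemma \<nu>: "n1 \<le> \<nu> k" "\<nu> k > 0" using n1(1) by (auto simp: \<nu>_def)

lemma filterlim_\<nu>: "filterlim \<nu> at_top sequentially"
  unfolding \<nu>_def by (rule filterlim_tendsto_add_at_top[OF tendsto_const filterlim_real_sequentially])

text \<open>The bounded operator \<nu> A (\<nu> - A)^(-1), rewritten by A R y = \<nu> R y - y so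
  that only the resolvent occurs.\<close>

definition Yosida where "Yosida k = \<nu> k *\<^sub>R (\<nu> k *\<^sub>R Blinfun (R (\<nu> k)) - id_blinfun)"

lemma Yosida_apply: "Yosida k x = \<nu> k *\<^sub>R (\<nu> k *\<^sub>R R (\<nu> k) x - x)"
  by (simp add: Yosida_def blinfun.scaleR_left blinfun.diff_left
      bounded_linear_Blinfun_apply[OF bounded_linear_R[OF \<nu>(1)]])

lemma Yosida_commute: "Yosida k o\<^sub>L Yosida l = Yosida l o\<^sub>L Yosida k"
proof (rule blinfun_eqI)
  fix x
  show "(Yosida k o\<^sub>L Yosida l) x = (Yosida l o\<^sub>L Yosida k) x"
    using R_commute[OF \<nu>(1)[of k] \<nu>(1)[of l], of x]
    by (simp add: Yosida_apply linear_diff[OF bounded_linear.linear[OF bounded_linear_R[OF \<nu>(1)]]]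
      linear_scale[OF bounded_linear.linear[OF bounded_linear_R[OF \<nu>(1)]]] algebra_simps)
qed

lemma Yosida_domain: "(x, y) \<in> A \<Longrightarrow> Yosida k x = \<nu> k *\<^sub>R R (\<nu> k) y"
proof -
  assume xy: "(x, y) \<in> A"
  have "R (\<nu> k) (\<nu> k *\<^sub>R x - y) = x" by (rule R_unique[OF \<nu>(1)]) (use xy in simp)
  then show ?thesis
    by (simp add: Yosida_apply linear_diff[OF bounded_linear.linear[OF bounded_linear_R[OF \<nu>(1)]]]
      linear_scale[OF bounded_linear.linear[OF bounded_linear_R[OF \<nu>(1)]]] algebra_simps)
qed

text \<open>Put x = R n y and z = n x - y, so that (x, z) is in A. Then the left side is e(n z, n x
  - z) = n^2 e(z,x) - n e(z,z), whose last term is dropped. Dissipativity bounds the rest by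
  \<omega> n^2 e(x,x), and \<open>R_energy\<close> converts n^2 e(x,x) into 4 e(y,y).\<close>

lemma Yosida_dissipative: "e (Yosida k y) y \<le> 4 * \<omega> * e y y"
proof -
  define n where "n = \<nu> k"
  define x where "x = R n y"
  define z where "z = n *\<^sub>R x - y"
  have n: "n1 \<le> n" "n > 0" by (auto simp: n_def \<nu>)
  have z: "(x, z) \<in> A" using R[OF n(1)] by (simp add: x_def z_def)
  have y: "y = n *\<^sub>R x - z" by (simp add: z_def)
  have "e (Yosida k y) y = e (n *\<^sub>R z) (n *\<^sub>R x - z)"
    by (subst (2) y) (simp add: Yosida_apply n_def[symmetric] x_def[symmetric] z_def)
  also have "\<dots> = n\<^sup>2 * e z x - n * e z z"
    by (simp add: e.scaleR_left e.scaleR_right e.diff_right power2_eq_square algebra_simps)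
  also have "\<dots> \<le> n\<^sup>2 * e z x" using n by simp
  also have "\<dots> \<le> n\<^sup>2 * (\<omega> * e x x)" by (intro mult_left_mono dissipative(2) z) simp
  also have "\<dots> = 4 * \<omega> * ((n / 2)\<^sup>2 * e x x)" by (simp add: power2_eq_square)
  also have "\<dots> \<le> 4 * \<omega> * e y y"
    unfolding x_def by (intro mult_left_mono R_energy n) (use dissipative(1) in simp)
  finally show ?thesis .
qed

text \<open>For (x, z) in A one has \<nu> R x - x = R z, which is of order 1/\<nu>. Density of the
  domain and the bound 2 C on the operators \<nu> R extend the limit to all y.\<close>

lemma Yosida_resolvent_tendsto: "(\<lambda>k. \<nu> k *\<^sub>R R (\<nu> k) y) \<longlonglongrightarrow> y"
proof (rule tendstoI)
  fix \<epsilon> :: real assume "\<epsilon> > 0"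
  have C: "C > 0" by (rule C_pos)
  \<comment> \<open>The distance of y to the approximating x enters the final estimate with total
    factor 2 C + 1 and may use up \<epsilon>/2.\<close>
  let ?\<eta> = "\<epsilon> / (2 * (2 * C + 1))"
  have eta: "?\<eta> > 0" using \<open>\<epsilon> > 0\<close> C by simp
  obtain x z where xz: "(x, z) \<in> A" "dist x y < ?\<eta>"
    using dense_domain closure_approachable[of y "Domain A"] eta by auto
  have "(\<lambda>k. norm z * (2 / \<nu> k * C)) \<longlonglongrightarrow> norm z * (0 * C)"
    by (intro tendsto_mult tendsto_const tendsto_divide_0[OF tendsto_const]
       filterlim_mono[OF filterlim_\<nu> at_top_le_at_infinity order_refl])
  then have "\<forall>\<^sub>F k in sequentially. norm z * (2 / \<nu> k * C) < \<epsilon> / 2"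
    using \<open>\<epsilon> > 0\<close> by (intro order_tendstoD) auto
  then show "\<forall>\<^sub>F k in sequentially. dist (\<nu> k *\<^sub>R R (\<nu> k) y) y < \<epsilon>"
  proof eventually_elim
    case (elim k)
    let ?n = "\<nu> k"
    interpret R: bounded_linear "R ?n" by (rule bounded_linear_R[OF \<nu>(1)])
    have "R ?n (?n *\<^sub>R x - z) = x" by (rule R_unique[OF \<nu>(1)]) (use xz in simp)
    then have "?n *\<^sub>R R ?n x - x = R ?n z" by (simp add: R.diff R.scaleR algebra_simps)
    then have 1: "norm (?n *\<^sub>R R ?n x - x) < \<epsilon> / 2"
      using R_bound[OF \<nu>(1), of k z] elim by simp
    have "norm (R ?n (y - x)) \<le> norm (y - x) * (2 / ?n * C)" by (rule R_bound[OF \<nu>(1)])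
    then have 2: "norm (?n *\<^sub>R R ?n (y - x)) \<le> 2 * C * norm (y - x)"
      using \<nu>(2)[of k] by (simp add: field_simps)
    have "?n *\<^sub>R R ?n y - y = ?n *\<^sub>R R ?n (y - x) + (?n *\<^sub>R R ?n x - x) + (x - y)"
      by (simp add: R.diff algebra_simps)
    then have "norm (?n *\<^sub>R R ?n y - y) \<le> norm (?n *\<^sub>R R ?n (y - x)) + norm (?n *\<^sub>R R ?n x - x) + norm (x - y)"
      by (metis norm_triangle_mono norm_triangle_ineq order_refl)
    also have "\<dots> < 2 * C * norm (y - x) + \<epsilon> / 2 + norm (y - x)"
      using 1 2 by (simp add: norm_minus_commute)
    also have "\<dots> = (2 * C + 1) * norm (y - x) + \<epsilon> / 2" by (simp add: algebra_simps)
    also have "(2 * C + 1) * norm (y - x) \<le> (2 * C + 1) * ?\<eta>"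
      using xz(2) C by (intro mult_left_mono) (auto simp: dist_norm norm_minus_commute)
    also have "(2 * C + 1) * ?\<eta> = \<epsilon> / 2" using C by (simp add: field_simps)
    finally show ?case by (simp add: dist_norm)
  qed
qed

lemma Yosida_tendsto: "(x, y) \<in> A \<Longrightarrow> (\<lambda>k. Yosida k x) \<longlonglongrightarrow> y"
  using Yosida_resolvent_tendsto by (simp add: Yosida_domain)

end

section \<open>Convergence of the exponentials of the Yosida approximations\<close>

lemma vector_mean_value_bound:
  fixes f :: "real \<Rightarrow> 'a::real_normed_vector"
  assumes "a \<le> b" "\<And>s. s \<in> {a..b} \<Longrightarrow> (f has_vector_derivative f' s) (at s within {a..b})"
    and B: "\<And>s. s \<in> {a..b} \<Longrightarrow> norm (f' s) \<le> B"
  shows "norm (f b - f a) \<le> B * (b - a)"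
proof -
  have "norm (f b - f a) \<le> B * norm (b - a)"
  proof (rule differentiable_bound[of "{a..b}" f "\<lambda>s h. h *\<^sub>R f' s"])
    show "onorm (\<lambda>h. h *\<^sub>R f' s) \<le> B" if "s \<in> {a..b}" for s
    proof (rule onorm_bound)
      show "0 \<le> B" using B[OF that] norm_ge_zero[of "f' s"] by linarith
      show "norm (h *\<^sub>R f' s) \<le> B * norm h" for h :: real
        using mult_left_mono[OF B[OF that] abs_ge_zero[of h]] by (simp add: mult.commute)
    qed
  qed (use assms in \<open>auto simp: has_vector_derivative_def\<close>)
  then show ?thesis using assms(1) by simp
qed

context m_dissipative
begin

abbreviation E where "E k \<equiv> exp_blinfun (Yosida k)"

text \<open>The function exp(-8 \<omega> s) e(E s x, E s x) is nonincreasing: the energy is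
  quadratic, so its growth rate is twice the constant 4 \<omega> of
  \<open>Yosida_dissipative\<close>.\<close>

lemma E_energy:
  assumes t: "0 \<le> t"
  shows "e (E k t x) (E k t x) \<le> (exp (4 * \<omega> * t))\<^sup>2 * e x x"
proof -
  define g where "g s = exp (- 8 * \<omega> * s) * e (E k s x) (E k s x)" for s
  have "g t \<le> g 0"
  proof (rule DERIV_nonpos_imp_nonincreasing[OF t])
    fix s
    let ?y = "E k s x"
    have com: "E k s (Yosida k x) = Yosida k ?y" by (rule exp_blinfun_commute_apply) simp
    have d: "((\<lambda>s. E k s x) has_vector_derivative Yosida k ?y) (at s)"
      using exp_blinfun_apply_has_vector_derivative[of "Yosida k" x s] by (simp add: com)
    have "((\<lambda>s. e (E k s x) (E k s x)) has_real_derivative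
        (e ?y (Yosida k ?y) + e (Yosida k ?y) ?y)) (at s)"
      unfolding has_real_derivative_iff_has_vector_derivative by (rule e.has_vector_derivative[OF d d])
    then have "(g has_real_derivative (exp (- 8 * \<omega> * s) * (- 8 * \<omega>) * e ?y ?y +
        (e ?y (Yosida k ?y) + e (Yosida k ?y) ?y) * exp (- 8 * \<omega> * s))) (at s)"
      unfolding g_def by (intro DERIV_mult) (auto intro!: derivative_eq_intros)
    moreover have "exp (- 8 * \<omega> * s) * (- 8 * \<omega>) * e ?y ?y +
        (e ?y (Yosida k ?y) + e (Yosida k ?y) ?y) * exp (- 8 * \<omega> * s)
      = exp (- 8 * \<omega> * s) * (2 * (e (Yosida k ?y) ?y - 4 * \<omega> * e ?y ?y))"
      by (simp add: sym[of ?y "Yosida k ?y"] algebra_simps)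
    moreover have "\<dots> \<le> 0"
      using Yosida_dissipative[of k ?y] by (simp add: mult_nonneg_nonpos)
    ultimately show "\<exists>y. (g has_real_derivative y) (at s) \<and> y \<le> 0" by metis
  qed
  then have 1: "exp (8 * \<omega> * t) * g t \<le> exp (8 * \<omega> * t) * g 0" by (intro mult_left_mono) auto
  have "exp (8 * \<omega> * t) * exp (- 8 * \<omega> * t) = 1" by (simp flip: exp_add)
  then have 2: "exp (8 * \<omega> * t) * g t = e (E k t x) (E k t x)" by (simp add: g_def flip: mult.assoc)
  have 3: "exp (8 * \<omega> * t) = (exp (4 * \<omega> * t))\<^sup>2" by (simp add: power2_eq_square flip: exp_add)
  have "g 0 = e x x" by (simp add: g_def)
  with 1 show ?thesis unfolding 2 unfolding 3 by simp
qed

lemma E_bound: "0 \<le> t \<Longrightarrow> norm (E k t x) \<le> exp (4 * \<omega> * t) * C * norm x"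
  by (rule norm_le_energy[OF _ E_energy]) auto

text \<open>The path s \<mapsto> E l (t - s) (E k s x) joins the two values, and since the
  approximations commute its derivative is E l (t - s) E k s applied to the difference of the two
  Yosida operators at x. Each exponential costs one factor C.\<close>

lemma E_diff:
  assumes t: "0 \<le> t"
  shows "norm (E k t x - E l t x) \<le> exp (4 * \<omega> * t) * C\<^sup>2 * norm (Yosida k x - Yosida l x) * t"
proof -
  define \<phi> where "\<phi> s = E l (t - s) (E k s x)" for s
  have "norm (\<phi> t - \<phi> 0) \<le> (exp (4 * \<omega> * t) * C\<^sup>2 * norm (Yosida k x - Yosida l x)) * (t - 0)"
  proof (rule vector_mean_value_bound[OF t, where f' = "\<lambda>s. E l (t - s) (E k s (Yosida k x - Yosida l x))"])
    fix s assume s: "s \<in> {0..t}"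
    have "((\<lambda>s. E l (t - s)) has_vector_derivative (- 1) *\<^sub>R (E l (t - s) o\<^sub>L Yosida l)) (at s within {0..t})"
      by (rule vector_diff_chain_within[where g = "E l", unfolded o_def])
        (auto intro!: derivative_eq_intros exp_blinfun_has_vector_derivative)
    from bounded_bilinear.has_vector_derivative[OF bounded_bilinear_blinfun_apply this exp_blinfun_apply_has_vector_derivative]
    have "(\<phi> has_vector_derivative (E l (t - s) (E k s (Yosida k x)) + ((- 1) *\<^sub>R (E l (t - s) o\<^sub>L Yosida l)) (E k s x))) (at s within {0..t})"
      unfolding \<phi>_def .
    moreover have "E k s (Yosida l x) = Yosida l (E k s x)"
      by (rule exp_blinfun_commute_apply[OF Yosida_commute])
    ultimately show "(\<phi> has_vector_derivative E l (t - s) (E k s (Yosida k x - Yosida l x))) (at s within {0..t})"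
      by (simp add: blinfun.diff_right blinfun.minus_left)
    have "norm (E l (t - s) (E k s (Yosida k x - Yosida l x)))
        \<le> exp (4 * \<omega> * (t - s)) * C * (exp (4 * \<omega> * s) * C * norm (Yosida k x - Yosida l x))"
      using s C_pos by (intro E_bound[THEN order_trans] mult_left_mono E_bound) auto
    also have "\<dots> = (exp (4 * \<omega> * (t - s)) * exp (4 * \<omega> * s)) * C\<^sup>2 * norm (Yosida k x - Yosida l x)"
      by (simp add: power2_eq_square)
    also have "exp (4 * \<omega> * (t - s)) * exp (4 * \<omega> * s) = exp (4 * \<omega> * t)"
      by (simp add: algebra_simps flip: exp_add)
    finally show "norm (E l (t - s) (E k s (Yosida k x - Yosida l x))) \<le> exp (4 * \<omega> * t) * C\<^sup>2 * norm (Yosida k x - Yosida l x)" .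
  qed
  then show ?thesis by (simp add: \<phi>_def)
qed

text \<open>On the domain the Yosida operators converge, so \<open>E_diff\<close> gives the Cauchy
  property uniformly in t. A general x is replaced by a nearby point of the domain, at a cost that
  the uniform bound on the exponentials keeps small.\<close>

lemma E_uniformly_convergent:
  assumes \<tau>: "0 \<le> \<tau>"
  shows "uniformly_convergent_on {0..\<tau>} (\<lambda>k t. E k t x)"
proof (rule Cauchy_uniformly_convergent, rule uniformly_Cauchy_onI)
  fix \<epsilon> :: real assume \<epsilon>: "\<epsilon> > 0"
  define B where "B = exp (4 * \<omega> * \<tau>) * C"
  define D where "D = exp (4 * \<omega> * \<tau>) * C\<^sup>2 * \<tau>"
  have B: "B > 0" and D: "D \<ge> 0" using C_pos \<tau> by (auto simp: B_def D_def)
  have "\<forall>r>0. \<exists>z\<in>Domain A. dist z x < r"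
    using closure_approachable[of x "Domain A"] dense_domain by simp
  moreover have "\<epsilon> / (4 * B) > 0" using \<epsilon> B by simp
  ultimately obtain x' y' where xy: "(x', y') \<in> A" "norm (x - x') < \<epsilon> / (4 * B)"
    by (metis DomainE dist_norm norm_minus_commute)
  have "Cauchy (\<lambda>k. Yosida k x')" using Yosida_tendsto[OF xy(1)] by (rule LIMSEQ_imp_Cauchy)
  moreover have "\<epsilon> / (2 * (D + 1)) > 0" using \<epsilon> D by simp
  ultimately obtain N where N: "\<And>k l. k \<ge> N \<Longrightarrow> l \<ge> N \<Longrightarrow> norm (Yosida k x' - Yosida l x') < \<epsilon> / (2 * (D + 1))"
    by (meson CauchyD)
  show "\<exists>M. \<forall>t\<in>{0..\<tau>}. \<forall>m\<ge>M. \<forall>n\<ge>M. dist (E m t x) (E n t x) < \<epsilon>"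
  proof (intro exI[of _ N] ballI allI impI)
    fix t k l assume t: "t \<in> {0..\<tau>}" and k: "N \<le> k" and l: "N \<le> l"
    have mono: "exp (4 * \<omega> * t) \<le> exp (4 * \<omega> * \<tau>)" using t dissipative(1) by simp
    have bd: "norm (E k t (x - x')) < \<epsilon> / 4" for k
    proof -
      have "norm (E k t (x - x')) \<le> B * norm (x - x')"
        using E_bound[of t k "x - x'"] t mono C_pos unfolding B_def
        by (smt (verit) atLeastAtMost_iff mult_right_mono norm_ge_zero)
      also have "\<dots> < B * (\<epsilon> / (4 * B))" using xy(2) B by (intro mult_strict_left_mono)
      finally show ?thesis using B by simp
    qed
    let ?n = "norm (Yosida k x' - Yosida l x')"
    have "norm (E k t x' - E l t x') \<le> exp (4 * \<omega> * t) * C\<^sup>2 * ?n * t" using t by (intro E_diff) auto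
    also have "\<dots> \<le> exp (4 * \<omega> * \<tau>) * C\<^sup>2 * ?n * \<tau>"
      using t mono by (intro mult_mono) auto
    also have "\<dots> = D * ?n" by (simp add: D_def)
    also have "\<dots> \<le> D * (\<epsilon> / (2 * (D + 1)))" using N[OF k l] D by (intro mult_left_mono) auto
    also have "\<dots> \<le> \<epsilon> / 2" using D \<epsilon> by (simp add: field_simps)
    finally have 1: "norm (E k t x' - E l t x') \<le> \<epsilon> / 2" .
    have "E k t x - E l t x = E k t (x - x') - E l t (x - x') + (E k t x' - E l t x')"
      by (simp add: blinfun.diff_right)
    then have "norm (E k t x - E l t x) \<le> norm (E k t (x - x')) + norm (E l t (x - x')) + norm (E k t x' - E l t x')"
      by (metis norm_triangle_mono norm_triangle_ineq4 order_refl)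
    then show "dist (E k t x) (E l t x) < \<epsilon>" using bd[of k] bd[of l] 1 by (simp add: dist_norm)
  qed
qed

definition W :: "real \<Rightarrow> 'a \<Rightarrow>\<^sub>L 'a" where "W t = Blinfun (\<lambda>x. lim (\<lambda>k. E k t x))"

lemma E_tendsto_lim: "0 \<le> t \<Longrightarrow> (\<lambda>k. E k t x) \<longlonglongrightarrow> lim (\<lambda>k. E k t x)"
  using E_uniformly_convergent[of t x] unfolding uniformly_convergent_uniform_limit_iff
  by (rule tendsto_uniform_limitI) auto

lemma W_apply: "0 \<le> t \<Longrightarrow> W t x = lim (\<lambda>k. E k t x)"
proof -
  assume t: "0 \<le> t"
  note lim = E_tendsto_lim[OF t]
  have "bounded_linear (\<lambda>x. lim (\<lambda>k. E k t x))"
  proof (rule bounded_linear_intro[where K = "exp (4 * \<omega> * t) * C"])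
    show "lim (\<lambda>k. E k t (x + y)) = lim (\<lambda>k. E k t x) + lim (\<lambda>k. E k t y)" for x y
      by (rule limI) (simp add: blinfun.add_right tendsto_add lim)
    show "lim (\<lambda>k. E k t (r *\<^sub>R x)) = r *\<^sub>R lim (\<lambda>k. E k t x)" for r x
      by (rule limI) (simp add: blinfun.scaleR_right tendsto_scaleR lim)
    show "norm (lim (\<lambda>k. E k t x)) \<le> norm x * (exp (4 * \<omega> * t) * C)" for x
      by (rule LIMSEQ_le_const2[OF tendsto_norm[OF lim]]) (use E_bound[OF t] in \<open>auto simp: mult_ac\<close>)
  qed
  then show ?thesis by (simp add: W_def bounded_linear_Blinfun_apply)
qed

lemma E_tendsto: "0 \<le> t \<Longrightarrow> (\<lambda>k. E k t x) \<longlonglongrightarrow> W t x"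
  by (simp add: W_apply E_tendsto_lim)

lemma E_uniform_limit: "0 \<le> \<tau> \<Longrightarrow> uniform_limit {0..\<tau>} (\<lambda>k t. E k t x) (\<lambda>t. W t x) sequentially"
  using E_uniformly_convergent[of \<tau> x] unfolding uniformly_convergent_uniform_limit_iff
  by (rule uniform_limit_cong'[THEN iffD1, rotated 2]) (auto simp: W_apply)

lemma W_energy: "0 \<le> t \<Longrightarrow> e (W t x) (W t x) \<le> (exp (4 * \<omega> * t))\<^sup>2 * e x x"
  by (rule LIMSEQ_le_const2[OF e.tendsto[OF E_tendsto E_tendsto]]) (use E_energy in auto)

lemma W_C0_semigroup: "C0_semigroup W"
  unfolding C0_semigroup_def
proof (intro conjI allI impI)
  show "W 0 = id_blinfun"
  proof (rule blinfun_eqI)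
    fix x show "W 0 x = id_blinfun x"
      using LIMSEQ_unique[OF E_tendsto[of 0 x], of x] by simp
  qed
next
  fix s t :: real assume s: "0 \<le> s" and t: "0 \<le> t"
  show "W (s + t) = W s o\<^sub>L W t"
  proof (rule blinfun_eqI)
    fix x
    have "(\<lambda>k. exp (4 * \<omega> * s) * C * norm (E k t x - W t x)) \<longlonglongrightarrow> exp (4 * \<omega> * s) * C * 0"
      by (intro tendsto_mult tendsto_const tendsto_norm_zero LIM_zero E_tendsto t)
    then have lim: "(\<lambda>k. exp (4 * \<omega> * s) * C * norm (E k t x - W t x)) \<longlonglongrightarrow> 0" by simp
    \<comment> \<open>Both the operator and its argument vary with k; the bound on E k s, uniform in
      k, permits replacing the inner limit before the outer one is taken.\<close>
    have "(\<lambda>k. E k s (E k t x - W t x)) \<longlonglongrightarrow> 0"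
      by (rule Lim_null_comparison[OF _ lim]) (use E_bound[OF s] in simp)
    from tendsto_add[OF this E_tendsto[OF s, of "W t x"]]
    have "(\<lambda>k. E k (s + t) x) \<longlonglongrightarrow> W s (W t x)"
      by (simp add: blinfun.diff_right exp_blinfun_add)
    moreover have "(\<lambda>k. E k (s + t) x) \<longlonglongrightarrow> W (s + t) x" using s t by (intro E_tendsto) auto
    ultimately show "W (s + t) x = (W s o\<^sub>L W t) x" by (simp add: LIMSEQ_unique)
  qed
next
  fix x
  have cont: "continuous_on {0..\<tau>} (\<lambda>t. W t x)" if "0 \<le> \<tau>" for \<tau>
  proof (rule uniform_limit_theorem[OF _ E_uniform_limit[OF that]])
    have "continuous_on {0..\<tau>} (\<lambda>t. E k t x)" for k
      using exp_blinfun_apply_has_vector_derivative by (intro continuous_on_vector_derivative)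
    then show "\<forall>\<^sub>F k in sequentially. continuous_on {0..\<tau>} (\<lambda>t. E k t x)" by simp
  qed simp
  \<comment> \<open>Extending the orbit constantly to negative times makes every point interior to
    some interval of continuity, so the bounded intervals can be glued.\<close>
  have "isCont (\<lambda>t. W (max 0 t) x) t" for t
  proof -
    have "continuous_on {..<\<bar>t\<bar> + 1} (\<lambda>t. W (max 0 t) x)"
      by (rule continuous_on_compose2[OF cont[of "\<bar>t\<bar> + 1"]]) (auto intro!: continuous_intros)
    then show ?thesis by (rule continuous_on_interior) (simp add: interior_open)
  qed
  then have "continuous_on {0..} (\<lambda>t. W (max 0 t) x)" by (simp add: continuous_at_imp_continuous_on)
  then show "continuous_on {0..} (\<lambda>t. W t x)" by (rule continuous_on_eq) simp
qed

lemma W_tendsto_0: "((\<lambda>t. W t y) \<longlongrightarrow> y) (at_right 0)"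
proof -
  have c: "continuous_on {0..} (\<lambda>t. W t y)" and W0: "W 0 = id_blinfun"
    using W_C0_semigroup by (auto simp: C0_semigroup_def)
  have "((\<lambda>t. W t y) \<longlongrightarrow> W 0 y) (at 0 within {0..})"
    by (rule bspec[OF c[unfolded continuous_on_def]]) simp
  then have "((\<lambda>t. W t y) \<longlongrightarrow> y) (at 0 within {0..})" by (simp add: W0)
  then show ?thesis by (rule tendsto_within_subset) auto
qed

text \<open>The first-order expansion of the orbit is proved for the approximations by the mean
  value inequality and then passed to the limit in k. The derivative E k s (Yosida k x) - y splits
  into three parts, each at most \<epsilon>/3: convergence of the Yosida operators at x, uniform
  convergence of the exponentials at y, and continuity of W s y at 0.\<close>

lemma A_subset_generator:
  assumes xy: "(x, y) \<in> A"
  shows "(x, y) \<in> generator W"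
proof -
  have key: "norm (W t x - x - t *\<^sub>R y) \<le> \<epsilon> * t"
    if t: "0 \<le> t" and \<epsilon>: "\<epsilon> > 0" and small: "\<And>s. s \<in> {0..t} \<Longrightarrow> norm (W s y - y) \<le> \<epsilon> / 3" for t \<epsilon>
  proof (rule LIMSEQ_le_const2)
    show "(\<lambda>k. norm (E k t x - x - t *\<^sub>R y)) \<longlonglongrightarrow> norm (W t x - x - t *\<^sub>R y)"
      by (intro tendsto_intros E_tendsto t)
    define B where "B = exp (4 * \<omega> * t) * C"
    have B: "B > 0" using C_pos by (simp add: B_def)
    have "\<forall>\<^sub>F k in sequentially. norm (Yosida k x - y) < \<epsilon> / (3 * B)"
      using tendstoD[OF Yosida_tendsto[OF xy], of "\<epsilon> / (3 * B)"] \<epsilon> B by (simp add: dist_norm)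
    moreover have "\<forall>\<^sub>F k in sequentially. \<forall>s\<in>{0..t}. norm (E k s y - W s y) < \<epsilon> / 3"
      using uniform_limitD[OF E_uniform_limit[OF t], of "\<epsilon> / 3" y] \<epsilon> by (simp add: dist_norm)
    ultimately have "\<forall>\<^sub>F k in sequentially. norm (E k t x - x - t *\<^sub>R y) \<le> \<epsilon> * t"
    proof eventually_elim
      case (elim k)
      have "norm ((E k t x - t *\<^sub>R y) - (E k 0 x - 0 *\<^sub>R y)) \<le> \<epsilon> * (t - 0)"
      proof (rule vector_mean_value_bound[OF t, where f' = "\<lambda>s. E k s (Yosida k x) - y"])
        fix s assume s: "s \<in> {0..t}"
        show "((\<lambda>s. E k s x - s *\<^sub>R y) has_vector_derivative E k s (Yosida k x) - y) (at s within {0..t})"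
          by (intro has_vector_derivative_diff exp_blinfun_apply_has_vector_derivative) (auto intro!: derivative_eq_intros)
        have "norm (E k s (Yosida k x - y)) \<le> exp (4 * \<omega> * s) * C * norm (Yosida k x - y)"
          using s by (intro E_bound) auto
        also have "\<dots> \<le> B * norm (Yosida k x - y)"
          unfolding B_def using s dissipative(1) C_pos by (intro mult_right_mono) auto
        also have "\<dots> \<le> B * (\<epsilon> / (3 * B))" using elim(1) B by (intro mult_left_mono) auto
        also have "\<dots> = \<epsilon> / 3" using B by simp
        finally have 1: "norm (E k s (Yosida k x - y)) \<le> \<epsilon> / 3" .
        have "E k s (Yosida k x) - y = E k s (Yosida k x - y) + (E k s y - W s y) + (W s y - y)"
          by (simp add: blinfun.diff_right)
        then have "norm (E k s (Yosida k x) - y) \<le> norm (E k s (Yosida k x - y)) + norm (E k s y - W s y) + norm (W s y - y)"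
          by (metis norm_triangle_mono norm_triangle_ineq order_refl)
        moreover have "norm (E k s y - W s y) < \<epsilon> / 3" using elim(2) s by blast
        ultimately show "norm (E k s (Yosida k x) - y) \<le> \<epsilon>" using 1 small[OF s] by linarith
      qed
      then show ?case by (simp add: algebra_simps)
    qed
    then show "\<exists>N. \<forall>n\<ge>N. norm (E n t x - x - t *\<^sub>R y) \<le> \<epsilon> * t" by (simp add: eventually_sequentially)
  qed
  have "((\<lambda>t. (W t x - x) /\<^sub>R t) \<longlongrightarrow> y) (at_right 0)"
  proof (rule tendstoI)
    fix \<epsilon> :: real assume \<epsilon>: "\<epsilon> > 0"
    obtain d where d: "d > 0" "\<And>t. 0 < t \<Longrightarrow> t < d \<Longrightarrow> norm (W t y - y) < \<epsilon> / 6"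
      using tendstoD[OF W_tendsto_0, of "\<epsilon> / 6"] \<epsilon> unfolding eventually_at_right_field by (auto simp: dist_norm)
    have W0: "W 0 = id_blinfun" using W_C0_semigroup by (simp add: C0_semigroup_def)
    have "dist ((W t x - x) /\<^sub>R t) y < \<epsilon>" if t: "0 < t" "t < d" for t
    proof -
      have "norm (W s y - y) \<le> (\<epsilon> / 2) / 3" if "s \<in> {0..t}" for s
        using that d(2)[of s] t \<epsilon> W0 by (cases "s = 0") auto
      then have "norm (W t x - x - t *\<^sub>R y) \<le> \<epsilon> / 2 * t"
        using t \<epsilon> by (intro key) auto
      moreover have "(W t x - x) /\<^sub>R t - y = (W t x - x - t *\<^sub>R y) /\<^sub>R t" using t by (simp add: algebra_simps)
      then have "norm ((W t x - x) /\<^sub>R t - y) = norm (W t x - x - t *\<^sub>R y) / t"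
        using t by (simp add: divide_inverse_commute)
      ultimately have "norm ((W t x - x) /\<^sub>R t - y) \<le> \<epsilon> / 2" using t by (simp add: pos_divide_le_eq)
      then show ?thesis using \<epsilon> by (simp add: dist_norm)
    qed
    then show "\<forall>\<^sub>F t in at_right 0. dist ((W t x - x) /\<^sub>R t) y < \<epsilon>"
      unfolding eventually_at_right_field using d(1) by blast
  qed
  then show ?thesis by (simp add: generator_def)
qed

text \<open>The energy growth of W together with Cauchy-Schwarz bounds e(W t x, x) by exp(4 \<omega>
  t) e(x,x); dividing the increments by t and letting t tend to 0 differentiates this bound.\<close>

lemma generator_dissipative:
  assumes "(x, y) \<in> generator W"
  shows "e y x \<le> 4 * \<omega> * e x x"
proof (rule tendsto_le[OF _ _ _])
  show "((\<lambda>t. e ((W t x - x) /\<^sub>R t) x) \<longlongrightarrow> e y x) (at_right 0)"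
    using assms by (intro e.tendsto tendsto_const) (simp add: generator_def)
  have "((\<lambda>t. exp (4 * \<omega> * t)) has_real_derivative (4 * \<omega>)) (at 0)"
    by (auto intro!: derivative_eq_intros)
  then have "((\<lambda>t. (exp (4 * \<omega> * t) - 1) / t) \<longlongrightarrow> 4 * \<omega>) (at_right 0)"
    unfolding has_field_derivative_iff by (auto intro: tendsto_within_subset)
  then show "((\<lambda>t. (exp (4 * \<omega> * t) - 1) / t * e x x) \<longlongrightarrow> 4 * \<omega> * e x x) (at_right 0)"
    by (intro tendsto_mult tendsto_const)
  show "\<forall>\<^sub>F t in at_right 0. e ((W t x - x) /\<^sub>R t) x \<le> (exp (4 * \<omega> * t) - 1) / t * e x x"
    unfolding eventually_at_right_field
  proof (intro exI[of _ 1] conjI allI impI)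
    fix t :: real assume t: "0 < t"
    have "e (W t x) x \<le> exp (4 * \<omega> * t) * e x x"
      using e_le[OF _ W_energy, of t x] t by simp
    then have "(e (W t x) x - e x x) / t \<le> (exp (4 * \<omega> * t) * e x x - e x x) / t"
      using t by (intro divide_right_mono) auto
    then show "e ((W t x - x) /\<^sub>R t) x \<le> (exp (4 * \<omega> * t) - 1) / t * e x x"
      by (simp add: e.diff_left e.scaleR_left divide_inverse algebra_simps)
  qed simp
qed simp

text \<open>For the inclusion of the generator in \<open>A\<close>, solve the resolvent equation in
  \<open>A\<close> with right-hand side n x - y. The difference d of x and the solution satisfies
  (d, n d) in the generator, so dissipativity of the generator, with n above 4 \<omega>, gives d =
  0.\<close>

theorem generates_W: "generates A W"
  unfolding generates_def
proof (intro conjI W_C0_semigroup equalityI subsetI)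
  fix p assume p: "p \<in> generator W"
  obtain x y where xy: "p = (x, y)" by (cases p)
  define n where "n = max n1 (4 * \<omega> + 1)"
  have n: "n1 \<le> n" "4 * \<omega> < n" by (auto simp: n_def)
  define x' where "x' = R n (n *\<^sub>R x - y)"
  have x': "(x', n *\<^sub>R x' - (n *\<^sub>R x - y)) \<in> A" unfolding x'_def by (rule R[OF n(1)])
  define d where "d = x - x'"
  have "(d, n *\<^sub>R d) \<in> generator W"
  proof -
    have 1: "((\<lambda>t. (W t x - x) /\<^sub>R t) \<longlongrightarrow> y) (at_right 0)" using p xy by (simp add: generator_def)
    have 2: "((\<lambda>t. (W t x' - x') /\<^sub>R t) \<longlongrightarrow> n *\<^sub>R x' - (n *\<^sub>R x - y)) (at_right 0)"
      using A_subset_generator[OF x'] by (simp add: generator_def)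
    show ?thesis
      using tendsto_diff[OF 1 2] by (simp add: generator_def d_def blinfun.diff_right algebra_simps)
  qed
  from generator_dissipative[OF this] have "n * e d d \<le> 4 * \<omega> * e d d" by (simp add: e.scaleR_left)
  then have "(n - 4 * \<omega>) * e d d \<le> 0" by (simp add: algebra_simps)
  then have "e d d \<le> 0" using n by (simp add: mult_le_0_iff)
  then have "d = 0" using e_nonneg[of d] e_eq_0_iff[of d] by linarith
  then show "p \<in> A" using x' by (simp add: d_def xy)
next
  fix p assume "p \<in> A"
  then show "p \<in> generator W" using A_subset_generator by (cases p) simp
qed

end

section \<open>From a coercive form to a wave-type generator\<close>

instance prod :: (perfect_space, topological_space) perfect_space
proof
  fix p :: "'a \<times> 'b"
  show "\<not> open {p}"
  proof
    assume "open {p}"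
    then obtain A B where AB: "open A" "open B" "p \<in> A \<times> B" "A \<times> B \<subseteq> {p}"
      by (rule open_prod_elim) auto
    then have "A = {fst p}" by (cases p) auto
    then show False using AB(1) not_open_singleton by metis
  qed
qed

lemma bounded_bilinear_add:
  assumes "bounded_bilinear f" "bounded_bilinear g"
  shows "bounded_bilinear (\<lambda>x y. f x y + g x y)"
proof -
  interpret f: bounded_bilinear f by fact
  interpret g: bounded_bilinear g by fact
  obtain K L where K: "\<And>x y. norm (f x y) \<le> norm x * norm y * K" and L: "\<And>x y. norm (g x y) \<le> norm x * norm y * L"
    using f.bounded g.bounded by blast
  show ?thesis
  proof
    show "\<exists>K. \<forall>x y. norm (f x y + g x y) \<le> norm x * norm y * K"
      by (intro exI[of _ "K + L"] allI norm_triangle_le) (use K L in \<open>simp add: distrib_left add_mono\<close>)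
  qed (simp_all add: f.add_left f.add_right g.add_left g.add_right f.scaleR_left f.scaleR_right
      g.scaleR_left g.scaleR_right scaleR_add_right)
qed

lemma bounded_bilinear_cmult:
  fixes f :: "'a::real_normed_vector \<Rightarrow> 'b::real_normed_vector \<Rightarrow> real"
  assumes "bounded_bilinear f"
  shows "bounded_bilinear (\<lambda>x y. c * f x y)"
proof -
  interpret f: bounded_bilinear f by fact
  obtain K where K: "\<And>x y. norm (f x y) \<le> norm x * norm y * K" using f.bounded by blast
  show ?thesis
  proof
    show "\<exists>K. \<forall>x y. norm (c * f x y) \<le> norm x * norm y * K"
    proof (intro exI[of _ "\<bar>c\<bar> * K"] allI)
      fix x y
      show "norm (c * f x y) \<le> norm x * norm y * (\<bar>c\<bar> * K)"
        using mult_left_mono[OF K[of x y] abs_ge_zero[of c]] by (simp add: abs_mult mult_ac)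
    qed
  qed (simp_all add: f.add_left f.add_right f.scaleR_left f.scaleR_right distrib_left)
qed

text \<open>The relation is the graph of $(u,v)\mapsto(v,-Tu)$, where \<open>T\<close> is the operator of the form \<open>a\<close>. It is
  quasi-dissipative for the energy $a(u,u)+\mu\|ju\|^2+\|v\|^2$, and its resolvent is obtained by
  minimizing a coercive form.\<close>

theorem form_wave_generates:
  fixes j :: "'v::{banach, real_inner, perfect_space} \<Rightarrow> 'h::{banach, real_inner}" and a :: "'v \<Rightarrow> 'v \<Rightarrow> real"
  assumes j: "bounded_linear j" "\<And>u. j u = 0 \<Longrightarrow> u = 0" "\<And>f. (\<And>\<phi>. f \<bullet> j \<phi> = 0) \<Longrightarrow> f = 0"
    and a: "bounded_bilinear a" "\<And>u v. a u v = a v u"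
    and coercive: "0 < \<delta>" "0 \<le> \<mu>" "\<And>u. \<delta> * (norm u)\<^sup>2 \<le> a u u + \<mu> * (norm (j u))\<^sup>2"
  shows "\<exists>W. generates {((u, v), (z, w)). j z = v \<and> (\<forall>\<phi>. a u \<phi> = - (w \<bullet> j \<phi>))} W"
proof -
  interpret j: bounded_linear j by (rule j(1))
  interpret a: bounded_bilinear a by (rule a(1))
  let ?A = "{((u, v), (z, w)). j z = v \<and> (\<forall>\<phi>. a u \<phi> = - (w \<bullet> j \<phi>))}"
  define b where "b u v = a u v + \<mu> * (j u \<bullet> j v)" for u v
  have b: "bounded_bilinear b"
    unfolding b_def
    by (intro bounded_bilinear_add bounded_bilinear_cmult a(1) bounded_bilinear.comp[OF bounded_bilinear_inner j(1) j(1)])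
  interpret b: bounded_bilinear b by (rule b)
  have b_coercive: "\<delta> * (norm u)\<^sup>2 \<le> b u u" for u
    using coercive(3)[of u] by (simp add: b_def power2_norm_eq_inner)
  define e where "e p q = b (fst p) (fst q) + snd p \<bullet> snd q" for p q :: "'v \<times> 'h"
  have e: "bounded_bilinear e"
    unfolding e_def
    by (intro bounded_bilinear_add bounded_bilinear.comp[OF b bounded_linear_fst bounded_linear_fst]
        bounded_bilinear.comp[OF bounded_bilinear_inner bounded_linear_snd bounded_linear_snd])
  obtain J where J: "\<And>u. norm (j u) \<le> norm u * J" using j.bounded by blast
  define \<delta>' where "\<delta>' = min \<delta> 1"
  have \<delta>': "0 < \<delta>'" "\<delta>' \<le> \<delta>" "\<delta>' \<le> 1" using coercive(1) by (auto simp: \<delta>'_def)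
  have e_coercive: "\<delta>' * (norm p)\<^sup>2 \<le> e p p" for p
  proof -
    have "\<delta>' * (norm p)\<^sup>2 = \<delta>' * (norm (fst p))\<^sup>2 + \<delta>' * (norm (snd p))\<^sup>2"
      by (cases p) (simp add: norm_Pair distrib_left)
    also have "\<dots> \<le> \<delta> * (norm (fst p))\<^sup>2 + 1 * (norm (snd p))\<^sup>2"
      using \<delta>' by (intro add_mono mult_right_mono) auto
    also have "\<dots> \<le> e p p" using b_coercive[of "fst p"] by (simp add: e_def power2_norm_eq_inner)
    finally show ?thesis .
  qed
  \<comment> \<open>After the skew part cancels, e(y,x) is \<mu> times the product of v and j u,
    hence at most \<mu> |J| times the squared norm; \<delta>' converts this to the energy, and the
    summand 1 makes \<omega> positive.\<close>
  define \<omega> where "\<omega> = (\<mu> * \<bar>J\<bar> + 1) / \<delta>'"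
  have "m_dissipative ?A e \<delta>' \<omega> (\<mu> + 1)"
  proof (rule m_dissipative.intro)
    show "bounded_bilinear e" by (rule e)
    show "e x y = e y x" for x y by (simp add: e_def b_def a(2)[of "fst x"] inner_commute)
    show "0 < \<delta>'" by (rule \<delta>')
    show "\<delta>' * (norm x)\<^sup>2 \<le> e x x" for x by (rule e_coercive)
    show "0 < \<omega>" using coercive(2) \<delta>' by (auto simp: \<omega>_def intro!: divide_pos_pos add_nonneg_pos)
    show "subspace ?A"
      unfolding subspace_def
      by (auto simp: zero_prod_def j.zero j.add j.scaleR a.zero_left a.add_left a.scaleR_left inner_add_left)
    show "y = 0" if "(0, y) \<in> ?A" for y
    proof -
      have y: "j (fst y) = 0" "\<And>\<phi>. - (snd y \<bullet> j \<phi>) = 0"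
        using that by (auto simp: zero_prod_def a.zero_left case_prod_beta)
      have "fst y = 0" using y(1) by (rule j(2))
      moreover have "snd y = 0" using y(2) by (intro j(3)) simp
      ultimately show ?thesis by (simp add: prod_eq_iff)
    qed
    show "e y x \<le> \<omega> * e x x" if "(x, y) \<in> ?A" for x y
    proof -
      obtain u v z w where xy: "x = (u, v)" "y = (z, w)" by (metis prod.exhaust)
      have A: "j z = v" "\<And>\<phi>. a u \<phi> = - (w \<bullet> j \<phi>)" using that xy by auto
      have "e y x = a z u + \<mu> * (j z \<bullet> j u) + w \<bullet> v" by (simp add: e_def b_def xy)
      \<comment> \<open>The cancellation behind conservation of the wave energy: a(z,u) and the
        inner product of w and v differ only in sign, which leaves just the artificial
        \<mu>-term.\<close>
      also have "a z u = - (w \<bullet> v)" using A a(2)[of z u] by simp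
      finally have "e y x = \<mu> * (v \<bullet> j u)" using A(1) by simp
      also have "\<dots> \<le> \<mu> * (norm v * norm (j u))"
        using coercive(2) by (intro mult_left_mono norm_cauchy_schwarz) auto
      also have "\<dots> \<le> \<mu> * (norm x * (norm x * \<bar>J\<bar>))"
      proof -
        have v: "norm v \<le> norm x" using norm_snd_le[of v u] by (simp add: xy)
        have u: "norm u \<le> norm x" using norm_fst_le[of u v] by (simp add: xy)
        have "norm (j u) \<le> norm u * \<bar>J\<bar>" using J[of u] mult_left_mono[OF abs_ge_self[of J] norm_ge_zero[of u]] by linarith
        also have "\<dots> \<le> norm x * \<bar>J\<bar>" using u by (rule mult_right_mono) simp
        finally have "norm v * norm (j u) \<le> norm x * (norm x * \<bar>J\<bar>)" using v by (intro mult_mono) auto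
        then show ?thesis using coercive(2) by (rule mult_left_mono)
      qed
      also have "\<dots> \<le> (\<mu> * \<bar>J\<bar> + 1) * (norm x)\<^sup>2"
        by (simp add: power2_eq_square algebra_simps)
      also have "\<dots> = \<omega> * (\<delta>' * (norm x)\<^sup>2)" using \<delta>'(1) by (simp add: \<omega>_def)
      also have "\<dots> \<le> \<omega> * e x x"
        using e_coercive[of x] coercive(2) \<delta>'(1) by (intro mult_left_mono) (auto simp: \<omega>_def)
      finally show ?thesis .
    qed
    show "\<exists>x. (x, n *\<^sub>R x - y) \<in> ?A" if n: "\<mu> + 1 \<le> n" for n y
    proof -
      obtain f g where y: "y = (f, g)" by (cases y)
      \<comment> \<open>The system requires z = n u - f, w = n v - g and v = j z. Eliminating v and
        w leaves a(u,\<phi>) + n^2 (j u, j \<phi>) = (g + n j f, j \<phi>), a single variational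
        equation for u.\<close>
      define c where "c u v = a u v + n\<^sup>2 * (j u \<bullet> j v)" for u v
      have c: "bounded_bilinear c"
        unfolding c_def
        by (intro bounded_bilinear_add bounded_bilinear_cmult a(1) bounded_bilinear.comp[OF bounded_bilinear_inner j(1) j(1)])
      \<comment> \<open>The threshold \<mu> + 1 gives n \<ge> 1, hence n^2 \<ge> n \<ge> \<mu>, so
        \<open>c\<close> dominates the coercive form \<open>b\<close> on the diagonal.\<close>
      have "\<mu> \<le> n\<^sup>2"
      proof -
        have "n * 1 \<le> n * n" using n coercive(2) by (intro mult_left_mono) auto
        then show ?thesis using n by (simp add: power2_eq_square)
      qed
      have cc: "\<delta> * (norm u)\<^sup>2 \<le> c u u" for u
      proof -
        have "\<mu> * (j u \<bullet> j u) \<le> n\<^sup>2 * (j u \<bullet> j u)" using \<open>\<mu> \<le> n\<^sup>2\<close> by (intro mult_right_mono) auto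
        then show ?thesis using b_coercive[of u] by (simp add: b_def c_def)
      qed
      have l: "bounded_linear (\<lambda>\<phi>. (g + n *\<^sub>R j f) \<bullet> j \<phi>)"
        by (rule bounded_linear_compose[OF bounded_linear_inner_right j(1)])
      obtain u where u: "\<And>\<phi>. c u \<phi> = (g + n *\<^sub>R j f) \<bullet> j \<phi>"
        using coercive_minimizer[OF c _ coercive(1) cc subspace_UNIV closed_UNIV l]
        by (auto simp: c_def a(2) inner_commute)
      define v where "v = j (n *\<^sub>R u - f)"
      have "((u, v), n *\<^sub>R (u, v) - y) \<in> ?A"
        using u by (simp add: y v_def c_def j.diff j.scaleR inner_diff_left inner_add_left power2_eq_square algebra_simps)
      then show ?thesis by (rule exI)
    qed
  qed
  then interpret m_dissipative ?A e \<delta>' \<omega> "\<mu> + 1" .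
  show ?thesis using generates_W by blast
qed

section \<open>Completeness of $L^2(0,\infty)$ and $H^1(0,\infty)$\<close>

lemma l2_class_eq_iff:
  assumes "square_integrable f" "square_integrable g"
  shows "l2_class f = l2_class g \<longleftrightarrow> (AE x in halfline. f x = g x)"
  using Quotient3_rel[OF Quotient3_l2, of f g] assms by (auto simp: l2_class_def)

lemma l2_cases:
  obtains f where "square_integrable f" "u = l2_class f"
proof
  show "square_integrable (rep_l2 u)" using Quotient3_rep_reflp[OF Quotient3_l2, of u] by simp
  show "u = l2_class (rep_l2 u)" by (simp add: l2_class_def Quotient3_abs_rep[OF Quotient3_l2])
qed

lemma l2_class_zero: "l2_class (\<lambda>x. 0) = 0"
  by (simp add: l2_class_def zero_l2.abs_eq)

lemma l2_class_add:
  "square_integrable f \<Longrightarrow> square_integrable g \<Longrightarrow> l2_class f + l2_class g = l2_class (\<lambda>x. f x + g x)"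
  by (simp add: l2_class_def plus_l2.abs_eq)

lemma l2_class_minus: "square_integrable f \<Longrightarrow> - l2_class f = l2_class (\<lambda>x. - f x)"
  by (simp add: l2_class_def uminus_l2.abs_eq)

lemma square_integrable_diff:
  "square_integrable f \<Longrightarrow> square_integrable g \<Longrightarrow> square_integrable (\<lambda>x. f x - g x)"
  using square_integrable_add[OF _ square_integrable_minus] by fastforce

lemma l2_class_diff:
  "square_integrable f \<Longrightarrow> square_integrable g \<Longrightarrow> l2_class f - l2_class g = l2_class (\<lambda>x. f x - g x)"
  by (simp add: minus_l2_def l2_class_minus l2_class_add square_integrable_minus)

lemma l2_class_scale: "square_integrable f \<Longrightarrow> r *\<^sub>R l2_class f = l2_class (\<lambda>x. r * f x)"
  by (simp add: l2_class_def scaleR_l2.abs_eq)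

lemma l2_class_inner:
  "square_integrable f \<Longrightarrow> square_integrable g \<Longrightarrow> l2_class f \<bullet> l2_class g = (LINT x|halfline. f x * g x)"
  by (simp add: l2_class_def inner_l2.abs_eq)

lemma sin_l2_class: "square_integrable f \<Longrightarrow> sin_l2 (l2_class f) = l2_class (\<lambda>x. sin (f x))"
  by (simp add: l2_class_def sin_l2.abs_eq)

lemma norm_l2_class: "square_integrable f \<Longrightarrow> (norm (l2_class f))\<^sup>2 = (LINT x|halfline. (f x)\<^sup>2)"
  by (simp add: power2_norm_eq_inner l2_class_inner) (simp add: power2_eq_square)

lemma norm_l2_class_le:
  assumes f: "square_integrable f" and g: "square_integrable g"
    and le: "AE x in halfline. \<bar>f x\<bar> \<le> C * \<bar>g x\<bar>" and C: "0 \<le> C"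
  shows "norm (l2_class f) \<le> C * norm (l2_class g)"
proof (rule power2_le_imp_le)
  have "(LINT x|halfline. (f x)\<^sup>2) \<le> (LINT x|halfline. C\<^sup>2 * (g x)\<^sup>2)"
  proof (rule integral_mono_AE)
    show "AE x in halfline. (f x)\<^sup>2 \<le> C\<^sup>2 * (g x)\<^sup>2"
      using le
    proof eventually_elim
      case (elim x)
      then have "\<bar>f x\<bar>\<^sup>2 \<le> (C * \<bar>g x\<bar>)\<^sup>2" by (intro power_mono) auto
      then show ?case by (simp add: power_mult_distrib)
    qed
  qed (use f g in \<open>auto simp: square_integrable_def\<close>)
  then show "(norm (l2_class f))\<^sup>2 \<le> (C * norm (l2_class g))\<^sup>2"
    by (simp add: power_mult_distrib norm_l2_class f g)
qed (use C in simp)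

lemma square_integrable_nn_integral:
  assumes m: "f \<in> borel_measurable halfline"
    and le: "(\<integral>\<^sup>+x. ennreal ((f x)\<^sup>2) \<partial>halfline) \<le> ennreal c" and c: "0 \<le> c"
  shows "square_integrable f" "(norm (l2_class f))\<^sup>2 \<le> c"
proof -
  have "integrable halfline (\<lambda>x. (f x)\<^sup>2)"
    by (rule integrableI_bounded) (use m le in \<open>auto simp: le_less_trans\<close>)
  then show f: "square_integrable f" using m by (simp add: square_integrable_def)
  have "ennreal (LINT x|halfline. (f x)\<^sup>2) \<le> ennreal c"
    using le \<open>integrable halfline (\<lambda>x. (f x)\<^sup>2)\<close> by (simp add: nn_integral_eq_integral)
  then show "(norm (l2_class f))\<^sup>2 \<le> c" using c by (simp add: norm_l2_class[OF f])
qed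

lemma nn_integral_l2_class:
  assumes "square_integrable f"
  shows "(\<integral>\<^sup>+x. ennreal ((f x)\<^sup>2) \<partial>halfline) = ennreal ((norm (l2_class f))\<^sup>2)"
  using assms by (simp add: norm_l2_class nn_integral_eq_integral square_integrable_def)

lemma Cauchy_fast_subsequence:
  fixes X :: "nat \<Rightarrow> 'a::real_normed_vector"
  assumes "Cauchy X"
  shows "\<exists>r. mono r \<and> (\<forall>k. \<forall>i\<ge>r k. \<forall>j\<ge>r k. norm (X i - X j) < (1/2) ^ k)"
proof -
  have "\<exists>M. \<forall>i\<ge>M. \<forall>j\<ge>M. norm (X i - X j) < (1/2) ^ k" for k
    using CauchyD[OF assms, of "(1/2) ^ k"] by simp
  then obtain M where M: "\<And>k i j. M k \<le> i \<Longrightarrow> M k \<le> j \<Longrightarrow> norm (X i - X j) < (1/2) ^ k" by metis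
  \<comment> \<open>The thresholds M k need not increase; their partial sums do, and still dominate
    them.\<close>
  define r where "r k = (\<Sum>i\<le>k. M i)" for k
  have "M k \<le> r k" for k unfolding r_def by (rule member_le_sum) auto
  moreover have "mono r" unfolding r_def by (intro monoI sum_mono2) auto
  ultimately show ?thesis using M by (intro exI[of _ r]) (meson le_trans)
qed

text \<open>The sum of the weighted squares $2^k(f_{k+1}-f_k)^2$ along a fast subsequence
  is integrable, which forces pointwise convergence almost everywhere.\<close>

instance l2 :: banach
proof
  fix X :: "nat \<Rightarrow> l2" assume "Cauchy X"
  then obtain r where r: "\<And>k i j. r k \<le> i \<Longrightarrow> r k \<le> j \<Longrightarrow> norm (X i - X j) < (1/2) ^ k" and "mono r"
    using Cauchy_fast_subsequence by blast
  have "\<exists>f. square_integrable f \<and> X (r k) = l2_class f" for k by (metis l2_cases)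
  then obtain f where f: "\<And>k. square_integrable (f k)" "\<And>k. X (r k) = l2_class (f k)" by metis
  have meas [measurable]: "f k \<in> borel_measurable halfline" for k
    using f(1)[of k] by (simp add: square_integrable_def)
  have diff: "(\<integral>\<^sup>+x. ennreal ((f n x - f m x)\<^sup>2) \<partial>halfline) \<le> ennreal ((1/4) ^ n)" if "n \<le> m" for n m
  proof -
    have "norm (X (r n) - X (r m)) < (1/2) ^ n" by (rule r) (use \<open>mono r\<close> that in \<open>auto dest: monoD\<close>)
    then have "(norm (X (r n) - X (r m)))\<^sup>2 \<le> ((1/2) ^ n)\<^sup>2" by (intro power_mono) auto
    also have "\<dots> = (1/4::real) ^ n" by (simp add: power2_eq_square flip: power_mult_distrib)
    finally show ?thesis
      using f by (simp add: nn_integral_l2_class square_integrable_diff l2_class_diff ennreal_leI)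
  qed
  \<comment> \<open>The weight 2^k leaves the integrals summable, as 2^k (1/4)^k = (1/2)^k.
    Pointwise, |d| \<le> (1/2)^k + 2^k d^2 then turns summability of h into absolute convergence of
    the telescoping series.\<close>
  define h where "h k x = 2 ^ k * (f (Suc k) x - f k x)\<^sup>2" for k x
  have h_nonneg: "0 \<le> h k x" for k x by (simp add: h_def)
  have "(\<integral>\<^sup>+x. (\<Sum>k. ennreal (h k x)) \<partial>halfline) = (\<Sum>k. \<integral>\<^sup>+x. ennreal (h k x) \<partial>halfline)"
    by (rule nn_integral_suminf) (simp add: h_def)
  also have "\<dots> \<le> (\<Sum>k. ennreal ((1/2) ^ k))"
  proof (rule suminf_le)
    fix k
    have "(\<integral>\<^sup>+x. ennreal (h k x) \<partial>halfline) = ennreal (2 ^ k) * (\<integral>\<^sup>+x. ennreal ((f k x - f (Suc k) x)\<^sup>2) \<partial>halfline)"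
      unfolding h_def by (subst nn_integral_cmult[symmetric]) (simp_all add: ennreal_mult power2_commute)
    also have "\<dots> \<le> ennreal (2 ^ k) * ennreal ((1/4) ^ k)" by (intro mult_left_mono diff) auto
    also have "\<dots> = ennreal ((1/2) ^ k)" by (simp add: ennreal_mult[symmetric] flip: power_mult_distrib)
    finally show "(\<integral>\<^sup>+x. ennreal (h k x) \<partial>halfline) \<le> ennreal ((1/2) ^ k)" .
  qed auto
  also have "\<dots> < \<infinity>" by (subst suminf_ennreal2) (auto simp: summable_geometric)
  finally have "AE x in halfline. (\<Sum>k. ennreal (h k x)) \<noteq> \<infinity>"
    by (intro nn_integral_PInf_AE) (auto simp: h_def)
  then have conv: "AE x in halfline. (\<lambda>k. f k x) \<longlonglongrightarrow> lim (\<lambda>k. f k x)"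
  proof eventually_elim
    case (elim x)
    have "summable (\<lambda>k. h k x)" by (rule summable_suminf_not_top) (use elim h_nonneg in auto)
    then have "summable (\<lambda>k. (1/2) ^ k + h k x)" by (intro summable_add) (auto simp: summable_geometric)
    then have "summable (\<lambda>k. f (Suc k) x - f k x)"
    proof (rule summable_comparison_test[rotated], intro exI[of _ 0] allI impI)
      fix k
      let ?d = "\<bar>f (Suc k) x - f k x\<bar>"
      have "0 \<le> (2 ^ k * ?d - 1)\<^sup>2" by simp
      then have "2 * 2 ^ k * ?d \<le> (2 ^ k)\<^sup>2 * ?d\<^sup>2 + 1" by (simp add: power2_diff power_mult_distrib)
      moreover have "0 \<le> 2 ^ k * ?d" by simp
      ultimately have "2 ^ k * ?d \<le> (2 ^ k)\<^sup>2 * ?d\<^sup>2 + 1" by linarith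
      then have "(1/2) ^ k * (2 ^ k * ?d) \<le> (1/2) ^ k * ((2 ^ k)\<^sup>2 * ?d\<^sup>2 + 1)" by (intro mult_left_mono) auto
      moreover have "(1/2::real) ^ k * 2 ^ k = 1" by (simp flip: power_mult_distrib)
      ultimately show "norm (f (Suc k) x - f k x) \<le> (1/2) ^ k + h k x"
        by (simp add: h_def distrib_left power2_eq_square flip: mult.assoc)
    qed
    then have "summable (\<lambda>k. f (Suc k) x - f k x)" .
    then have "convergent (\<lambda>n. \<Sum>k<n. f (Suc k) x - f k x)" by (simp add: summable_iff_convergent)
    then have "convergent (\<lambda>n. f n x - f 0 x)" unfolding sum_lessThan_telescope[of "\<lambda>k. f k x"] .
    then have "convergent (\<lambda>n. (f n x - f 0 x) + f 0 x)" by (intro convergent_add convergent_const)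
    then show ?case by (simp add: convergent_LIMSEQ_iff)
  qed
  define g where "g x = lim (\<lambda>k. f k x)" for x
  have [measurable]: "g \<in> borel_measurable halfline" unfolding g_def by measurable
  \<comment> \<open>Fatou's lemma, applied as m tends to infinity with n fixed, transfers the
    estimate \<open>diff\<close> to the pointwise limit.\<close>
  have bound: "(\<integral>\<^sup>+x. ennreal ((f n x - g x)\<^sup>2) \<partial>halfline) \<le> ennreal ((1/4) ^ n)" for n
  proof -
    have "(\<integral>\<^sup>+x. ennreal ((f n x - g x)\<^sup>2) \<partial>halfline) = (\<integral>\<^sup>+x. liminf (\<lambda>m. ennreal ((f n x - f m x)\<^sup>2)) \<partial>halfline)"
    proof (rule nn_integral_cong_AE)
      show "AE x in halfline. ennreal ((f n x - g x)\<^sup>2) = liminf (\<lambda>m. ennreal ((f n x - f m x)\<^sup>2))"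
        using conv
      proof eventually_elim
        case (elim x)
        have "(\<lambda>m. ennreal ((f n x - f m x)\<^sup>2)) \<longlonglongrightarrow> ennreal ((f n x - g x)\<^sup>2)"
          using elim by (intro tendsto_ennrealI tendsto_power tendsto_diff tendsto_const) (simp add: g_def)
        then show ?case by (rule lim_imp_Liminf[OF trivial_limit_sequentially, symmetric])
      qed
    qed
    also have "\<dots> \<le> liminf (\<lambda>m. \<integral>\<^sup>+x. ennreal ((f n x - f m x)\<^sup>2) \<partial>halfline)"
      by (rule nn_integral_liminf) simp
    also have "\<dots> \<le> limsup (\<lambda>m. \<integral>\<^sup>+x. ennreal ((f n x - f m x)\<^sup>2) \<partial>halfline)"
      by (rule Liminf_le_Limsup) simp
    also have "\<dots> \<le> ennreal ((1/4) ^ n)"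
      by (rule Limsup_bounded) (use diff in \<open>auto simp: eventually_sequentially\<close>)
    finally show ?thesis .
  qed
  have si: "square_integrable (\<lambda>x. f n x - g x)" and le: "(norm (l2_class (\<lambda>x. f n x - g x)))\<^sup>2 \<le> (1/4) ^ n" for n
    using square_integrable_nn_integral[OF _ bound[of n]] by auto
  have g: "square_integrable g"
    using square_integrable_diff[OF f(1)[of 0] si[of 0]] by simp
  have near: "norm (X (r n) - l2_class g) \<le> (1/2) ^ n" for n
  proof (rule power2_le_imp_le)
    have "((1/2::real) ^ n)\<^sup>2 = (1/4) ^ n" by (simp add: power2_eq_square flip: power_mult_distrib)
    then show "(norm (X (r n) - l2_class g))\<^sup>2 \<le> ((1/2) ^ n)\<^sup>2"
      using le[of n] by (simp add: f l2_class_diff g)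
  qed simp
  have "X \<longlonglongrightarrow> l2_class g"
  proof (rule LIMSEQ_I)
    fix e :: real assume "e > 0"
    then obtain k where k: "(1/2) ^ k < e / 2" using real_arch_pow_inv[of "e / 2" "1/2"] by auto
    show "\<exists>N. \<forall>n\<ge>N. norm (X n - l2_class g) < e"
    proof (intro exI[of _ "r k"] allI impI)
      fix n assume "r k \<le> n"
      then have "norm (X n - X (r k)) < (1/2) ^ k" by (rule r) simp
      then show "norm (X n - l2_class g) < e"
        using near[of k] k norm_triangle_ineq[of "X n - X (r k)" "X (r k) - l2_class g"] by simp
    qed
  qed
  then show "convergent X" by (rule convergentI)
qed

section \<open>H^1(0,\<infinity>) as a Banach space\<close>

lemma h1_eqI: "h1_fun u = h1_fun v \<Longrightarrow> h1_deriv u = h1_deriv v \<Longrightarrow> u = v"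
  by transfer (simp add: prod_eq_iff)

lemma h1_ex: "weak_derivative f g \<Longrightarrow> \<exists>u. h1_fun u = f \<and> h1_deriv u = g"
  by (intro exI[of _ "Abs_h1 (f, g)"]) (simp add: h1_fun.rep_eq h1_deriv.rep_eq Abs_h1_inverse)

lemma weak_derivative_h1: "weak_derivative (h1_fun u) (h1_deriv u)"
  by transfer auto

lemma inner_h1: "(u :: h1) \<bullet> v = h1_fun u \<bullet> h1_fun v + h1_deriv u \<bullet> h1_deriv v"
  by transfer (simp add: inner_prod_def)

lemma norm_h1: "(norm (u :: h1))\<^sup>2 = (norm (h1_fun u))\<^sup>2 + (norm (h1_deriv u))\<^sup>2"
  by (simp add: power2_norm_eq_inner inner_h1)

lemma norm_h1_fun_le: "norm (h1_fun u) \<le> norm u" and norm_h1_deriv_le: "norm (h1_deriv u) \<le> norm u"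
  by (rule power2_le_imp_le; simp add: norm_h1)+

lemma bounded_linear_h1_fun: "bounded_linear h1_fun"
  by (rule bounded_linear_intro[where K = 1]) (transfer, simp, transfer, simp, simp add: norm_h1_fun_le)

lemma bounded_linear_h1_deriv: "bounded_linear h1_deriv"
  by (rule bounded_linear_intro[where K = 1]) (transfer, simp, transfer, simp, simp add: norm_h1_deriv_le)

lemmas h1_linear =
  linear_0[OF bounded_linear.linear[OF bounded_linear_h1_fun]]
  linear_add[OF bounded_linear.linear[OF bounded_linear_h1_fun]]
  linear_diff[OF bounded_linear.linear[OF bounded_linear_h1_fun]]
  linear_scale[OF bounded_linear.linear[OF bounded_linear_h1_fun]]
  linear_0[OF bounded_linear.linear[OF bounded_linear_h1_deriv]]
  linear_add[OF bounded_linear.linear[OF bounded_linear_h1_deriv]]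
  linear_diff[OF bounded_linear.linear[OF bounded_linear_h1_deriv]]
  linear_scale[OF bounded_linear.linear[OF bounded_linear_h1_deriv]]

text \<open>The functions and their derivatives converge separately in L^2. The weak derivative
  relation passes to the limit because it is tested by continuous functionals.\<close>

instance h1 :: banach
proof
  fix X :: "nat \<Rightarrow> h1" assume X: "Cauchy X"
  obtain a b where a: "(\<lambda>n. h1_fun (X n)) \<longlonglongrightarrow> a" and b: "(\<lambda>n. h1_deriv (X n)) \<longlonglongrightarrow> b"
    using bounded_linear.Cauchy[OF bounded_linear_h1_fun X] bounded_linear.Cauchy[OF bounded_linear_h1_deriv X] by (auto simp: Cauchy_convergent_iff convergent_def)
  have "weak_derivative a b"
    unfolding weak_derivative_def
  proof (intro allI impI)
    fix \<phi> \<phi>' assume "C1_test_function \<phi> \<phi>'"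
    then have "h1_fun (X n) \<bullet> l2_class \<phi>' = - (h1_deriv (X n) \<bullet> l2_class \<phi>)" for n
      using weak_derivative_h1[of "X n"] unfolding weak_derivative_def by blast
    then have "(\<lambda>n. h1_fun (X n) \<bullet> l2_class \<phi>') \<longlonglongrightarrow> - (b \<bullet> l2_class \<phi>)"
      using b by (auto intro!: tendsto_intros)
    moreover have "(\<lambda>n. h1_fun (X n) \<bullet> l2_class \<phi>') \<longlonglongrightarrow> a \<bullet> l2_class \<phi>'"
      using a by (intro tendsto_intros)
    ultimately show "a \<bullet> l2_class \<phi>' = - (b \<bullet> l2_class \<phi>)" by (rule LIMSEQ_unique[rotated])
  qed
  then obtain u where u: "h1_fun u = a" "h1_deriv u = b" using h1_ex by blast
  have "(\<lambda>n. sqrt ((norm (h1_fun (X n) - a))\<^sup>2 + (norm (h1_deriv (X n) - b))\<^sup>2)) \<longlonglongrightarrow> sqrt (0\<^sup>2 + 0\<^sup>2)"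
    by (intro tendsto_real_sqrt tendsto_add tendsto_power tendsto_norm_zero LIM_zero a b)
  moreover have "sqrt ((norm (h1_fun (X n) - a))\<^sup>2 + (norm (h1_deriv (X n) - b))\<^sup>2) = norm (X n - u)" for n
    by (rule real_sqrt_unique) (simp_all add: norm_h1 h1_linear u)
  ultimately have "(\<lambda>n. norm (X n - u)) \<longlonglongrightarrow> 0" by simp
  then have "X \<longlonglongrightarrow> u" by (rule tendsto_norm_zero_cancel[THEN LIM_zero_cancel])
  then show "convergent X" by (rule convergentI)
qed

section \<open>Primitives of integrable functions\<close>

lemma halfline_integrable_iff:
  fixes f :: "real \<Rightarrow> real"
  shows "integrable halfline f \<longleftrightarrow> f absolutely_integrable_on {0<..}"
  by (simp add: set_integrable_def integrable_restrict_space)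

lemma integrable_on_imp_Icc:
  fixes f :: "real \<Rightarrow> real"
  assumes "f absolutely_integrable_on {0<..}"
  shows "f absolutely_integrable_on {0..b}"
proof -
  have "f absolutely_integrable_on {0<..<b}"
    using assms by (rule set_integrable_subset) auto
  then show ?thesis by (simp add: absolutely_integrable_on_Icc_iff_Ioo)
qed

text \<open>On a bounded interval |f| is dominated by the integrable function 1 + f^2; this makes
  primitives of L^2 functions available from the endpoint 0 on.\<close>

lemma square_integrable_imp_Icc:
  assumes f: "square_integrable f"
  shows "f absolutely_integrable_on {0..b}"
proof -
  have "(\<lambda>x. (f x)\<^sup>2) absolutely_integrable_on {0<..}"
    using f by (simp add: square_integrable_def halfline_integrable_iff)
  then have "(\<lambda>x. 1 + (f x)\<^sup>2) absolutely_integrable_on {0..b}"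
    by (intro set_integral_add integrable_on_imp_Icc absolutely_integrable_continuous_real) auto
  then have *: "(\<lambda>x. 1 + (f x)\<^sup>2) absolutely_integrable_on {0<..<b}"
    by (simp add: absolutely_integrable_on_Icc_iff_Ioo)
  have m: "(\<lambda>x. indicator {0<..} x *\<^sub>R f x) \<in> borel_measurable lebesgue"
    using f by (simp add: square_integrable_def borel_measurable_restrict_space_iff)
  have "f absolutely_integrable_on {0<..<b}"
  proof (rule set_integrable_bound[OF *])
    have "(\<lambda>x. indicator {0<..<b} x *\<^sub>R (indicator {0<..} x *\<^sub>R f x)) \<in> borel_measurable lebesgue"
      by (intro borel_measurable_scaleR borel_measurable_indicator m) auto
    moreover have "(\<lambda>x. indicator {0<..<b} x *\<^sub>R (indicator {0<..} x *\<^sub>R f x)) = (\<lambda>x. indicator {0<..<b} x *\<^sub>R f x)"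
      by (auto simp: indicator_def)
    ultimately show "set_borel_measurable lebesgue {0<..<b} f" by (simp add: set_borel_measurable_def)
    have "\<bar>f x\<bar> \<le> 1 + (f x)\<^sup>2" for x
      using zero_le_power2[of "\<bar>f x\<bar> - 1"] by (simp add: power2_diff)
    then show "AE x in lebesgue. x \<in> {0<..<b} \<longrightarrow> norm (f x) \<le> norm (1 + (f x)\<^sup>2)" by simp
  qed
  then show ?thesis by (simp add: absolutely_integrable_on_Icc_iff_Ioo)
qed

text \<open>Connects the Lebesgue integral in which the inner product is written with the gauge
  integral in which primitives and the product rule are written.\<close>

lemma LINT_halfline_cutoff:
  fixes f :: "real \<Rightarrow> real"
  assumes f: "integrable halfline f" and 0: "\<And>x. b < x \<Longrightarrow> f x = 0"
  shows "(LINT x|halfline. f x) = integral {0..b} f"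
proof -
  have "(LINT x|halfline. f x) = integral {0<..} f"
    using f by (intro lebesgue_integral_eq_integral) auto
  also have "\<dots> = integral {0..b} f"
  proof (rule integral_spike_set)
    show "negligible {x \<in> {0<..} - {0..b}. f x \<noteq> 0}"
      by (rule negligible_subset[of "{}"]) (use 0 in \<open>auto simp: not_le\<close>)
    show "negligible {x \<in> {0..b} - {0<..}. f x \<noteq> 0}"
      by (rule negligible_subset[of "{0}"]) auto
  qed
  finally show ?thesis .
qed

lemma LINT_halfline_tendsto:
  fixes f :: "real \<Rightarrow> real"
  assumes f: "integrable halfline f"
  shows "(\<lambda>n. integral {0..real n} f) \<longlonglongrightarrow> (LINT x|halfline. f x)"
proof -
  have "(\<lambda>n. LINT x|halfline. indicator {..real n} x * f x) \<longlonglongrightarrow> (LINT x|halfline. f x)"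
  proof (rule integral_dominated_convergence[where w = "\<lambda>x. norm (f x)"])
    show "AE x in halfline. (\<lambda>n. indicator {..real n} x * f x) \<longlonglongrightarrow> f x"
    proof (rule AE_I2, rule tendsto_eventually)
      fix x :: real
      obtain N where "x \<le> real N" using real_arch_simple by blast
      then show "\<forall>\<^sub>F n in sequentially. indicator {..real n} x * f x = f x"
        unfolding eventually_sequentially by (intro exI[of _ N]) auto
    qed
    show "(\<lambda>x. indicator {..real n} x * f x) \<in> borel_measurable halfline" for n
      using f by (intro borel_measurable_times borel_measurable_indicator')
        (auto simp: sets_restrict_space_iff)
  qed (use f in \<open>auto simp: indicator_def\<close>)
  moreover have "(LINT x|halfline. indicator {..real n} x * f x) = integral {0..real n} f" for n
  proof -
    have "integrable halfline (\<lambda>x. indicator {..real n} x * f x)"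
    proof (rule Bochner_Integration.integrable_bound[OF f])
      show "(\<lambda>x. indicator {..real n} x * f x) \<in> borel_measurable halfline"
        using f by (intro borel_measurable_times borel_measurable_indicator')
          (auto simp: sets_restrict_space_iff)
    qed (auto simp: indicator_def)
    then have "(LINT x|halfline. indicator {..real n} x * f x) = integral {0..real n} (\<lambda>x. indicator {..real n} x * f x)"
      by (rule LINT_halfline_cutoff) auto
    also have "\<dots> = integral {0..real n} f" by (rule integral_cong) auto
    finally show ?thesis .
  qed
  ultimately show ?thesis by simp
qed

text \<open>Over N equal pieces shorter than \<delta> the right-hand sides telescope to \<epsilon>
  (\<mu> b - \<mu> a), and \<epsilon> tends to 0. This shows constancy without pointwise
  derivatives, as needed for primitives of merely integrable functions.\<close>

lemma eq_if_small_increments: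
  fixes D \<mu> :: "real \<Rightarrow> real"
  assumes small: "\<And>\<epsilon>. \<epsilon> > 0 \<Longrightarrow> \<exists>\<delta>>0. \<forall>x y. a \<le> x \<and> x \<le> y \<and> y \<le> b \<and> y - x < \<delta> \<longrightarrow> \<bar>D y - D x\<bar> \<le> \<epsilon> * (\<mu> y - \<mu> x)"
    and ab: "a \<le> b"
  shows "D b = D a"
proof -
  have "\<bar>D b - D a\<bar> \<le> \<epsilon> * (\<mu> b - \<mu> a)" if "\<epsilon> > 0" for \<epsilon>
  proof -
    obtain \<delta> where "\<delta> > 0" and \<delta>: "\<And>x y. a \<le> x \<Longrightarrow> x \<le> y \<Longrightarrow> y \<le> b \<Longrightarrow> y - x < \<delta> \<Longrightarrow> \<bar>D y - D x\<bar> \<le> \<epsilon> * (\<mu> y - \<mu> x)"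
      using small[OF \<open>\<epsilon> > 0\<close>] by blast
    obtain N where N: "(b - a) / \<delta> < real N" using reals_Archimedean2 by blast
    have "0 \<le> (b - a) / \<delta>" using ab \<open>\<delta> > 0\<close> by simp
    with N have N0: "0 < real N" by linarith
    define p where "p i = a + (b - a) * (real i / real N)" for i
    have "\<bar>D (p i) - D a\<bar> \<le> \<epsilon> * (\<mu> (p i) - \<mu> a)" if "i \<le> N" for i
      using that
    proof (induction i)
      case (Suc i)
      have step: "p (Suc i) - p i = (b - a) / real N" by (simp add: p_def add_divide_distrib distrib_left)
      have "p (Suc i) - p i < \<delta>" using N N0 \<open>\<delta> > 0\<close> unfolding step by (simp add: field_simps)
      moreover have "p i \<le> p (Suc i)" using step ab N0 by (smt (verit) divide_nonneg_pos)
      moreover have "a \<le> p i" using ab by (simp add: p_def)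
      moreover have "p (Suc i) \<le> b"
      proof -
        have "(b - a) * (real (Suc i) / real N) \<le> (b - a) * 1"
          using Suc.prems N0 ab by (intro mult_left_mono) auto
        then show ?thesis by (simp add: p_def)
      qed
      ultimately have "\<bar>D (p (Suc i)) - D (p i)\<bar> \<le> \<epsilon> * (\<mu> (p (Suc i)) - \<mu> (p i))" by (intro \<delta>)
      then show ?case using Suc by (simp add: algebra_simps)
    qed (simp add: p_def)
    from this[of N] show ?thesis using N0 by (simp add: p_def)
  qed
  note * = this
  have "((\<lambda>\<epsilon>. \<epsilon> * (\<mu> b - \<mu> a)) \<longlongrightarrow> 0 * (\<mu> b - \<mu> a)) (at_right 0)" by (intro tendsto_intros)
  then have "\<bar>D b - D a\<bar> \<le> 0 * (\<mu> b - \<mu> a)"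
    by (rule tendsto_lowerbound) (auto simp: eventually_at_right_field * intro!: exI[of _ 1])
  then show ?thesis by simp
qed

lemma integral_Icc_diff:
  fixes f :: "real \<Rightarrow> real"
  assumes "f integrable_on {a..b}" "a \<le> x" "x \<le> y" "y \<le> b"
  shows "integral {a..y} f - integral {a..x} f = integral {x..y} f"
proof -
  have "f integrable_on {a..y}" by (rule integrable_on_subinterval[OF assms(1)]) (use assms in auto)
  from Henstock_Kurzweil_Integration.integral_combine[OF assms(2,3) this] show ?thesis by simp
qed

lemma absolutely_integrable_continuous_mult:
  fixes f g :: "real \<Rightarrow> real"
  assumes "continuous_on {a..b} f" "g absolutely_integrable_on {a..b}"
  shows "(\<lambda>x. f x * g x) absolutely_integrable_on {a..b}"
  using assms
  by (intro absolutely_integrable_bounded_measurable_product_real continuous_imp_measurable_on_sets_lebesgue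
      compact_imp_bounded compact_continuous_image) auto

text \<open>On a short interval the product of the primitives \<open>P\<close>, \<open>Q\<close> satisfies
  $P(y)Q(y)-P(x)Q(x)=Q(y)\int_x^y p+P(x)\int_x^y q$, where the frozen factors oscillate little.\<close>

lemma integral_product_rule:
  fixes p q P Q :: "real \<Rightarrow> real"
  assumes p: "p absolutely_integrable_on {a..b}" and q: "q absolutely_integrable_on {a..b}"
    and P: "\<And>x. x \<in> {a..b} \<Longrightarrow> P x = P a + integral {a..x} p"
    and Q: "\<And>x. x \<in> {a..b} \<Longrightarrow> Q x = Q a + integral {a..x} q" and ab: "a \<le> b"
  shows "P b * Q b = P a * Q a + integral {a..b} (\<lambda>x. Q x * p x + P x * q x)"
    and "(\<lambda>x. Q x * p x + P x * q x) absolutely_integrable_on {a..b}"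
proof -
  have pi: "p integrable_on {a..b}" and qi: "q integrable_on {a..b}"
    using p q set_lebesgue_integral_eq_integral by blast+
  have api: "(\<lambda>x. \<bar>p x\<bar>) integrable_on {a..b}" and aqi: "(\<lambda>x. \<bar>q x\<bar>) integrable_on {a..b}"
    using p q by (auto simp: absolutely_integrable_on_def)
  have cP: "continuous_on {a..b} P"
    by (rule continuous_on_eq[OF _ P[symmetric]]) (intro continuous_intros indefinite_integral_continuous_1 pi)
  have cQ: "continuous_on {a..b} Q"
    by (rule continuous_on_eq[OF _ Q[symmetric]]) (intro continuous_intros indefinite_integral_continuous_1 qi)
  show ai: "(\<lambda>x. Q x * p x + P x * q x) absolutely_integrable_on {a..b}"
    by (intro set_integral_add absolutely_integrable_continuous_mult cP cQ p q)
  then have i: "(\<lambda>x. Q x * p x + P x * q x) integrable_on {a..b}"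
    using set_lebesgue_integral_eq_integral by blast
  \<comment> \<open>D is the defect of the product rule, to be shown constant; \<mu>, the primitive
    of |p| + |q|, is the control function for its increments.\<close>
  define D where "D x = P x * Q x - integral {a..x} (\<lambda>x. Q x * p x + P x * q x)" for x
  define \<mu> where "\<mu> x = integral {a..x} (\<lambda>x. \<bar>p x\<bar> + \<bar>q x\<bar>)" for x
  have mi: "(\<lambda>x. \<bar>p x\<bar> + \<bar>q x\<bar>) integrable_on {a..b}" using api aqi by (rule integrable_add)
  have "D b = D a"
  proof (rule eq_if_small_increments[OF _ ab])
    fix \<epsilon> :: real assume \<epsilon>: "\<epsilon> > 0"
    have "uniformly_continuous_on {a..b} P" "uniformly_continuous_on {a..b} Q"
      using cP cQ by (auto intro: compact_uniformly_continuous)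
    then obtain d1 d2 where d1: "d1 > 0" "\<And>x y. x \<in> {a..b} \<Longrightarrow> y \<in> {a..b} \<Longrightarrow> dist y x < d1 \<Longrightarrow> dist (P y) (P x) < \<epsilon>"
      and d2: "d2 > 0" "\<And>x y. x \<in> {a..b} \<Longrightarrow> y \<in> {a..b} \<Longrightarrow> dist y x < d2 \<Longrightarrow> dist (Q y) (Q x) < \<epsilon>"
      unfolding uniformly_continuous_on_def using \<epsilon> by metis
    show "\<exists>\<delta>>0. \<forall>x y. a \<le> x \<and> x \<le> y \<and> y \<le> b \<and> y - x < \<delta> \<longrightarrow> \<bar>D y - D x\<bar> \<le> \<epsilon> * (\<mu> y - \<mu> x)"
    proof (intro exI[of _ "min d1 d2"] conjI allI impI)
      fix x y assume xy: "a \<le> x \<and> x \<le> y \<and> y \<le> b \<and> y - x < min d1 d2"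
      note sub = integral_Icc_diff[OF _ _ _ _, of _ a b x y]
      have on: "f integrable_on {x..y}" if "f integrable_on {a..b}" for f :: "real \<Rightarrow> real"
        by (rule integrable_on_subinterval[OF that]) (use xy in auto)
      have "D y - D x = Q y * (P y - P x) + P x * (Q y - Q x) - integral {x..y} (\<lambda>x. Q x * p x + P x * q x)"
        using sub[OF i] xy by (simp add: D_def algebra_simps)
      also have "P y - P x = integral {x..y} p" using sub[OF pi] P[of x] P[of y] xy by simp
      also have "Q y - Q x = integral {x..y} q" using sub[OF qi] Q[of x] Q[of y] xy by simp
      also have "Q y * integral {x..y} p + P x * integral {x..y} q - integral {x..y} (\<lambda>x. Q x * p x + P x * q x)
          = integral {x..y} (\<lambda>t. (Q y * p t + P x * q t) - (Q t * p t + P t * q t))"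
        by (subst integral_diff) (auto simp: integral_add on pi qi i integrable_on_mult_right integrable_add)
      finally have "\<bar>D y - D x\<bar> = norm (integral {x..y} (\<lambda>t. (Q y * p t + P x * q t) - (Q t * p t + P t * q t)))" by simp
      also have "\<dots> \<le> integral {x..y} (\<lambda>t. \<epsilon> * (\<bar>p t\<bar> + \<bar>q t\<bar>))"
      proof (rule Henstock_Kurzweil_Integration.integral_norm_bound_integral)
        show "(\<lambda>t. Q y * p t + P x * q t - (Q t * p t + P t * q t)) integrable_on {x..y}"
          by (intro integrable_diff integrable_add integrable_on_mult_right on pi qi i)
        show "(\<lambda>t. \<epsilon> * (\<bar>p t\<bar> + \<bar>q t\<bar>)) integrable_on {x..y}"
          by (intro integrable_on_mult_right on mi)
        fix t assume t: "t \<in> {x..y}"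
        have "\<bar>Q y - Q t\<bar> \<le> \<epsilon>" "\<bar>P x - P t\<bar> \<le> \<epsilon>"
          using d1(2)[of t x] d2(2)[of t y] t xy by (auto simp: dist_real_def)
        then have "\<bar>Q y - Q t\<bar> * \<bar>p t\<bar> + \<bar>P x - P t\<bar> * \<bar>q t\<bar> \<le> \<epsilon> * \<bar>p t\<bar> + \<epsilon> * \<bar>q t\<bar>"
          by (intro add_mono mult_right_mono) auto
        moreover have "Q y * p t + P x * q t - (Q t * p t + P t * q t) = (Q y - Q t) * p t + (P x - P t) * q t"
          by (simp add: algebra_simps)
        ultimately show "norm (Q y * p t + P x * q t - (Q t * p t + P t * q t)) \<le> \<epsilon> * (\<bar>p t\<bar> + \<bar>q t\<bar>)"
          using abs_triangle_ineq[of "(Q y - Q t) * p t" "(P x - P t) * q t"] by (simp add: abs_mult distrib_left)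
      qed
      also have "\<dots> = \<epsilon> * (\<mu> y - \<mu> x)" using sub[OF mi] xy by (simp add: \<mu>_def)
      finally show "\<bar>D y - D x\<bar> \<le> \<epsilon> * (\<mu> y - \<mu> x)" .
    qed (use d1 d2 in simp)
  qed
  then show "P b * Q b = P a * Q a + integral {a..b} (\<lambda>x. Q x * p x + P x * q x)"
    by (simp add: D_def)
qed

text \<open>At almost every point the averages over short intervals to the right converge to the
  value of the function (Lebesgue differentiation), and here all averages equal a. Extension by 0 to
  the negative axis makes the function integrable on every bounded interval.\<close>

lemma AE_eq_if_interval_integrals:
  fixes k :: "real \<Rightarrow> real"
  assumes k: "\<And>b. k absolutely_integrable_on {0..b}"
    and I: "\<And>x h. 0 < x \<Longrightarrow> 0 < h \<Longrightarrow> integral {x..x + h} k = h * a"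
  shows "AE x in halfline. k x = a"
proof -
  define k' where "k' x = (if x \<in> {0<..} then k x else 0)" for x
  have "k' integrable_on cbox \<alpha> \<beta>" for \<alpha> \<beta>
  proof -
    have "k absolutely_integrable_on ({0<..} \<inter> {\<alpha>..\<beta>})"
      by (rule set_integrable_subset[OF k[of \<beta>]]) auto
    then have "k integrable_on ({0<..} \<inter> {\<alpha>..\<beta>})"
      by (rule set_lebesgue_integral_eq_integral)
    then show ?thesis unfolding k'_def[abs_def] integrable_restrict_Int box_real .
  qed
  from integrable_ccontinuous_explicit[OF this] obtain N where N: "negligible N"
    "\<And>x e. x \<notin> N \<Longrightarrow> 0 < e \<Longrightarrow> \<exists>d>0. \<forall>h. 0 < h \<and> h < d \<longrightarrow>
        norm (integral (cbox x (x + h *\<^sub>R One)) k' /\<^sub>R h ^ DIM(real) - k' x) < e" by metis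
  have "k x = a" if x: "x \<notin> N" "0 < x" for x
  proof (rule ccontr)
    assume "k x \<noteq> a"
    then have "\<bar>a - k x\<bar> > 0" by simp
    from N(2)[OF x(1) this] obtain d where d: "d > 0"
      "\<And>h. 0 < h \<Longrightarrow> h < d \<Longrightarrow> norm (integral (cbox x (x + h *\<^sub>R One)) k' /\<^sub>R h ^ DIM(real) - k' x) < \<bar>a - k x\<bar>" by blast
    define h where "h = d / 2"
    have h: "0 < h" "h < d" using d by (auto simp: h_def)
    have "integral {x..x + h} k' = integral {x..x + h} k"
      by (rule integral_cong) (use x in \<open>auto simp: k'_def\<close>)
    also have "\<dots> = h * a" by (rule I[OF x(2) h(1)])
    finally have "integral {x..x + h} k' /\<^sub>R h = a" using h by (simp add: divide_simps)
    then show False using d(2)[OF h] x by (simp add: k'_def)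
  qed
  then have sub: "x \<notin> N \<longrightarrow> x \<in> {0<..} \<longrightarrow> k x = a" for x by auto
  have "AE x in lebesgue. x \<notin> N"
    using N(1) by (intro AE_not_in) (simp add: negligible_iff_null_sets)
  then have "AE x in lebesgue. x \<in> {0<..} \<longrightarrow> k x = a"
    by (rule AE_mp) (use sub in auto)
  then show ?thesis by (simp add: AE_restrict_space_iff)
qed

section \<open>Test functions and weak derivatives\<close>

lemma square_integrable_compact_support:
  assumes c: "continuous_on {0..b} \<psi>" and 0: "\<And>x. b < x \<Longrightarrow> \<psi> x = 0"
    and m: "\<psi> \<in> borel_measurable halfline"
  shows "square_integrable \<psi>"
proof -
  have "(\<lambda>x. (\<psi> x)\<^sup>2) absolutely_integrable_on {0..b}"
    by (intro absolutely_integrable_continuous_real continuous_intros c)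
  then have "(\<lambda>x. (\<psi> x)\<^sup>2) absolutely_integrable_on {0<..b}"
    by (rule set_integrable_subset) auto
  also have "?this \<longleftrightarrow> (\<lambda>x. (\<psi> x)\<^sup>2) absolutely_integrable_on {0<..}"
    by (rule absolutely_integrable_spike_set_eq) (use 0 in \<open>auto intro!: negligible_subset[of "{}"] simp: not_le\<close>)
  finally show ?thesis using m by (simp add: square_integrable_def halfline_integrable_iff)
qed

lemma C1_test_functionD:
  assumes "C1_test_function \<phi> \<phi>'"
  shows "\<exists>b>0. (\<forall>x\<le>0. \<phi> x = 0) \<and> (\<forall>x\<ge>b. \<phi> x = 0 \<and> \<phi>' x = 0)"
    and "0 \<le> x \<Longrightarrow> \<phi> x = \<phi> 0 + integral {0..x} \<phi>'"
    and "continuous_on UNIV \<phi>" "continuous_on UNIV \<phi>'"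
    and "square_integrable \<phi>" "square_integrable \<phi>'"
proof -
  have d: "\<And>x. (\<phi> has_real_derivative \<phi>' x) (at x)" and c': "continuous_on UNIV \<phi>'"
    using assms by (auto simp: C1_test_function_def)
  obtain a b0 where ab: "a > 0" "\<And>x. x \<notin> {a..b0} \<Longrightarrow> \<phi> x = 0"
    using assms by (auto simp: C1_test_function_def)
  \<comment> \<open>Strictly beyond the support, so that \<phi> vanishes in a neighbourhood of every
    x \<ge> b and \<phi>' vanishes there as well.\<close>
  define b where "b = max 0 b0 + 1"
  have c: "continuous_on UNIV \<phi>" using d by (meson DERIV_isCont continuous_at_imp_continuous_on)
  have 0: "\<phi> x = 0" if "b \<le> x" for x using that by (intro ab(2)) (auto simp: b_def)
  have deriv0: "\<phi>' x = 0" if x: "b \<le> x" for x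
  proof -
    have "(\<phi> has_real_derivative 0) (at x)"
      by (rule has_field_derivative_transform_within_open[of "\<lambda>x. 0" _ _ "{b0<..}"])
        (use ab x in \<open>auto simp: b_def\<close>)
    then show ?thesis using DERIV_unique[OF d] by blast
  qed
  have ftc: "\<phi> x = \<phi> 0 + integral {0..x} \<phi>'" if "0 \<le> x" for x
  proof -
    have "(\<phi>' has_integral (\<phi> x - \<phi> 0)) {0..x}"
      by (rule fundamental_theorem_of_calculus[OF that])
        (use d in \<open>auto simp: has_real_derivative_iff_has_vector_derivative[symmetric] intro: has_field_derivative_at_within\<close>)
    then show ?thesis by (simp add: integral_unique)
  qed
  have m: "\<psi> \<in> borel_measurable halfline" if "continuous_on UNIV \<psi>" for \<psi> :: "real \<Rightarrow> real"
    by (rule continuous_imp_measurable_on_sets_lebesgue) (use that continuous_on_subset in auto)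
  have si: "square_integrable \<psi>" if "continuous_on UNIV \<psi>" "\<And>x. b \<le> x \<Longrightarrow> \<psi> x = 0" for \<psi>
    by (rule square_integrable_compact_support[of b]) (use that m continuous_on_subset[OF that(1), of "{0..b}"] in auto)
  have "0 < b" by (simp add: b_def)
  moreover have "\<phi> x = 0" if "x \<le> 0" for x using that ab(1) by (intro ab(2)) auto
  ultimately show "\<exists>b>0. (\<forall>x\<le>0. \<phi> x = 0) \<and> (\<forall>x\<ge>b. \<phi> x = 0 \<and> \<phi>' x = 0)"
    using 0 deriv0 by blast
  show "\<phi> x = \<phi> 0 + integral {0..x} \<phi>'" if "0 \<le> x" by (rule ftc[OF that])
  show "square_integrable \<phi>" by (rule si[OF c]) (rule 0)
  show "square_integrable \<phi>'" by (rule si[OF c']) (rule deriv0)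
qed (use assms in \<open>auto simp: C1_test_function_def intro: DERIV_isCont continuous_at_imp_continuous_on\<close>)

text \<open>The product rule on [0,b] for f and a test function: both boundary terms vanish because
  the support is a compact subset of the open half-line.\<close>

lemma weak_derivative_of_primitive:
  assumes f: "square_integrable f" and g: "square_integrable g"
    and fg: "\<And>x. 0 \<le> x \<Longrightarrow> f x = f 0 + integral {0..x} g"
  shows "weak_derivative (l2_class f) (l2_class g)"
  unfolding weak_derivative_def
proof (intro allI impI)
  fix \<phi> \<phi>' assume t: "C1_test_function \<phi> \<phi>'"
  obtain b where b: "0 < b" "\<forall>x\<le>0. \<phi> x = 0" "\<forall>x\<ge>b. \<phi> x = 0 \<and> \<phi>' x = 0"
    using C1_test_functionD(1)[OF t] by blast
  note si = C1_test_functionD(5,6)[OF t]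
  have pr: "f b * \<phi> b = f 0 * \<phi> 0 + integral {0..b} (\<lambda>x. \<phi> x * g x + f x * \<phi>' x)"
    by (rule integral_product_rule(1))
      (use b(1) in \<open>auto intro!: square_integrable_imp_Icc g si fg C1_test_functionD(2)[OF t]\<close>)
  have i: "integrable halfline (\<lambda>x. f x * \<phi>' x)" "integrable halfline (\<lambda>x. g x * \<phi> x)"
    using f g si by (auto intro: square_integrable_mult)
  have "l2_class f \<bullet> l2_class \<phi>' + l2_class g \<bullet> l2_class \<phi> = (LINT x|halfline. f x * \<phi>' x + g x * \<phi> x)"
    using f g si i by (simp add: l2_class_inner)
  also have "\<dots> = integral {0..b} (\<lambda>x. f x * \<phi>' x + g x * \<phi> x)"
    by (rule LINT_halfline_cutoff) (use i b in auto)
  also have "\<dots> = 0" using pr b by (simp add: algebra_simps)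
  finally show "l2_class f \<bullet> l2_class \<phi>' = - (l2_class g \<bullet> l2_class \<phi>)" by simp
qed

text \<open>A continuous approximation of the indicator of (0,\<infinity>). Its primitive is of
  class C^1 and equals x - \<epsilon>/2 beyond \<epsilon>, so the offset cancels in differences of
  shifts, from which compactly supported test functions are built.\<close>

definition ramp :: "real \<Rightarrow> real \<Rightarrow> real" where
  "ramp \<epsilon> x = (max 0 x - max 0 (x - \<epsilon>)) / \<epsilon>"

definition ramp_primitive :: "real \<Rightarrow> real \<Rightarrow> real" where
  "ramp_primitive \<epsilon> x = ((max 0 x)\<^sup>2 - (max 0 (x - \<epsilon>))\<^sup>2) / (2 * \<epsilon>)"

lemma DERIV_max_square: "((\<lambda>x::real. (max 0 x)\<^sup>2) has_real_derivative 2 * max 0 x) (at x)"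
proof -
  consider "x < 0" | "x = 0" | "x > 0" by linarith
  then show ?thesis
  proof cases
    case 1
    have "((\<lambda>x::real. (max 0 x)\<^sup>2) has_real_derivative 0) (at x)"
      by (rule has_field_derivative_transform_within_open[of "\<lambda>x. 0" _ _ "{..<0}"]) (use 1 in auto)
    then show ?thesis using 1 by simp
  next
    case 2
    have "((\<lambda>h::real. \<bar>h\<bar>) \<longlongrightarrow> 0) (at 0)" by (intro tendsto_rabs_zero tendsto_ident_at)
    then have "((\<lambda>h::real. ((max 0 h)\<^sup>2 - (max 0 0)\<^sup>2) / h) \<longlongrightarrow> 0) (at 0)"
      by (rule Lim_null_comparison[rotated])
        (auto simp: power2_eq_square abs_mult eventually_at_filter max_def)
    then show ?thesis using 2 by (simp add: has_field_derivative_iff)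
  next
    case 3
    have "((\<lambda>x::real. (max 0 x)\<^sup>2) has_real_derivative (2 * x)) (at x)"
      by (rule has_field_derivative_transform_within_open[of "\<lambda>x. x\<^sup>2" _ _ "{0<..}"])
        (use 3 in \<open>auto intro!: derivative_eq_intros\<close>)
    then show ?thesis using 3 by simp
  qed
qed

lemma DERIV_ramp_primitive:
  assumes "\<epsilon> \<noteq> 0"
  shows "(ramp_primitive \<epsilon> has_real_derivative ramp \<epsilon> x) (at x)"
proof -
  have 1: "((\<lambda>x. (max 0 (x - \<epsilon>))\<^sup>2) has_real_derivative 2 * max 0 (x - \<epsilon>) * 1) (at x)"
    by (rule DERIV_chain2[OF DERIV_max_square]) (auto intro!: derivative_eq_intros)
  have "(ramp_primitive \<epsilon> has_real_derivative (2 * max 0 x - 2 * max 0 (x - \<epsilon>) * 1) / (2 * \<epsilon>)) (at x)"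
    unfolding ramp_primitive_def by (intro DERIV_cdivide DERIV_diff DERIV_max_square 1)
  then show ?thesis using assms by (simp add: ramp_def diff_divide_distrib)
qed

lemma DERIV_ramp_primitive_shift:
  assumes "\<epsilon> \<noteq> 0"
  shows "((\<lambda>x. ramp_primitive \<epsilon> (x - s)) has_real_derivative ramp \<epsilon> (x - s)) (at x)"
proof -
  have "((\<lambda>x. ramp_primitive \<epsilon> (x - s)) has_real_derivative ramp \<epsilon> (x - s) * 1) (at x)"
    by (rule DERIV_chain2[OF DERIV_ramp_primitive[OF assms]]) (auto intro!: derivative_eq_intros)
  then show ?thesis by simp
qed

lemma continuous_on_ramp: "continuous_on S (\<lambda>x. ramp \<epsilon> (x - s))"
  unfolding ramp_def divide_inverse by (intro continuous_intros)

lemma ramp_bounds: "0 < \<epsilon> \<Longrightarrow> 0 \<le> ramp \<epsilon> x \<and> ramp \<epsilon> x \<le> 1"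
  by (auto simp: ramp_def max_def field_simps)

lemma ramp_nonpos: "0 < \<epsilon> \<Longrightarrow> x \<le> 0 \<Longrightarrow> ramp \<epsilon> x = 0" "0 < \<epsilon> \<Longrightarrow> x \<le> 0 \<Longrightarrow> ramp_primitive \<epsilon> x = 0"
  by (auto simp: ramp_def ramp_primitive_def)

lemma ramp_ge: "0 < \<epsilon> \<Longrightarrow> \<epsilon> \<le> x \<Longrightarrow> ramp \<epsilon> x = 1" "0 < \<epsilon> \<Longrightarrow> \<epsilon> \<le> x \<Longrightarrow> ramp_primitive \<epsilon> x = x - \<epsilon> / 2"
  by (auto simp: ramp_def ramp_primitive_def power2_eq_square field_simps)

lemma ramp_tendsto: "(\<lambda>n. ramp (inverse (real (Suc n))) x) \<longlonglongrightarrow> (if 0 < x then 1 else 0)"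
proof (rule tendsto_eventually)
  show "\<forall>\<^sub>F n in sequentially. ramp (inverse (real (Suc n))) x = (if 0 < x then 1 else 0)"
  proof (cases "0 < x")
    case True
    have "\<forall>\<^sub>F n in sequentially. inverse (real (Suc n)) < x"
      using LIMSEQ_inverse_real_of_nat True by (rule order_tendstoD)
    then show ?thesis by eventually_elim (use True in \<open>simp add: ramp_ge\<close>)
  qed (simp add: ramp_nonpos)
qed

text \<open>The test function is $\psi_h(x-x_0)-h\,\psi_1(x-1)$, where $\psi_h$ rises smoothly from $0$ to $h$ with
  derivative close to the indicator of $(0,h)$; the total rises cancel.\<close>

lemma weak_derivative_imp_primitive:
  assumes f: "square_integrable f" and g: "square_integrable g"
    and w: "weak_derivative (l2_class f) (l2_class g)"
  shows "\<exists>a. AE x in halfline. f x = a + integral {0..x} g"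
proof -
  define G where "G x = integral {0..x} g" for x
  have gi: "g integrable_on {0..b}" for b
    using square_integrable_imp_Icc[OF g] by (rule set_lebesgue_integral_eq_integral)
  have cG: "continuous_on {0..b} G" for b unfolding G_def by (rule indefinite_integral_continuous_1[OF gi])
  define k where "k x = f x - G x" for x
  have k: "k absolutely_integrable_on {0..b}" for b
    unfolding k_def[abs_def]
    by (intro set_integral_diff square_integrable_imp_Icc f absolutely_integrable_continuous_real cG)
  \<comment> \<open>Subtracting the product rule for G from the defining identity for f shows that k
    = f - G has weak derivative zero.\<close>
  have test: "integral {0..b} (\<lambda>x. k x * \<phi>' x) = 0"
    if \<phi>: "C1_test_function \<phi> \<phi>'" and b: "0 < b" and 0: "\<And>x. b \<le> x \<Longrightarrow> \<phi> x = 0" "\<And>x. b \<le> x \<Longrightarrow> \<phi>' x = 0" for \<phi> \<phi>' b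
  proof -
    note si = C1_test_functionD(5,6)[OF \<phi>]
    have z: "\<phi> 0 = 0" using C1_test_functionD(1)[OF \<phi>] by auto
    have i: "integrable halfline (\<lambda>x. f x * \<phi>' x)" "integrable halfline (\<lambda>x. g x * \<phi> x)"
      using f g si by (auto intro: square_integrable_mult)
    have fi: "(\<lambda>x. f x * \<phi>' x) integrable_on {0..b}" and gi': "(\<lambda>x. g x * \<phi> x) integrable_on {0..b}"
      using i by (auto simp: halfline_integrable_iff intro: set_lebesgue_integral_eq_integral(1)[OF integrable_on_imp_Icc])
    have Gi: "(\<lambda>x. G x * \<phi>' x) integrable_on {0..b}"
      by (intro integrable_continuous_interval continuous_intros cG continuous_on_subset[OF C1_test_functionD(4)[OF \<phi>]]) simp
    have *: "G b * \<phi> b = G 0 * \<phi> 0 + integral {0..b} (\<lambda>x. \<phi> x * g x + G x * \<phi>' x)"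
      by (rule integral_product_rule(1)) (use b in \<open>auto intro!: square_integrable_imp_Icc g si C1_test_functionD(2)[OF \<phi>] simp: G_def\<close>)
    have "integral {0..b} (\<lambda>x. g x * \<phi> x) + integral {0..b} (\<lambda>x. G x * \<phi>' x) = 0"
    proof -
      have "integral {0..b} (\<lambda>x. g x * \<phi> x) + integral {0..b} (\<lambda>x. G x * \<phi>' x)
          = integral {0..b} (\<lambda>x. \<phi> x * g x + G x * \<phi>' x)"
        unfolding integral_add[OF gi' Gi, symmetric] by (rule integral_cong) simp
      then show ?thesis using * 0(1)[of b] z by simp
    qed
    moreover have "integral {0..b} (\<lambda>x. f x * \<phi>' x) = l2_class f \<bullet> l2_class \<phi>'"
      using f si 0 by (simp add: l2_class_inner LINT_halfline_cutoff[OF i(1), of b])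
    moreover have "integral {0..b} (\<lambda>x. g x * \<phi> x) = l2_class g \<bullet> l2_class \<phi>"
      using g si 0 by (simp add: l2_class_inner LINT_halfline_cutoff[OF i(2), of b])
    moreover have "l2_class f \<bullet> l2_class \<phi>' = - (l2_class g \<bullet> l2_class \<phi>)"
      using w \<phi> unfolding weak_derivative_def by blast
    ultimately have "integral {0..b} (\<lambda>x. f x * \<phi>' x) - integral {0..b} (\<lambda>x. G x * \<phi>' x) = 0" by simp
    then show ?thesis by (simp add: k_def left_diff_distrib integral_diff[OF fi Gi])
  qed
  have ki: "k integrable_on {x..y}" if "0 \<le> x" for x y
    by (rule integrable_on_subinterval[OF set_lebesgue_integral_eq_integral(1)[OF k[of y]]]) (use that in auto)
  \<comment> \<open>All interval averages of k agree with the average over the reference interval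
    (1,2), which becomes the constant.\<close>
  have "integral {s..s + h} k = h * integral {1..2} k" if s: "0 < s" and h: "0 < h" for s h
  proof -
    define b where "b = max (s + h) 2 + 1"
    define \<epsilon> where "\<epsilon> n = inverse (real (Suc n))" for n
    have \<epsilon>: "0 < \<epsilon> n" "\<epsilon> n \<le> 1" for n by (auto simp: \<epsilon>_def field_simps)
    define \<phi> where "\<phi> n x = (ramp_primitive (\<epsilon> n) (x - s) - ramp_primitive (\<epsilon> n) (x - (s + h)))
      - h * (ramp_primitive (\<epsilon> n) (x - 1) - ramp_primitive (\<epsilon> n) (x - 2))" for n x
    define \<phi>' where "\<phi>' n x = (ramp (\<epsilon> n) (x - s) - ramp (\<epsilon> n) (x - (s + h)))
      - h * (ramp (\<epsilon> n) (x - 1) - ramp (\<epsilon> n) (x - 2))" for n x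
    define step where "step x = ((if s < x then 1 else 0) - (if s + h < x then 1 else 0))
      - h * ((if 1 < x then 1 else 0) - (if 2 < x then 1 else 0))" for x :: real
    have c: "continuous_on S (\<phi>' n)" for n S
      unfolding \<phi>'_def by (intro continuous_intros continuous_on_ramp)
    have 0: "\<phi> n x = 0" "\<phi>' n x = 0" if "b \<le> x" for n x
    proof -
      have *: "\<epsilon> n \<le> x - s" "\<epsilon> n \<le> x - (s + h)" "\<epsilon> n \<le> x - 1" "\<epsilon> n \<le> x - 2"
        using that \<epsilon>(2)[of n] h by (auto simp: b_def)
      show "\<phi> n x = 0" "\<phi>' n x = 0" unfolding \<phi>_def \<phi>'_def
        using * \<epsilon>(1)[of n] by (simp_all add: ramp_ge algebra_simps)
    qed
    have "C1_test_function (\<phi> n) (\<phi>' n)" for n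
      unfolding C1_test_function_def
    proof (intro conjI allI)
      show "(\<phi> n has_real_derivative \<phi>' n x) (at x)" for x
        unfolding \<phi>_def \<phi>'_def
        by (intro DERIV_diff DERIV_cmult DERIV_ramp_primitive_shift) (use \<epsilon>(1)[of n] in auto)
      show "continuous_on UNIV (\<phi>' n)" by (rule c)
      show "\<exists>a>0. \<exists>b. \<forall>x. x \<notin> {a..b} \<longrightarrow> \<phi> n x = 0"
      proof -
        have "\<phi> n x = 0" if "x \<notin> {min s 1..b}" for x
        proof -
          from that consider "x < min s 1" | "b \<le> x" by force
          then show "\<phi> n x = 0"
          proof cases
            case 1
            then show ?thesis using \<epsilon>(1)[of n] h by (simp add: \<phi>_def ramp_nonpos)
          qed (rule 0)
        qed
        moreover have "min s 1 > 0" using s by simp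
        ultimately show ?thesis by blast
      qed
    qed
    then have "integral {0..b} (\<lambda>x. k x * \<phi>' n x) = 0" for n
      by (rule test) (use 0 s h in \<open>auto simp: b_def\<close>)
    \<comment> \<open>Dominated convergence replaces the ramps by jumps: the limit
      \<open>step\<close> is the indicator of (s, s + h] minus h times that of (1, 2], and each
      difference of ramps is at most 1, hence the bound 1 + h.\<close>
    moreover have "(\<lambda>n. integral {0..b} (\<lambda>x. k x * \<phi>' n x)) \<longlonglongrightarrow> integral {0..b} (\<lambda>x. k x * step x)"
    proof (rule dominated_convergence(2)[where h = "\<lambda>x. \<bar>k x\<bar> * (1 + h)"])
      show "(\<lambda>x. k x * \<phi>' n x) integrable_on {0..b}" for n
      proof -
        have "(\<lambda>x. \<phi>' n x * k x) absolutely_integrable_on {0..b}"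
          by (rule absolutely_integrable_continuous_mult[OF c k])
        then show ?thesis
          by (subst mult.commute) (rule set_lebesgue_integral_eq_integral)
      qed
      show "(\<lambda>x. \<bar>k x\<bar> * (1 + h)) integrable_on {0..b}"
        using k[of b] by (intro integrable_on_mult_left) (auto simp: absolutely_integrable_on_def)
      show "norm (k x * \<phi>' n x) \<le> \<bar>k x\<bar> * (1 + h)" for n x
      proof -
        have r: "0 \<le> ramp (\<epsilon> n) y" "ramp (\<epsilon> n) y \<le> 1" for y using ramp_bounds[OF \<epsilon>(1)] by auto
        have "\<bar>ramp (\<epsilon> n) (x - s) - ramp (\<epsilon> n) (x - (s + h))\<bar> \<le> 1"
          using r[of "x - s"] r[of "x - (s + h)"] by linarith
        moreover have "\<bar>ramp (\<epsilon> n) (x - 1) - ramp (\<epsilon> n) (x - 2)\<bar> \<le> 1"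
          using r[of "x - 1"] r[of "x - 2"] by linarith
        then have "\<bar>h * (ramp (\<epsilon> n) (x - 1) - ramp (\<epsilon> n) (x - 2))\<bar> \<le> h * 1"
          unfolding abs_mult using h by (intro mult_mono) auto
        ultimately have "\<bar>\<phi>' n x\<bar> \<le> 1 + h" unfolding \<phi>'_def by linarith
        then show ?thesis by (simp add: abs_mult mult_left_mono)
      qed
      show "(\<lambda>n. k x * \<phi>' n x) \<longlonglongrightarrow> k x * step x" for x
        unfolding \<phi>'_def step_def \<epsilon>_def
        using ramp_tendsto[of "x - s"] ramp_tendsto[of "x - (s + h)"] ramp_tendsto[of "x - 1"] ramp_tendsto[of "x - 2"]
        by (intro tendsto_intros) simp_all
    qed
    ultimately have "integral {0..b} (\<lambda>x. k x * step x) = 0" by (simp add: LIMSEQ_const_iff)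
    moreover have "((\<lambda>x. k x * step x) has_integral (integral {s..s + h} k - h * integral {1..2} k)) {0..b}"
    proof -
      have piece: "((\<lambda>x. if x \<in> {\<alpha><..\<beta>} then k x else 0) has_integral integral {\<alpha>..\<beta>} k) {0..b}"
        if "0 \<le> \<alpha>" "\<beta> \<le> b" for \<alpha> \<beta>
      proof -
        have "(k has_integral integral {\<alpha>..\<beta>} k) {\<alpha>..\<beta>}" using ki that by blast
        then have "(k has_integral integral {\<alpha>..\<beta>} k) {\<alpha><..\<beta>}"
          by (rule has_integral_spike_set_eq[THEN iffD1, rotated 2]) (auto intro: negligible_subset[of "{\<alpha>}"])
        then show ?thesis by (subst has_integral_restrict) (use that in auto)
      qed
      have eq: "(\<lambda>x. k x * step x) = (\<lambda>x. (if x \<in> {s<..s + h} then k x else 0) - h * (if x \<in> {1<..2} then k x else 0))"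
        using h by (auto simp: step_def algebra_simps)
      show ?thesis unfolding eq
        by (intro has_integral_diff has_integral_mult_right piece) (use s h in \<open>auto simp: b_def\<close>)
    qed
    ultimately show ?thesis by (simp add: has_integral_iff)
  qed
  from AE_eq_if_interval_integrals[OF k this] have "AE x in halfline. k x = integral {1..2} k" by simp
  then have "AE x in halfline. f x = integral {1..2} k + integral {0..x} g"
    by eventually_elim (simp add: k_def G_def)
  then show ?thesis by (rule exI)
qed

section \<open>Traces and integration by parts in $H^1(0,\infty)$\<close>

text \<open>Demanding the primitive identity at every x \<ge> 0, not almost everywhere, selects the
  continuous representative including its endpoint value, so \<open>f 0\<close> is the trace. Values
  at negative arguments are irrelevant.\<close>

definition h1_rep :: "h1 \<Rightarrow> (real \<Rightarrow> real) \<Rightarrow> (real \<Rightarrow> real) \<Rightarrow> bool" where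
  "h1_rep u f g \<longleftrightarrow> square_integrable f \<and> square_integrable g \<and> h1_fun u = l2_class f \<and> h1_deriv u = l2_class g \<and>
     (\<forall>x\<ge>0. f x = f 0 + integral {0..x} g)"

lemma h1_repI:
  assumes "square_integrable f" "square_integrable g" "h1_fun u = l2_class f" "h1_deriv u = l2_class g"
    and "\<And>x. 0 \<le> x \<Longrightarrow> f x = f 0 + integral {0..x} g"
  shows "h1_rep u f g"
  unfolding h1_rep_def by (intro conjI allI impI assms)

lemma h1_repD: "h1_rep u f g \<Longrightarrow> 0 \<le> x \<Longrightarrow> f x = f 0 + integral {0..x} g"
  unfolding h1_rep_def by blast

lemma h1_rep_continuous_on:
  assumes "h1_rep u f g"
  shows "continuous_on {0..} f"
proof -
  have gi: "g integrable_on {0..b}" for b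
    using assms by (intro set_lebesgue_integral_eq_integral(1)[OF square_integrable_imp_Icc]) (simp add: h1_rep_def)
  have c: "continuous_on {0..b} f" for b
  proof (rule continuous_on_eq)
    show "continuous_on {0..b} (\<lambda>x. f 0 + integral {0..x} g)"
      by (intro continuous_intros indefinite_integral_continuous_1 gi)
    show "f 0 + integral {0..x} g = f x" if "x \<in> {0..b}" for x
      using assms that unfolding h1_rep_def by (metis atLeastAtMost_iff)
  qed
  show ?thesis
    unfolding continuous_on_eq_continuous_within
  proof
    fix x :: real assume x: "x \<in> {0..}"
    have "continuous (at x within {0..x + 1}) f"
      using c[of "x + 1"] x by (simp add: continuous_on_eq_continuous_within)
    moreover have "at x within {0..x + 1} = at x within {0..}"
      by (rule at_within_nhd[of x "{x - 1<..<x + 1}"]) (use x in auto)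
    ultimately show "continuous (at x within {0..}) f" by simp
  qed
qed

lemma h1_rep_ex: "\<exists>f g. h1_rep u f g"
proof -
  obtain f0 where f0: "square_integrable f0" "h1_fun u = l2_class f0" by (rule l2_cases)
  obtain g where g: "square_integrable g" "h1_deriv u = l2_class g" by (rule l2_cases)
  have "weak_derivative (l2_class f0) (l2_class g)" using weak_derivative_h1[of u] f0 g by simp
  then obtain a where a: "AE x in halfline. f0 x = a + integral {0..x} g"
    using weak_derivative_imp_primitive[OF f0(1) g(1)] by blast
  define f where "f x = a + integral {0..x} g" for x
  have f_eq: "f x = f 0 + integral {0..x} g" for x by (simp add: f_def)
  have gi: "g integrable_on {0..b}" for b
    by (rule set_lebesgue_integral_eq_integral(1)[OF square_integrable_imp_Icc[OF g(1)]])
  have "continuous (at x) f" if "x \<in> {0<..}" for x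
  proof -
    have "continuous_on {0..x + 1} f"
      unfolding f_def by (intro continuous_intros indefinite_integral_continuous_1 gi)
    then show ?thesis by (rule continuous_on_interior) (use that in simp)
  qed
  then have "continuous_on {0<..} f" by (rule continuous_at_imp_continuous_on[OF ballI])
  then have m: "f \<in> borel_measurable halfline" by (rule continuous_imp_measurable_on_sets_lebesgue) simp
  have m0: "f0 \<in> borel_measurable halfline" "integrable halfline (\<lambda>x. (f0 x)\<^sup>2)"
    using f0(1) by (auto simp: square_integrable_def)
  have ae: "AE x in halfline. f0 x = f x" using a by (simp add: f_def)
  have "integrable halfline (\<lambda>x. (f x)\<^sup>2)"
  proof (rule integrable_cong_AE_imp[OF m0(2)])
    show "(\<lambda>x. (f x)\<^sup>2) \<in> borel_measurable halfline" using m by simp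
    show "AE x in halfline. (f0 x)\<^sup>2 = (f x)\<^sup>2" using ae by eventually_elim simp
  qed
  with m have f: "square_integrable f" by (simp add: square_integrable_def)
  have fu: "h1_fun u = l2_class f" using l2_class_eq_iff[OF f0(1) f] ae f0(2) by simp
  have "h1_rep u f g" by (rule h1_repI[OF f g(1) fu g(2)]) (rule f_eq)
  then show ?thesis by blast
qed

text \<open>The set where the functions differ is open and null, hence empty.\<close>

lemma continuous_AE_eq:
  fixes f g :: "real \<Rightarrow> real"
  assumes f: "continuous_on {0<..} f" and g: "continuous_on {0<..} g"
    and eq: "AE x in halfline. f x = g x" and x: "0 < x"
  shows "f x = g x"
proof -
  have "continuous_on {0<..} (\<lambda>x. f x - g x)" by (intro continuous_intros f g)
  then have op: "open ({0<..} \<inter> (\<lambda>x. f x - g x) -` (- {0}))"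
    by (rule continuous_open_preimage) auto
  have "AE x in lebesgue. x \<in> {0<..} \<longrightarrow> f x = g x" using eq by (simp add: AE_restrict_space_iff)
  then have "AE x in lebesgue. x \<notin> ({0<..} \<inter> (\<lambda>x. f x - g x) -` (- {0}))" by eventually_elim auto
  then have "({0<..} \<inter> (\<lambda>x. f x - g x) -` (- {0})) \<in> null_sets lebesgue"
    by (rule AE_iff_null_sets[THEN iffD2, rotated]) (use op in \<open>auto intro: sets_completionI_sets\<close>)
  then have "negligible ({0<..} \<inter> (\<lambda>x. f x - g x) -` (- {0}))" by (simp add: negligible_iff_null_sets)
  then have "{0<..} \<inter> (\<lambda>x. f x - g x) -` (- {0}) = {}" using op open_not_negligible by blast
  then show ?thesis using x by auto
qed

text \<open>Resolves the definite description in \<open>trace0\<close>: any continuous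
  representative agrees with f on (0,\<infinity>) and therefore has the same limit at 0.\<close>

lemma trace0_rep:
  assumes u: "h1_rep u f g"
  shows "trace0 u = f 0"
  unfolding trace0_def
proof (rule the_equality)
  have c: "continuous_on {0..} f" by (rule h1_rep_continuous_on[OF u])
  have "(f \<longlongrightarrow> f 0) (at 0 within {0..})" by (rule bspec[OF c[unfolded continuous_on_def]]) simp
  then have lim: "(f \<longlongrightarrow> f 0) (at_right 0)" by (rule tendsto_within_subset) auto
  have c': "continuous_on {0<..} f" by (rule continuous_on_subset[OF c]) auto
  show "\<exists>f'. square_integrable f' \<and> l2_class f' = h1_fun u \<and> continuous_on {0<..} f' \<and> (f' \<longlongrightarrow> f 0) (at_right 0)"
    using u c' lim unfolding h1_rep_def by metis
  fix a assume "\<exists>f'. square_integrable f' \<and> l2_class f' = h1_fun u \<and> continuous_on {0<..} f' \<and> (f' \<longlongrightarrow> a) (at_right 0)"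
  then obtain f' where f': "square_integrable f'" "l2_class f' = h1_fun u" "continuous_on {0<..} f'" "(f' \<longlongrightarrow> a) (at_right 0)"
    by blast
  have "AE x in halfline. f' x = f x"
    using l2_class_eq_iff[OF f'(1), of f] f'(2) u by (simp add: h1_rep_def)
  from continuous_AE_eq[OF f'(3) c' this] have eq: "f' x = f x" if "0 < x" for x using that .
  have "(f \<longlongrightarrow> a) (at_right 0)"
    by (rule Lim_transform_eventually[OF f'(4) eventually_mono[OF eventually_at_right_less]]) (rule eq)
  then show "a = f 0" using lim by (rule tendsto_unique[OF trivial_limit_at_right_real])
qed

lemma h1_rep_add: "h1_rep u f g \<Longrightarrow> h1_rep v p q \<Longrightarrow> h1_rep (u + v) (\<lambda>x. f x + p x) (\<lambda>x. g x + q x)"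
proof -
  assume u: "h1_rep u f g" and v: "h1_rep v p q"
  have si: "square_integrable f" "square_integrable g" "square_integrable p" "square_integrable q"
    using u v by (auto simp: h1_rep_def)
  have i: "g integrable_on {0..x}" "q integrable_on {0..x}" for x
    using si by (auto intro: set_lebesgue_integral_eq_integral(1)[OF square_integrable_imp_Icc])
  show ?thesis
  proof (rule h1_repI)
    show "h1_fun (u + v) = l2_class (\<lambda>x. f x + p x)" "h1_deriv (u + v) = l2_class (\<lambda>x. g x + q x)"
      using u v si by (simp_all add: h1_rep_def h1_linear l2_class_add)
    fix x :: real assume "0 \<le> x"
    then have "f x = f 0 + integral {0..x} g" "p x = p 0 + integral {0..x} q"
      using u v unfolding h1_rep_def by blast+
    then show "f x + p x = (f 0 + p 0) + integral {0..x} (\<lambda>x. g x + q x)"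
      by (simp add: integral_add[OF i])
  qed (use si in \<open>auto intro: square_integrable_add\<close>)
qed

lemma h1_rep_scale: "h1_rep u f g \<Longrightarrow> h1_rep (r *\<^sub>R u) (\<lambda>x. r * f x) (\<lambda>x. r * g x)"
proof -
  assume u: "h1_rep u f g"
  have si: "square_integrable f" "square_integrable g" using u by (auto simp: h1_rep_def)
  show ?thesis
  proof (rule h1_repI)
    show "h1_fun (r *\<^sub>R u) = l2_class (\<lambda>x. r * f x)" "h1_deriv (r *\<^sub>R u) = l2_class (\<lambda>x. r * g x)"
      using u si by (simp_all add: h1_rep_def h1_linear l2_class_scale)
    fix x :: real assume "0 \<le> x"
    then have "f x = f 0 + integral {0..x} g" using u unfolding h1_rep_def by blast
    then show "r * f x = r * f 0 + integral {0..x} (\<lambda>x. r * g x)" by (simp add: distrib_left)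
  qed (use si in \<open>auto intro: square_integrable_scale\<close>)
qed

lemma trace0_add: "trace0 (u + v) = trace0 u + trace0 v"
proof -
  obtain f g p q where "h1_rep u f g" "h1_rep v p q" using h1_rep_ex by metis
  then show ?thesis using trace0_rep[OF h1_rep_add] by (simp add: trace0_rep)
qed

lemma trace0_scale: "trace0 (r *\<^sub>R u) = r * trace0 u"
proof -
  obtain f g where "h1_rep u f g" using h1_rep_ex by metis
  then show ?thesis using trace0_rep[OF h1_rep_scale] by (simp add: trace0_rep)
qed

lemma halfline_integrable_imp_Icc:
  fixes f :: "real \<Rightarrow> real"
  assumes "integrable halfline f"
  shows "f integrable_on {0..b}"
  by (rule set_lebesgue_integral_eq_integral(1)[OF integrable_on_imp_Icc])
    (use assms in \<open>simp add: halfline_integrable_iff\<close>)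

text \<open>The value P n differs from the integral of P over [n, n+1] by at most the integral of
  |h| over that window. Window integrals of integrable functions tend to 0, so P n does, while P n
  also tends to the left-hand side of the claim.\<close>

lemma integrable_primitive_tendsto_0:
  fixes P h :: "real \<Rightarrow> real"
  assumes P: "integrable halfline P" and h: "integrable halfline h"
    and eq: "\<And>x. 0 \<le> x \<Longrightarrow> P x = c + integral {0..x} h"
  shows "c + (LINT x|halfline. h x) = 0"
proof -
  have hi: "h absolutely_integrable_on {0..b}" and Pi: "P absolutely_integrable_on {0..b}" for b
    using P h by (auto simp: halfline_integrable_iff intro: integrable_on_imp_Icc)
  have ahi: "(\<lambda>x. \<bar>h x\<bar>) integrable_on {0..b}" and hi': "h integrable_on {0..b}" and Pi': "P integrable_on {0..b}" for b
    using hi Pi by (auto simp: absolutely_integrable_on_def)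
  have window: "(\<lambda>n. integral {real n..real n + 1} f) \<longlonglongrightarrow> 0" if "integrable halfline f" for f :: "real \<Rightarrow> real"
  proof -
    have fi: "f integrable_on {0..b}" for b
      using that by (rule halfline_integrable_imp_Icc)
    have "(\<lambda>n. integral {0..real (Suc n)} f - integral {0..real n} f) \<longlonglongrightarrow> 0"
      using tendsto_diff[OF LIMSEQ_Suc[OF LINT_halfline_tendsto[OF that]] LINT_halfline_tendsto[OF that]] by simp
    moreover have "integral {0..real (Suc n)} f - integral {0..real n} f = integral {real n..real n + 1} f" for n
      using integral_Icc_diff[OF fi, of "real n" "real n + 1" "real n + 1"] by (simp add: add.commute)
    ultimately show ?thesis by simp
  qed
  have "(\<lambda>n. P (real n)) \<longlonglongrightarrow> 0"
  proof (rule Lim_null_comparison)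
    show "(\<lambda>n. \<bar>integral {real n..real n + 1} P\<bar> + integral {real n..real n + 1} (\<lambda>x. \<bar>h x\<bar>)) \<longlonglongrightarrow> 0"
      using h by (intro tendsto_add_zero tendsto_rabs_zero window P) auto
    show "\<forall>\<^sub>F n in sequentially. norm (P (real n)) \<le> \<bar>integral {real n..real n + 1} P\<bar> + integral {real n..real n + 1} (\<lambda>x. \<bar>h x\<bar>)"
    proof (rule always_eventually, rule allI)
      fix n :: nat
      let ?I = "{real n..real n + 1}" and ?B = "integral {real n..real n + 1} (\<lambda>x. \<bar>h x\<bar>)"
      have on: "f integrable_on ?I" if "\<And>b. f integrable_on {0..b}" for f :: "real \<Rightarrow> real"
        by (rule integrable_on_subinterval[OF that[of "real n + 1"]]) auto
      have near: "\<bar>P (real n) - P x\<bar> \<le> ?B" if x: "x \<in> ?I" for x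
      proof -
        have "P x - P (real n) = integral {real n..x} h"
          using x integral_Icc_diff[OF hi', of "real n" x x] by (simp add: eq)
        also have "norm \<dots> \<le> integral {real n..x} (\<lambda>x. \<bar>h x\<bar>)"
          by (rule Henstock_Kurzweil_Integration.integral_norm_bound_integral)
            (use x in \<open>auto intro!: integrable_on_subinterval[OF hi'[of x]] integrable_on_subinterval[OF ahi[of x]]\<close>)
        also have "\<dots> \<le> ?B"
          by (rule integral_subset_le)
            (use x in \<open>auto intro!: integrable_on_subinterval[OF ahi[of "real n + 1"]]\<close>)
        finally show ?thesis by (simp add: abs_minus_commute)
      qed
      have "P (real n) = integral ?I (\<lambda>x. P x) + integral ?I (\<lambda>x. P (real n) - P x)"
        by (subst integral_diff) (auto intro: on Pi')
      also have "norm \<dots> \<le> \<bar>integral ?I (\<lambda>x. P x)\<bar> + norm (integral ?I (\<lambda>x. P (real n) - P x))"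
        using norm_triangle_ineq by fastforce
      also have "norm (integral ?I (\<lambda>x. P (real n) - P x)) \<le> integral ?I (\<lambda>x. ?B)"
        by (rule Henstock_Kurzweil_Integration.integral_norm_bound_integral)
          (use near in \<open>auto intro!: integrable_diff on Pi'\<close>)
      also have "integral ?I (\<lambda>x. ?B) = ?B" by simp
      finally show "norm (P (real n)) \<le> \<bar>integral ?I P\<bar> + ?B" by simp
    qed
  qed
  moreover have "(\<lambda>n. P (real n)) \<longlonglongrightarrow> c + (LINT x|halfline. h x)"
    using tendsto_add[OF tendsto_const LINT_halfline_tendsto[OF h], of c] by (simp add: eq)
  ultimately show ?thesis using LIMSEQ_unique by blast
qed

lemma h1_rep_product:
  assumes u: "h1_rep u f g" and v: "h1_rep v p q" and x: "0 \<le> x"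
  shows "f x * p x = f 0 * p 0 + integral {0..x} (\<lambda>x. p x * g x + f x * q x)"
proof (rule integral_product_rule(1)[OF _ _ _ _ x])
  show "g absolutely_integrable_on {0..x}" "q absolutely_integrable_on {0..x}"
    using u v by (auto simp: h1_rep_def intro: square_integrable_imp_Icc)
  show "f y = f 0 + integral {0..y} g" if "y \<in> {0..x}" for y by (rule h1_repD[OF u]) (use that in simp)
  show "p y = p 0 + integral {0..y} q" if "y \<in> {0..x}" for y by (rule h1_repD[OF v]) (use that in simp)
qed

text \<open>The product of the continuous representatives is an integrable primitive of an
  integrable function and so vanishes at infinity; only the endpoint 0 contributes.\<close>

theorem h1_integration_by_parts: "h1_deriv u \<bullet> h1_fun v + h1_fun u \<bullet> h1_deriv v = - (trace0 u * trace0 v)"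
proof -
  obtain f g p q where u: "h1_rep u f g" and v: "h1_rep v p q" using h1_rep_ex by metis
  have si: "square_integrable f" "square_integrable g" "square_integrable p" "square_integrable q"
    using u v by (auto simp: h1_rep_def)
  have i: "integrable halfline (\<lambda>x. p x * g x)" "integrable halfline (\<lambda>x. f x * q x)"
    using si by (auto intro: square_integrable_mult)
  have "f 0 * p 0 + (LINT x|halfline. p x * g x + f x * q x) = 0"
    by (rule integrable_primitive_tendsto_0[OF _ _ h1_rep_product[OF u v]])
      (use si i in \<open>auto intro: square_integrable_mult\<close>)
  moreover have "h1_deriv u \<bullet> h1_fun v = (LINT x|halfline. p x * g x)"
    using u v by (simp add: h1_rep_def l2_class_inner mult.commute)
  moreover have "h1_fun u \<bullet> h1_deriv v = (LINT x|halfline. f x * q x)"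
    using u v by (simp add: h1_rep_def l2_class_inner)
  ultimately show ?thesis using i by (simp add: trace0_rep[OF u] trace0_rep[OF v])
qed

lemma trace0_square: "(trace0 u)\<^sup>2 = - 2 * (h1_deriv u \<bullet> h1_fun u)"
  using h1_integration_by_parts[of u u] by (simp add: power2_eq_square inner_commute)

lemma trace0_square_le: "(trace0 u)\<^sup>2 \<le> 2 * (norm (h1_fun u) * norm (h1_deriv u))"
  using Cauchy_Schwarz_ineq2[of "h1_deriv u" "h1_fun u"] unfolding trace0_square by (simp add: mult.commute)

text \<open>The square of f at x is the square at 0 plus the integral of 2 f g, and each of the two
  terms is at most the squared norm of u. This is the embedding of H^1 into bounded
  functions.\<close>

lemma h1_rep_bound:
  assumes u: "h1_rep u f g" and x: "0 \<le> x"
  shows "\<bar>f x\<bar> \<le> 2 * norm u"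
proof (rule power2_le_imp_le)
  have si: "square_integrable f" "square_integrable g" using u by (auto simp: h1_rep_def)
  have fg: "integrable halfline (\<lambda>x. f x * g x + f x * g x)"
    using si by (auto intro: square_integrable_mult)
  have sq: "integrable halfline (\<lambda>x. (f x)\<^sup>2 + (g x)\<^sup>2)" using si by (simp add: square_integrable_def)
  have sqi: "(\<lambda>x. (f x)\<^sup>2 + (g x)\<^sup>2) integrable_on {0..b}" for b
    using sq by (rule halfline_integrable_imp_Icc)
  have fgi: "(\<lambda>x. f x * g x + f x * g x) integrable_on {0..b}" for b
    using fg by (rule halfline_integrable_imp_Icc)
  have nu: "(norm u)\<^sup>2 = (LINT x|halfline. (f x)\<^sup>2 + (g x)\<^sup>2)"
    using u si by (simp add: norm_h1 h1_rep_def norm_l2_class square_integrable_def)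
  have amgm: "\<bar>f x * g x + f x * g x\<bar> \<le> (f x)\<^sup>2 + (g x)\<^sup>2" for x
    using sum_squares_bound[of "\<bar>f x\<bar>" "\<bar>g x\<bar>"] by (simp add: abs_mult)
  have "\<bar>integral {0..x} (\<lambda>x. f x * g x + f x * g x)\<bar> \<le> integral {0..x} (\<lambda>x. (f x)\<^sup>2 + (g x)\<^sup>2)"
    using Henstock_Kurzweil_Integration.integral_norm_bound_integral[OF fgi sqi] amgm by auto
  also have "\<dots> \<le> (norm u)\<^sup>2"
    unfolding nu
  proof (rule LIMSEQ_le_const[OF LINT_halfline_tendsto[OF sq]])
    obtain N where N: "x \<le> real N" using real_arch_simple by blast
    show "\<exists>N. \<forall>n\<ge>N. integral {0..x} (\<lambda>x. (f x)\<^sup>2 + (g x)\<^sup>2) \<le> integral {0..real n} (\<lambda>x. (f x)\<^sup>2 + (g x)\<^sup>2)"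
    proof (intro exI[of _ N] allI impI integral_subset_le sqi)
      fix n assume "N \<le> n"
      then show "{0..x} \<subseteq> {0..real n}" using N by auto
    qed auto
  qed
  finally have 1: "\<bar>integral {0..x} (\<lambda>x. f x * g x + f x * g x)\<bar> \<le> (norm u)\<^sup>2" .
  have "(f 0)\<^sup>2 \<le> 2 * (norm (h1_fun u) * norm (h1_deriv u))" using trace0_square_le[of u] trace0_rep[OF u] by simp
  also have "\<dots> \<le> (norm u)\<^sup>2" using sum_squares_bound[of "norm (h1_fun u)" "norm (h1_deriv u)"] by (simp add: norm_h1)
  finally have "(f 0)\<^sup>2 \<le> (norm u)\<^sup>2" .
  moreover have "(f x)\<^sup>2 = (f 0)\<^sup>2 + integral {0..x} (\<lambda>x. f x * g x + f x * g x)"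
    using h1_rep_product[OF u u x] by (simp add: power2_eq_square)
  ultimately show "\<bar>f x\<bar>\<^sup>2 \<le> (2 * norm u)\<^sup>2" using 1 by (simp add: power_mult_distrib)
qed simp

lemma bounded_linear_trace0: "bounded_linear trace0"
proof (rule bounded_linear_intro[where K = 2])
  fix u
  obtain f g where "h1_rep u f g" using h1_rep_ex by metis
  then show "norm (trace0 u) \<le> norm u * 2" using h1_rep_bound[of u f g 0] by (simp add: trace0_rep)
qed (simp_all add: trace0_add trace0_scale)

text \<open>The hat max(0, 1 - x) has trace 1. Elements of prescribed trace are the test functions
  that detect the vertex conditions, and they also show that H^1 is not the trivial space.\<close>

lemma trace0_surj: "\<exists>u. trace0 u = r"
proof -
  define f where "f x = max 0 (1 - x)" for x :: real
  define g where "g x = (if x < 1 then -1 else 0 :: real)" for x :: real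
  have prim: "f x = f 0 + integral {0..x} g" if "0 \<le> x" for x
  proof -
    have "(g has_integral (f x - f 0)) {0..x}"
    proof (rule fundamental_theorem_of_calculus_strong[of "{1}"])
      show "continuous_on {0..x} f" unfolding f_def by (intro continuous_intros)
      fix y assume y: "y \<in> {0..x} - {1}"
      have "(f has_real_derivative g y) (at y)"
      proof (cases "y < 1")
        case True
        show ?thesis
          by (rule has_field_derivative_transform_within_open[of "\<lambda>y. 1 - y" _ _ "{..<1}"])
            (use True in \<open>auto simp: f_def g_def intro!: derivative_eq_intros\<close>)
      next
        case False
        show ?thesis
          by (rule has_field_derivative_transform_within_open[of "\<lambda>y. 0" _ _ "{1<..}"])
            (use False y in \<open>auto simp: f_def g_def\<close>)
      qed
      then show "(f has_vector_derivative g y) (at y)"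
        by (simp add: has_real_derivative_iff_has_vector_derivative)
    qed (use that in auto)
    then show ?thesis by (simp add: integral_unique)
  qed
  have f: "square_integrable f"
    by (rule square_integrable_compact_support[of 1])
      (auto simp: f_def intro!: continuous_intros continuous_imp_measurable_on_sets_lebesgue)
  have g_m: "g \<in> borel_measurable halfline"
  proof -
    have "g \<in> borel_measurable borel" unfolding g_def by measurable
    then have "g \<in> borel_measurable lebesgue" by (simp add: measurable_completion)
    then show ?thesis by (rule measurable_restrict_space1)
  qed
  have g: "square_integrable g"
  proof -
    have "(\<lambda>x. (g x)\<^sup>2) absolutely_integrable_on {0<..<1}"
      using absolutely_integrable_continuous_real[of 0 1 "\<lambda>x. 1 :: real"]
      unfolding absolutely_integrable_on_Icc_iff_Ioo
      by (rule set_integrable_cong[THEN iffD1, rotated -1]) (auto simp: g_def)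
    also have "?this \<longleftrightarrow> (\<lambda>x. (g x)\<^sup>2) absolutely_integrable_on {0<..}"
      by (rule absolutely_integrable_spike_set_eq) (auto intro!: negligible_subset[of "{}"] simp: g_def)
    finally show ?thesis using g_m by (simp add: square_integrable_def halfline_integrable_iff)
  qed
  from weak_derivative_of_primitive[OF f g prim] obtain u where u: "h1_fun u = l2_class f" "h1_deriv u = l2_class g"
    using h1_ex by blast
  have "h1_rep u f g" by (rule h1_repI[OF f g u prim])
  then have "trace0 u = 1" by (simp add: trace0_rep f_def)
  then have "trace0 (r *\<^sub>R u) = r" by (simp add: trace0_scale)
  then show ?thesis by blast
qed

text \<open>Uniqueness of the weak derivative: the continuous representative vanishes, so the
  derivative has zero integral over every interval and is zero almost everywhere.\<close>

lemma h1_fun_eq_0_imp: "h1_fun u = 0 \<Longrightarrow> u = 0"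
proof -
  assume 0: "h1_fun u = 0"
  obtain f g where u: "h1_rep u f g" using h1_rep_ex by metis
  have si: "square_integrable f" "square_integrable g" using u by (auto simp: h1_rep_def)
  have "l2_class f = l2_class (\<lambda>x. 0)" using u 0 by (simp add: h1_rep_def l2_class_zero)
  then have ae: "AE x in halfline. f x = 0" using l2_class_eq_iff[OF si(1) square_integrable_zero] by simp
  have c: "continuous_on {0<..} f" using h1_rep_continuous_on[OF u] by (rule continuous_on_subset) auto
  have f0: "f x = 0" if "0 < x" for x by (rule continuous_AE_eq[OF c continuous_on_const ae that])
  have gi: "g integrable_on {0..b}" for b
    by (rule set_lebesgue_integral_eq_integral(1)[OF square_integrable_imp_Icc[OF si(2)]])
  have "AE x in halfline. g x = 0"
  proof (rule AE_eq_if_interval_integrals)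
    show "g absolutely_integrable_on {0..b}" for b by (rule square_integrable_imp_Icc[OF si(2)])
    fix x h :: real assume x: "0 < x" and h: "0 < h"
    have "f x = f 0 + integral {0..x} g" "f (x + h) = f 0 + integral {0..x + h} g"
      using u x h unfolding h1_rep_def by (meson add_nonneg_nonneg less_imp_le)+
    then show "integral {x..x + h} g = h * 0"
      using integral_Icc_diff[OF gi, of x "x + h" "x + h"] f0[OF x] f0[of "x + h"] x h by simp
  qed
  then have "l2_class g = l2_class (\<lambda>x. 0)" using l2_class_eq_iff[OF si(2) square_integrable_zero] by simp
  then have "h1_deriv u = 0" using u by (simp add: h1_rep_def l2_class_zero)
  then show "u = 0" using 0 by (intro h1_eqI) (simp_all add: h1_linear)
qed

text \<open>Every C^1 test function is an element of H^1 with trace zero. In this form weak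
  derivatives can be read off directly from variational identities.\<close>

lemma weak_derivativeI:
  assumes "\<And>v. trace0 v = 0 \<Longrightarrow> f \<bullet> h1_deriv v = - (g \<bullet> h1_fun v)"
  shows "weak_derivative f g"
  unfolding weak_derivative_def
proof (intro allI impI)
  fix \<phi> \<phi>' assume t: "C1_test_function \<phi> \<phi>'"
  note T = C1_test_functionD[OF t]
  from weak_derivative_of_primitive[OF T(5,6) T(2)] obtain v where v: "h1_fun v = l2_class \<phi>" "h1_deriv v = l2_class \<phi>'"
    using h1_ex by blast
  have "h1_rep v \<phi> \<phi>'" by (rule h1_repI[OF T(5,6) v T(2)])
  then have "trace0 v = 0" using T(1) by (auto simp: trace0_rep)
  from assms[OF this] show "f \<bullet> l2_class \<phi>' = - (g \<bullet> l2_class \<phi>)" by (simp add: v)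
qed

text \<open>If f is orthogonal to H^1, the pair (0, f) satisfies the weak derivative identity, so f
  is the derivative of 0.\<close>

lemma h1_dense:
  assumes "\<And>v. f \<bullet> h1_fun v = 0"
  shows "f = 0"
proof -
  have "weak_derivative 0 f" by (rule weak_derivativeI) (simp add: assms)
  then obtain u where u: "h1_fun u = 0" "h1_deriv u = f" using h1_ex by blast
  then show ?thesis using h1_fun_eq_0_imp[of u] by (simp add: h1_linear)
qed

text \<open>Needed to form exponentials of operators on the phase space; small multiples of an
  element of trace 1 show that no point is isolated.\<close>

instance h1 :: perfect_space
proof
  fix u :: h1
  show "\<not> open {u}"
  proof
    assume "open {u}"
    then obtain e where e: "e > 0" "\<And>v. dist v u < e \<Longrightarrow> v = u" unfolding open_dist by auto
    obtain w where w: "trace0 w = 1" using trace0_surj by blast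
    define v where "v = u + (e / (2 * (norm w + 1))) *\<^sub>R w"
    have "norm w + 1 > 0" by (smt (verit) norm_ge_zero)
    then have "(e / (2 * (norm w + 1))) * norm w < e"
      using e(1) by (simp add: field_simps) (smt (verit) mult_pos_pos mult_nonneg_nonneg norm_ge_zero)
    then have "dist v u < e" using e(1) by (simp add: v_def dist_norm)
    then have "v = u" by (rule e(2))
    then have "(e / (2 * (norm w + 1))) *\<^sub>R w = 0" by (simp add: v_def)
    then have "w = 0" using e(1) \<open>norm w + 1 > 0\<close> by simp
    then show False using w trace0_scale[of 0 w] by simp
  qed
qed

section \<open>The nonlinearity\<close>

lemma C2_bounded_precomp:
  fixes P :: "'a::real_normed_vector \<Rightarrow>\<^sub>L 'b::real_normed_vector" and f :: "'b \<Rightarrow> 'c::real_normed_vector"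
  assumes f: "C2_bounded f f' f'' C" and P: "norm P \<le> 1"
  shows "C2_bounded (\<lambda>x. f (P x)) (\<lambda>x. f' (P x) o\<^sub>L P) (\<lambda>x. blinfun_precomp P o\<^sub>L (f'' (P x) o\<^sub>L P)) C"
proof -
  have C: "0 \<le> C" using f by (rule C2_bounded_nonneg)
  note D = C2_boundedD[OF f]
  have Px: "norm (P x) \<le> norm x" for x
    using norm_blinfun[of P x] mult_right_mono[OF P norm_ge_zero[of x]] by simp
  have sq: "C * (norm (P x))\<^sup>2 \<le> C * (norm x)\<^sup>2" for x
    using C Px by (intro mult_left_mono power_mono) auto
  have N1: "norm (T o\<^sub>L P) \<le> K" if "norm T \<le> K" for T :: "'b \<Rightarrow>\<^sub>L 'd::real_normed_vector" and K
    using norm_blinfun_compose[of T P] mult_left_mono[OF P norm_ge_zero[of T]] that by linarith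
  have N2: "norm (blinfun_precomp P o\<^sub>L (T o\<^sub>L P)) \<le> K" if "norm T \<le> K" for T :: "'b \<Rightarrow>\<^sub>L 'b \<Rightarrow>\<^sub>L 'c" and K
  proof -
    have "norm (blinfun_precomp P o\<^sub>L (T o\<^sub>L P)) \<le> norm (blinfun_precomp P :: ('b \<Rightarrow>\<^sub>L 'c) \<Rightarrow>\<^sub>L _) * norm (T o\<^sub>L P)"
      by (rule norm_blinfun_compose)
    also have "\<dots> \<le> 1 * K"
      by (intro mult_mono N1 that order_trans[OF norm_blinfun_precomp P]) auto
    finally show ?thesis by simp
  qed
  show ?thesis
    unfolding C2_bounded_def
  proof (intro conjI allI)
    fix x h
    show "norm (f (P (x + h)) - f (P x) - (f' (P x) o\<^sub>L P) h) \<le> C * (norm h)\<^sup>2"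
      using order_trans[OF D(1)[of "P x" "P h"] sq] by (simp add: blinfun.add_right)
    have "norm ((f' (P x + P h) - f' (P x) - f'' (P x) (P h)) o\<^sub>L P) \<le> C * (norm h)\<^sup>2"
      by (rule N1[OF order_trans[OF D(2) sq]])
    then show "norm ((f' (P (x + h)) o\<^sub>L P) - (f' (P x) o\<^sub>L P) - (blinfun_precomp P o\<^sub>L (f'' (P x) o\<^sub>L P)) h) \<le> C * (norm h)\<^sup>2"
      by (simp add: blinfun.add_right bounded_bilinear.diff_left[OF bounded_bilinear_blinfun_compose])
    have "norm (blinfun_precomp P o\<^sub>L ((f'' (P x) - f'' (P h)) o\<^sub>L P)) \<le> C * norm (x - h)"
    proof (rule N2[OF order_trans[OF D(3)]])
      show "C * norm (P x - P h) \<le> C * norm (x - h)"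
        using mult_left_mono[OF Px[of "x - h"] C] by (simp add: blinfun.diff_right)
    qed
    then show "norm ((blinfun_precomp P o\<^sub>L (f'' (P x) o\<^sub>L P)) - (blinfun_precomp P o\<^sub>L (f'' (P h) o\<^sub>L P))) \<le> C * norm (x - h)"
      by (simp add: bounded_bilinear.diff_left[OF bounded_bilinear_blinfun_compose]
          bounded_bilinear.diff_right[OF bounded_bilinear_blinfun_compose])
    show "norm (f' (P x) o\<^sub>L P) \<le> C" by (rule N1[OF D(4)])
    show "norm (blinfun_precomp P o\<^sub>L (f'' (P x) o\<^sub>L P)) \<le> C" by (rule N2[OF D(5)])
  qed
qed

lemma C2_bounded_add:
  fixes f g :: "'a::real_normed_vector \<Rightarrow> 'b::real_normed_vector"
  assumes f: "C2_bounded f f' f'' C" and g: "C2_bounded g g' g'' D"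
  shows "C2_bounded (\<lambda>x. f x + g x) (\<lambda>x. f' x + g' x) (\<lambda>x. f'' x + g'' x) (C + D)"
proof -
  have sum: "norm (a + b) \<le> (C + D) * r" if "norm a \<le> C * r" "norm b \<le> D * r" for a b :: "'z::real_normed_vector" and r
    using that by (intro norm_triangle_le) (simp add: distrib_right)
  have sum1: "norm (a + b) \<le> C + D" if "norm a \<le> C" "norm b \<le> D" for a b :: "'z::real_normed_vector"
    using that by (intro norm_triangle_le) simp
  note Df = C2_boundedD[OF f]
  note Dg = C2_boundedD[OF g]
  show ?thesis
    unfolding C2_bounded_def
  proof (intro conjI allI)
    fix x h
    show "norm (f (x + h) + g (x + h) - (f x + g x) - (f' x + g' x) h) \<le> (C + D) * (norm h)\<^sup>2"
      using sum[OF Df(1)[of x h] Dg(1)[of x h]] by (simp add: blinfun.add_left algebra_simps)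
    show "norm (f' (x + h) + g' (x + h) - (f' x + g' x) - (f'' x + g'' x) h) \<le> (C + D) * (norm h)\<^sup>2"
      using sum[OF Df(2)[of x h] Dg(2)[of x h]] by (simp add: blinfun.add_left algebra_simps)
    show "norm (f'' x + g'' x - (f'' h + g'' h)) \<le> (C + D) * norm (x - h)"
      using sum[OF Df(3)[of x h] Dg(3)[of x h]] by (simp add: algebra_simps)
    show "norm (f' x + g' x) \<le> C + D" "norm (f'' x + g'' x) \<le> C + D"
      by (rule sum1[OF Df(4) Dg(4)], rule sum1[OF Df(5) Dg(5)])
  qed
qed

lemma C2_bounded_sum:
  fixes f :: "'i \<Rightarrow> 'a::real_normed_vector \<Rightarrow> 'b::real_normed_vector"
  assumes "finite I" "\<And>i. i \<in> I \<Longrightarrow> \<exists>f' f'' C. C2_bounded (f i) f' f'' C"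
  shows "\<exists>f' f'' C. C2_bounded (\<lambda>x. \<Sum>i\<in>I. f i x) f' f'' C"
  using assms
proof (induction I)
  case empty
  have "C2_bounded (\<lambda>x::'a. 0::'b) (\<lambda>x. 0) (\<lambda>x. 0) 0" by (simp add: C2_bounded_def)
  then show ?case by auto
next
  case (insert i I)
  then obtain f' f'' C g' g'' D where "C2_bounded (f i) f' f'' C" "C2_bounded (\<lambda>x. \<Sum>i\<in>I. f i x) g' g'' D"
    by (metis insertI1 insertI2)
  from C2_bounded_add[OF this] show ?case using insert by auto
qed

section \<open>The sine as a smooth substitution operator from H^1 to L^2\<close>

lemma sin_cos_lipschitz:
  fixes x y :: real
  shows "\<bar>sin x - sin y\<bar> \<le> \<bar>x - y\<bar>" "\<bar>cos x - cos y\<bar> \<le> \<bar>x - y\<bar>"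
proof -
  have "norm (sin x - sin y) \<le> 1 * norm (x - y)"
    by (rule field_differentiable_bound[of UNIV sin cos]) (auto intro!: derivative_eq_intros)
  then show "\<bar>sin x - sin y\<bar> \<le> \<bar>x - y\<bar>" by simp
  have "norm (cos x - cos y) \<le> 1 * norm (x - y)"
    by (rule field_differentiable_bound[of UNIV cos "\<lambda>x. - sin x"]) (auto intro!: derivative_eq_intros)
  then show "\<bar>cos x - cos y\<bar> \<le> \<bar>x - y\<bar>" by simp
qed

lemma sin_cos_remainder:
  fixes a b :: real
  shows "\<bar>sin (a + b) - sin a - cos a * b\<bar> \<le> b\<^sup>2" "\<bar>cos (a + b) - cos a + sin a * b\<bar> \<le> b\<^sup>2"
proof -
  have ab: "a + b \<in> cball a \<bar>b\<bar>" "a \<in> cball a \<bar>b\<bar>" by (auto simp: dist_norm)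
  have "norm ((sin (a + b) - cos a * (a + b)) - (sin a - cos a * a)) \<le> \<bar>b\<bar> * norm (a + b - a)"
  proof (rule field_differentiable_bound[OF convex_cball _ _ ab])
    fix t assume t: "t \<in> cball a \<bar>b\<bar>"
    show "((\<lambda>t. sin t - cos a * t) has_real_derivative (cos t - cos a)) (at t within cball a \<bar>b\<bar>)"
      by (auto intro!: derivative_eq_intros)
    show "norm (cos t - cos a) \<le> \<bar>b\<bar>" using sin_cos_lipschitz(2)[of t a] t by (simp add: dist_norm abs_minus_commute)
  qed
  then show "\<bar>sin (a + b) - sin a - cos a * b\<bar> \<le> b\<^sup>2"
    by (simp add: algebra_simps power2_eq_square abs_mult_self_eq)
  have "norm ((cos (a + b) + sin a * (a + b)) - (cos a + sin a * a)) \<le> \<bar>b\<bar> * norm (a + b - a)"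
  proof (rule field_differentiable_bound[OF convex_cball _ _ ab])
    fix t assume t: "t \<in> cball a \<bar>b\<bar>"
    show "((\<lambda>t. cos t + sin a * t) has_real_derivative (- sin t + sin a)) (at t within cball a \<bar>b\<bar>)"
      by (auto intro!: derivative_eq_intros)
    show "norm (- sin t + sin a) \<le> \<bar>b\<bar>" using sin_cos_lipschitz(1)[of a t] t by (simp add: dist_norm)
  qed
  then show "\<bar>cos (a + b) - cos a + sin a * b\<bar> \<le> b\<^sup>2"
    by (simp add: algebra_simps power2_eq_square abs_mult_self_eq)
qed

text \<open>A fixed choice of continuous representative, in which pointwise Taylor estimates can be
  made. Its linearity is recorded only almost everywhere, which is all that \<open>l2_class\<close>
  sees.\<close>

definition h1_repr :: "h1 \<Rightarrow> real \<Rightarrow> real" where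
  "h1_repr u = (SOME f. \<exists>g. h1_rep u f g)"

lemma h1_repr:
  "square_integrable (h1_repr u)" "h1_fun u = l2_class (h1_repr u)" "0 < x \<Longrightarrow> \<bar>h1_repr u x\<bar> \<le> 2 * norm u"
proof -
  have "\<exists>g. h1_rep u (h1_repr u) g" unfolding h1_repr_def by (rule someI_ex[OF h1_rep_ex])
  then obtain g where g: "h1_rep u (h1_repr u) g" by blast
  show "square_integrable (h1_repr u)" "h1_fun u = l2_class (h1_repr u)" using g by (auto simp: h1_rep_def)
  show "0 < x \<Longrightarrow> \<bar>h1_repr u x\<bar> \<le> 2 * norm u" using h1_rep_bound[OF g] by simp
qed

lemma h1_repr_measurable [measurable]: "h1_repr u \<in> borel_measurable halfline"
  using h1_repr(1)[of u] by (simp add: square_integrable_def)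

lemma h1_repr_add: "AE x in halfline. h1_repr (u + v) x = h1_repr u x + h1_repr v x"
  using l2_class_eq_iff[OF h1_repr(1)[of "u + v"] square_integrable_add[OF h1_repr(1)[of u] h1_repr(1)[of v]]]
  by (simp add: h1_repr(2)[symmetric] l2_class_add[symmetric] h1_repr(1) h1_linear)

lemma h1_repr_scale: "AE x in halfline. h1_repr (r *\<^sub>R u) x = r * h1_repr u x"
  using l2_class_eq_iff[OF h1_repr(1)[of "r *\<^sub>R u"] square_integrable_scale[OF h1_repr(1)[of u], of r]]
  by (simp add: h1_repr(2)[symmetric] l2_class_scale[symmetric] h1_repr(1) h1_linear)

lemma AE_halfline_I: "(\<And>x. 0 < x \<Longrightarrow> P x) \<Longrightarrow> AE x in halfline. P x"
  by (rule AE_I2) (simp add: space_restrict_space)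

lemma square_integrable_bounded_mult:
  assumes [measurable]: "m \<in> borel_measurable halfline" and b: "\<And>x. 0 < x \<Longrightarrow> \<bar>m x\<bar> \<le> B" and f: "square_integrable f"
  shows "square_integrable (\<lambda>x. m x * f x)"
proof -
  have [measurable]: "f \<in> borel_measurable halfline" using f by (simp add: square_integrable_def)
  have "integrable halfline (\<lambda>x. (m x * f x)\<^sup>2)"
  proof (rule Bochner_Integration.integrable_bound)
    show "integrable halfline (\<lambda>x. B\<^sup>2 * (f x)\<^sup>2)" using f by (simp add: square_integrable_def)
    show "AE x in halfline. norm ((m x * f x)\<^sup>2) \<le> norm (B\<^sup>2 * (f x)\<^sup>2)"
    proof (rule AE_halfline_I)
      fix x :: real assume "0 < x"
      then have "\<bar>m x\<bar>\<^sup>2 \<le> B\<^sup>2" using b by (intro power_mono) auto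
      then have "(m x)\<^sup>2 * (f x)\<^sup>2 \<le> B\<^sup>2 * (f x)\<^sup>2" by (intro mult_right_mono) auto
      then show "norm ((m x * f x)\<^sup>2) \<le> norm (B\<^sup>2 * (f x)\<^sup>2)" by (simp add: power_mult_distrib)
    qed
  qed measurable
  then show ?thesis by (simp add: square_integrable_def)
qed

lemma norm_l2_class_le_h1:
  assumes f: "square_integrable f" and le: "AE x in halfline. \<bar>f x\<bar> \<le> D * \<bar>h1_repr k x\<bar>" and D: "0 \<le> D"
  shows "norm (l2_class f) \<le> D * norm k"
proof -
  have "norm (l2_class f) \<le> D * norm (h1_fun k)"
    unfolding h1_repr(2) by (rule norm_l2_class_le[OF f h1_repr(1) le D])
  also have "\<dots> \<le> D * norm k" using D norm_h1_fun_le by (intro mult_left_mono)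
  finally show ?thesis .
qed

text \<open>Both derivatives of the sine are multiplication operators from H^1 to L^2: the
  multiplier is cos u for the first, and -sin u times k for the second in direction k, which is
  bounded because k is in H^1.\<close>

definition mult_l2 :: "(real \<Rightarrow> real) \<Rightarrow> h1 \<Rightarrow>\<^sub>L l2" where
  "mult_l2 m = Blinfun (\<lambda>k. l2_class (\<lambda>x. m x * h1_repr k x))"

lemma l2_class_cong:
  assumes "square_integrable f" "square_integrable g" "AE x in halfline. f x = g x"
  shows "l2_class f = l2_class g"
  using assms l2_class_eq_iff by blast

text \<open>Two bounds are kept apart: B' only ensures square integrability of the product, while B,
  required just almost everywhere, gives the operator norm. Remainders satisfy the sharp bound only
  almost everywhere, because representatives add only almost everywhere.\<close>

lemma mult_l2:
  assumes m: "m \<in> borel_measurable halfline" and b: "AE x in halfline. \<bar>m x\<bar> \<le> B" and B: "0 \<le> B"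
    and b': "\<And>x. 0 < x \<Longrightarrow> \<bar>m x\<bar> \<le> B'"
  shows mult_l2_apply: "mult_l2 m k = l2_class (\<lambda>x. m x * h1_repr k x)"
    and norm_mult_l2: "norm (mult_l2 m) \<le> B"
proof -
  have si: "square_integrable (\<lambda>x. m x * h1_repr k x)" for k
    by (rule square_integrable_bounded_mult[OF m _ h1_repr(1)]) (rule b')
  have le: "norm (l2_class (\<lambda>x. m x * h1_repr k x)) \<le> B * norm k" for k
  proof (rule norm_l2_class_le_h1[OF si _ B])
    show "AE x in halfline. \<bar>m x * h1_repr k x\<bar> \<le> B * \<bar>h1_repr k x\<bar>"
      using b by eventually_elim (simp add: abs_mult mult_right_mono)
  qed
  have "bounded_linear (\<lambda>k. l2_class (\<lambda>x. m x * h1_repr k x))"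
  proof (rule bounded_linear_intro[where K = B])
    fix k l :: h1 and r :: real
    show "l2_class (\<lambda>x. m x * h1_repr (k + l) x) = l2_class (\<lambda>x. m x * h1_repr k x) + l2_class (\<lambda>x. m x * h1_repr l x)"
      unfolding l2_class_add[OF si si]
    proof (rule l2_class_cong[OF si square_integrable_add[OF si si]])
      show "AE x in halfline. m x * h1_repr (k + l) x = m x * h1_repr k x + m x * h1_repr l x"
        using h1_repr_add[of k l] by eventually_elim (simp add: distrib_left)
    qed
    show "l2_class (\<lambda>x. m x * h1_repr (r *\<^sub>R k) x) = r *\<^sub>R l2_class (\<lambda>x. m x * h1_repr k x)"
      unfolding l2_class_scale[OF si]
    proof (rule l2_class_cong[OF si square_integrable_scale[OF si]])
      show "AE x in halfline. m x * h1_repr (r *\<^sub>R k) x = r * (m x * h1_repr k x)"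
        using h1_repr_scale[of r k] by eventually_elim simp
    qed
    show "norm (l2_class (\<lambda>x. m x * h1_repr k x)) \<le> norm k * B" using le[of k] by (simp add: mult.commute)
  qed
  then show app: "mult_l2 m k = l2_class (\<lambda>x. m x * h1_repr k x)" for k
    by (simp add: mult_l2_def bounded_linear_Blinfun_apply)
  show "norm (mult_l2 m) \<le> B" by (rule norm_blinfun_bound[OF B]) (simp add: app le)
qed

lemma mult_l2_linear:
  assumes m: "m \<in> borel_measurable halfline" "\<And>x. 0 < x \<Longrightarrow> \<bar>m x\<bar> \<le> B"
    and n: "n \<in> borel_measurable halfline" "\<And>x. 0 < x \<Longrightarrow> \<bar>n x\<bar> \<le> D"
    and p: "p \<in> borel_measurable halfline" "\<And>x. 0 < x \<Longrightarrow> \<bar>p x\<bar> \<le> E"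
    and eq: "AE x in halfline. p x = r * m x + s * n x"
  shows "mult_l2 p = r *\<^sub>R mult_l2 m + s *\<^sub>R mult_l2 n"
proof (rule blinfun_eqI)
  fix k
  have app: "mult_l2 q k = l2_class (\<lambda>x. q x * h1_repr k x)" and si: "square_integrable (\<lambda>x. q x * h1_repr k x)"
    if q: "q \<in> borel_measurable halfline" and Q: "\<And>x. 0 < x \<Longrightarrow> \<bar>q x\<bar> \<le> Q" for q Q
  proof -
    have "0 \<le> Q" using Q[of 1] by linarith
    from AE_halfline_I[of "\<lambda>x. \<bar>q x\<bar> \<le> Q"] Q have "AE x in halfline. \<bar>q x\<bar> \<le> Q" by blast
    from mult_l2_apply[OF q this \<open>0 \<le> Q\<close>] Q show "mult_l2 q k = l2_class (\<lambda>x. q x * h1_repr k x)" by blast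
    show "square_integrable (\<lambda>x. q x * h1_repr k x)"
      by (rule square_integrable_bounded_mult[OF q _ h1_repr(1)]) (rule Q)
  qed
  note appm = app[OF m(1), OF m(2)] and appn = app[OF n(1), OF n(2)] and appp = app[OF p(1), OF p(2)]
  have sim: "square_integrable (\<lambda>x. m x * h1_repr k x)" by (rule si[OF m(1)]) (rule m(2))
  have sin: "square_integrable (\<lambda>x. n x * h1_repr k x)" by (rule si[OF n(1)]) (rule n(2))
  have sip: "square_integrable (\<lambda>x. p x * h1_repr k x)" by (rule si[OF p(1)]) (rule p(2))
  have "l2_class (\<lambda>x. p x * h1_repr k x) = l2_class (\<lambda>x. r * (m x * h1_repr k x) + s * (n x * h1_repr k x))"
  proof (rule l2_class_cong)
    show "AE x in halfline. p x * h1_repr k x = r * (m x * h1_repr k x) + s * (n x * h1_repr k x)"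
      using eq by eventually_elim (simp add: algebra_simps)
  qed (intro square_integrable_add square_integrable_scale sim sin sip)+
  also have "\<dots> = r *\<^sub>R l2_class (\<lambda>x. m x * h1_repr k x) + s *\<^sub>R l2_class (\<lambda>x. n x * h1_repr k x)"
    by (simp add: l2_class_add l2_class_scale square_integrable_scale sim sin)
  finally show "mult_l2 p k = (r *\<^sub>R mult_l2 m + s *\<^sub>R mult_l2 n) k"
    by (simp add: blinfun.add_left blinfun.scaleR_left appm appn appp)
qed

lemma mult_l2_bounds:
  "0 < x \<Longrightarrow> \<bar>cos (h1_repr u x)\<bar> \<le> 1" "0 < x \<Longrightarrow> \<bar>- sin (h1_repr u x) * h1_repr k x\<bar> \<le> 2 * norm k"
  "(\<lambda>x. cos (h1_repr u x)) \<in> borel_measurable halfline" "(\<lambda>x. - sin (h1_repr u x) * h1_repr k x) \<in> borel_measurable halfline"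
proof -
  show "0 < x \<Longrightarrow> \<bar>- sin (h1_repr u x) * h1_repr k x\<bar> \<le> 2 * norm k"
    using mult_mono[OF abs_sin_le_one h1_repr(3), of x k "h1_repr u x"] by (simp add: abs_mult)
  show "(\<lambda>x. - sin (h1_repr u x) * h1_repr k x) \<in> borel_measurable halfline"
    "(\<lambda>x. cos (h1_repr u x)) \<in> borel_measurable halfline" by measurable
qed simp

definition sin_deriv2 :: "h1 \<Rightarrow> h1 \<Rightarrow>\<^sub>L h1 \<Rightarrow>\<^sub>L l2" where
  "sin_deriv2 u = Blinfun (\<lambda>k. mult_l2 (\<lambda>x. - sin (h1_repr u x) * h1_repr k x))"

lemma sin_deriv2_apply: "sin_deriv2 u k = mult_l2 (\<lambda>x. - sin (h1_repr u x) * h1_repr k x)"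
  and norm_sin_deriv2: "norm (sin_deriv2 u) \<le> 2"
proof -
  have N: "norm (mult_l2 (\<lambda>x. - sin (h1_repr u x) * h1_repr k x)) \<le> 2 * norm k" for k
  proof (rule norm_mult_l2[OF mult_l2_bounds(4)])
    show "AE x in halfline. \<bar>- sin (h1_repr u x) * h1_repr k x\<bar> \<le> 2 * norm k"
      by (rule AE_halfline_I) (rule mult_l2_bounds)
    show "0 < x \<Longrightarrow> \<bar>- sin (h1_repr u x) * h1_repr k x\<bar> \<le> 2 * norm k" for x by (rule mult_l2_bounds)
  qed simp
  have "bounded_linear (\<lambda>k. mult_l2 (\<lambda>x. - sin (h1_repr u x) * h1_repr k x))"
  proof (rule bounded_linear_intro[where K = 2])
    fix k l :: h1 and r :: real
    have "mult_l2 (\<lambda>x. - sin (h1_repr u x) * h1_repr (k + l) x) =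
        1 *\<^sub>R mult_l2 (\<lambda>x. - sin (h1_repr u x) * h1_repr k x) + 1 *\<^sub>R mult_l2 (\<lambda>x. - sin (h1_repr u x) * h1_repr l x)"
    proof (rule mult_l2_linear)
      show "AE x in halfline. - sin (h1_repr u x) * h1_repr (k + l) x =
          1 * (- sin (h1_repr u x) * h1_repr k x) + 1 * (- sin (h1_repr u x) * h1_repr l x)"
        using h1_repr_add[of k l] by eventually_elim (simp add: algebra_simps)
    qed (rule mult_l2_bounds; assumption)+
    then show "mult_l2 (\<lambda>x. - sin (h1_repr u x) * h1_repr (k + l) x) =
        mult_l2 (\<lambda>x. - sin (h1_repr u x) * h1_repr k x) + mult_l2 (\<lambda>x. - sin (h1_repr u x) * h1_repr l x)" by simp
    have "mult_l2 (\<lambda>x. - sin (h1_repr u x) * h1_repr (r *\<^sub>R k) x) =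
        r *\<^sub>R mult_l2 (\<lambda>x. - sin (h1_repr u x) * h1_repr k x) + 0 *\<^sub>R mult_l2 (\<lambda>x. - sin (h1_repr u x) * h1_repr k x)"
    proof (rule mult_l2_linear)
      show "AE x in halfline. - sin (h1_repr u x) * h1_repr (r *\<^sub>R k) x =
          r * (- sin (h1_repr u x) * h1_repr k x) + 0 * (- sin (h1_repr u x) * h1_repr k x)"
        using h1_repr_scale[of r k] by eventually_elim simp
    qed (rule mult_l2_bounds; assumption)+
    then show "mult_l2 (\<lambda>x. - sin (h1_repr u x) * h1_repr (r *\<^sub>R k) x) =
        r *\<^sub>R mult_l2 (\<lambda>x. - sin (h1_repr u x) * h1_repr k x)" by simp
    show "norm (mult_l2 (\<lambda>x. - sin (h1_repr u x) * h1_repr k x)) \<le> norm k * 2" using N[of k] by (simp add: mult.commute)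
  qed
  then show app: "sin_deriv2 u k = mult_l2 (\<lambda>x. - sin (h1_repr u x) * h1_repr k x)" for k
    by (simp add: sin_deriv2_def bounded_linear_Blinfun_apply)
  show "norm (sin_deriv2 u) \<le> 2"
  proof (rule norm_blinfun_bound)
    show "norm (sin_deriv2 u k) \<le> 2 * norm k" for k unfolding app by (rule N)
  qed simp
qed

text \<open>A quadratic remainder in h is estimated with one factor in the sup norm, at most 2 times
  the H^1 norm, and the other in L^2. For the derivative the remainder is itself a multiplier and
  both factors are taken in the sup norm, whence 2 * 2 = 4.\<close>

lemma C2_bounded_sin:
  "C2_bounded (\<lambda>u. sin_l2 (h1_fun u)) (\<lambda>u. mult_l2 (\<lambda>x. cos (h1_repr u x))) sin_deriv2 4"
  unfolding C2_bounded_def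
proof (intro conjI allI)
  fix u h :: h1
  let ?R = h1_repr
  have cosapp: "mult_l2 (\<lambda>x. cos (?R u x)) h = l2_class (\<lambda>x. cos (?R u x) * ?R h x)"
    by (rule mult_l2_apply[OF mult_l2_bounds(3), where B = 1 and B' = 1]) auto
  have si: "square_integrable (\<lambda>x. sin (?R u x))" "square_integrable (\<lambda>x. sin (?R (u + h) x))"
    "square_integrable (\<lambda>x. cos (?R u x) * ?R h x)"
    by (auto intro!: square_integrable_sin h1_repr(1) square_integrable_bounded_mult[where B = 1])
  have bh: "AE x in halfline. \<bar>?R h x\<bar> \<le> 2 * norm h" by (auto intro: AE_halfline_I h1_repr(3))
  show "norm (sin_l2 (h1_fun (u + h)) - sin_l2 (h1_fun u) - mult_l2 (\<lambda>x. cos (?R u x)) h) \<le> 4 * (norm h)\<^sup>2"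
  proof -
    have "sin_l2 (h1_fun (u + h)) - sin_l2 (h1_fun u) - mult_l2 (\<lambda>x. cos (?R u x)) h
        = l2_class (\<lambda>x. sin (?R (u + h) x) - sin (?R u x) - cos (?R u x) * ?R h x)"
      by (simp add: h1_repr(2) sin_l2_class h1_repr(1) cosapp l2_class_diff si square_integrable_diff)
    also have "norm \<dots> \<le> (2 * norm h) * norm h"
    proof (rule norm_l2_class_le_h1)
      show "AE x in halfline. \<bar>sin (?R (u + h) x) - sin (?R u x) - cos (?R u x) * ?R h x\<bar> \<le> 2 * norm h * \<bar>?R h x\<bar>"
        using h1_repr_add[of u h] bh
      proof eventually_elim
        case (elim x)
        have "\<bar>sin (?R (u + h) x) - sin (?R u x) - cos (?R u x) * ?R h x\<bar> \<le> \<bar>?R h x\<bar> * \<bar>?R h x\<bar>"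
          unfolding elim(1) using sin_cos_remainder(1)[of "?R u x" "?R h x"] by (simp add: power2_eq_square)
        also have "\<dots> \<le> 2 * norm h * \<bar>?R h x\<bar>" using elim(2) by (intro mult_right_mono) auto
        finally show ?case .
      qed
    qed (rule square_integrable_diff[OF square_integrable_diff[OF si(2,1)] si(3)], simp)
    also have "\<dots> \<le> 4 * (norm h)\<^sup>2" by (simp add: power2_eq_square)
    finally show ?thesis .
  qed
  show "norm (mult_l2 (\<lambda>x. cos (?R (u + h) x)) - mult_l2 (\<lambda>x. cos (?R u x)) - sin_deriv2 u h) \<le> 4 * (norm h)\<^sup>2"
  proof -
    \<comment> \<open>q is the linearization of cos(u + h) at u and p its remainder. Passing through
      q keeps each combination of multipliers to two terms, as \<open>mult_l2_linear\<close>
      expects.\<close>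
    define q where "q x = cos (?R u x) + - sin (?R u x) * ?R h x" for x
    define p where "p x = cos (?R (u + h) x) - q x" for x
    have qm: "q \<in> borel_measurable halfline" and pm: "p \<in> borel_measurable halfline"
      unfolding p_def q_def by measurable
    have qb: "\<bar>q x\<bar> \<le> 1 + 2 * norm h" if "0 < x" for x
      unfolding q_def using mult_l2_bounds(1)[OF that, of u] mult_l2_bounds(2)[OF that, of u h] by linarith
    have pb: "\<bar>p x\<bar> \<le> 1 + (1 + 2 * norm h)" if "0 < x" for x
      unfolding p_def using mult_l2_bounds(1)[OF that, of "u + h"] qb[OF that] by linarith
    have "mult_l2 q = 1 *\<^sub>R mult_l2 (\<lambda>x. cos (?R u x)) + 1 *\<^sub>R mult_l2 (\<lambda>x. - sin (?R u x) * ?R h x)"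
      by (rule mult_l2_linear[OF mult_l2_bounds(3) mult_l2_bounds(1) mult_l2_bounds(4) mult_l2_bounds(2) qm qb])
        (auto simp: q_def)
    moreover have "mult_l2 p = 1 *\<^sub>R mult_l2 (\<lambda>x. cos (?R (u + h) x)) + (- 1) *\<^sub>R mult_l2 q"
      by (rule mult_l2_linear[OF mult_l2_bounds(3) mult_l2_bounds(1) qm qb pm pb]) (auto simp: p_def)
    ultimately have "mult_l2 (\<lambda>x. cos (?R (u + h) x)) - mult_l2 (\<lambda>x. cos (?R u x)) - sin_deriv2 u h = mult_l2 p"
      by (simp add: sin_deriv2_apply)
    moreover have "norm (mult_l2 p) \<le> 4 * (norm h)\<^sup>2"
    proof (rule norm_mult_l2[OF pm _ _ pb])
      show "AE x in halfline. \<bar>p x\<bar> \<le> 4 * (norm h)\<^sup>2"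
        using h1_repr_add[of u h] bh
      proof eventually_elim
        case (elim x)
        have "\<bar>p x\<bar> \<le> (?R h x)\<^sup>2"
          unfolding p_def q_def elim(1) using sin_cos_remainder(2)[of "?R u x" "?R h x"] by simp
        also have "\<dots> = \<bar>?R h x\<bar>\<^sup>2" by simp
        also have "\<dots> \<le> (2 * norm h)\<^sup>2" using elim(2) by (intro power_mono) auto
        finally show ?case by (simp add: power_mult_distrib)
      qed
    qed auto
    ultimately show ?thesis by simp
  qed
  show "norm (sin_deriv2 u - sin_deriv2 h) \<le> 4 * norm (u - h)"
  proof (rule norm_blinfun_bound)
    fix k
    define p where "p x = - sin (?R u x) * ?R k x - (- sin (?R h x) * ?R k x)" for x
    have pm: "p \<in> borel_measurable halfline" unfolding p_def by measurable
    have pb: "\<bar>p x\<bar> \<le> 2 * norm k + 2 * norm k" if "0 < x" for x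
      unfolding p_def using mult_l2_bounds(2)[OF that, of u k] mult_l2_bounds(2)[OF that, of h k] by linarith
    have "mult_l2 p = 1 *\<^sub>R mult_l2 (\<lambda>x. - sin (?R u x) * ?R k x) + (- 1) *\<^sub>R mult_l2 (\<lambda>x. - sin (?R h x) * ?R k x)"
      by (rule mult_l2_linear[OF mult_l2_bounds(4) mult_l2_bounds(2) mult_l2_bounds(4) mult_l2_bounds(2) pm pb])
        (auto simp: p_def)
    then have "(sin_deriv2 u - sin_deriv2 h) k = mult_l2 p" by (simp add: blinfun.diff_left sin_deriv2_apply)
    also have "norm \<dots> \<le> (2 * norm (u - h)) * (2 * norm k)"
    proof (rule norm_mult_l2[OF pm _ _ pb])
      have bk: "AE x in halfline. \<bar>?R k x\<bar> \<le> 2 * norm k" "AE x in halfline. \<bar>?R (u - h) x\<bar> \<le> 2 * norm (u - h)"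
        by (auto intro: AE_halfline_I h1_repr(3))
      show "AE x in halfline. \<bar>p x\<bar> \<le> (2 * norm (u - h)) * (2 * norm k)"
        using h1_repr_add[of "u - h" h] bk
      proof eventually_elim
        case (elim x)
        have "\<bar>p x\<bar> = \<bar>sin (?R h x) - sin (?R u x)\<bar> * \<bar>?R k x\<bar>"
          unfolding p_def by (simp add: abs_mult[symmetric] algebra_simps)
        also have "\<dots> \<le> \<bar>?R (u - h) x\<bar> * \<bar>?R k x\<bar>"
          using sin_cos_lipschitz(1)[of "?R u x" "?R h x"] elim(1) by (intro mult_right_mono) auto
        also have "\<dots> \<le> (2 * norm (u - h)) * (2 * norm k)" using elim by (intro mult_mono) auto
        finally show ?case .
      qed
    qed auto
    finally show "norm ((sin_deriv2 u - sin_deriv2 h) k) \<le> 4 * norm (u - h) * norm k" by simp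
  qed simp
  have "norm (mult_l2 (\<lambda>x. cos (?R u x))) \<le> 1"
    by (rule norm_mult_l2[OF mult_l2_bounds(3), where B = 1 and B' = 1]) auto
  then show "norm (mult_l2 (\<lambda>x. cos (?R u x))) \<le> 4" by simp
  show "norm (sin_deriv2 u) \<le> 4" using norm_sin_deriv2[of u] by simp
qed

lemma axis_sum:
  fixes g :: "3 \<Rightarrow> 'b::zero \<Rightarrow> 'a::comm_monoid_add"
  assumes "\<And>i. g i 0 = 0"
  shows "(\<Sum>i\<in>UNIV. g i (axis j \<psi> $ i)) = g j \<psi>"
proof -
  have "(\<Sum>i\<in>UNIV. g i (axis j \<psi> $ i)) = (\<Sum>i\<in>UNIV. if i = j then g i \<psi> else 0)"
    by (rule sum.cong) (auto simp: axis_def assms)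
  then show ?thesis by simp
qed

lemma norm_axis_3: "norm (axis j y :: 'a::real_normed_vector ^ 3) = norm y"
  unfolding norm_vec_def L2_set_def by (subst axis_sum[of "\<lambda>i x. (norm x)\<^sup>2"]) auto

text \<open>F is a sum over the edges of Q j o sin o P j, with P j the projection to one component
  and Q j the embedding into the velocity slot, which also carries the minus sign.\<close>

lemma C2_bounded_F: "\<exists>F' F'' C. C2_bounded F F' F'' C"
proof -
  define P :: "3 \<Rightarrow> X \<Rightarrow>\<^sub>L h1" where "P j = Blinfun (\<lambda>w. fst w $ j)" for j
  define Q :: "3 \<Rightarrow> l2 \<Rightarrow>\<^sub>L X" where "Q j = Blinfun (\<lambda>y. (0, axis j (- y)))" for j
  have le: "norm (fst w $ j) \<le> norm w" for w :: X and j
    using Finite_Cartesian_Product.norm_nth_le[of "fst w" j] norm_fst_le[of "fst w" "snd w"] by simp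
  have "bounded_linear (\<lambda>w::X. fst w $ j)" for j
    by (rule bounded_linear_intro[where K = 1]) (use le in auto)
  then have P: "P j w = fst w $ j" for j w by (simp add: P_def bounded_linear_Blinfun_apply)
  have nP: "norm (P j) \<le> 1" for j by (rule norm_blinfun_bound) (use le in \<open>auto simp: P\<close>)
  have "bounded_linear (\<lambda>y::l2. (0 :: H1Y, axis j (- y) :: L2Y))" for j
    by (rule bounded_linear_intro[where K = 1]) (simp add: axis_def vec_eq_iff, simp add: axis_def vec_eq_iff, simp add: norm_Pair norm_axis_3)
  then have Q: "Q j y = (0, axis j (- y))" for j y by (simp add: Q_def bounded_linear_Blinfun_apply)
  have "\<exists>f' f'' C. C2_bounded (\<lambda>w. \<Sum>j\<in>UNIV. Q j (sin_l2 (h1_fun (P j w)))) f' f'' C"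
  proof (rule C2_bounded_sum)
    show "\<exists>f' f'' C. C2_bounded (\<lambda>w. Q j (sin_l2 (h1_fun (P j w)))) f' f'' C" for j
      using C2_bounded_blinfun[OF C2_bounded_precomp[OF C2_bounded_sin nP[of j]], of "Q j"] by blast
  qed simp
  moreover have "(\<Sum>j\<in>UNIV. Q j (sin_l2 (h1_fun (P j w)))) = F w" for w
  proof -
    obtain u v where w: "w = (u, v)" by (cases w)
    show ?thesis unfolding w by (simp add: P Q F_def prod_eq_iff fst_sum snd_sum vec_eq_iff axis_def)
  qed
  ultimately show ?thesis by simp
qed

section \<open>The operator as a form operator\<close>

lemma funY_inj: "funY u = funY v \<Longrightarrow> u = v"
proof -
  assume *: "funY u = funY v"
  have "h1_fun (u $ j - v $ j) = 0" for j
    using arg_cong[OF *, of "\<lambda>w. w $ j"] by (simp add: funY_def h1_linear)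
  then show ?thesis using h1_fun_eq_0_imp by (metis eq_iff_diff_eq_0 vec_eq_iff)
qed

definition vertex_sum :: "real ^ 3 \<Rightarrow> H1Y \<Rightarrow> real" where
  "vertex_sum c u = (\<Sum>j\<in>UNIV. c $ j * trace0 (u $ j))"

definition junction_form :: "real ^ 3 \<Rightarrow> real \<Rightarrow> H1Y \<Rightarrow> H1Y \<Rightarrow> real" where
  "junction_form c lam u \<phi> = (\<Sum>j\<in>UNIV. (c $ j)\<^sup>2 * (h1_deriv (u $ j) \<bullet> h1_deriv (\<phi> $ j)))
     + 1 / lam * (vertex_sum c u * vertex_sum c \<phi>)"

lemma inner_funY: "f \<bullet> funY \<phi> = (\<Sum>j\<in>UNIV. f $ j \<bullet> h1_fun (\<phi> $ j))"
  by (simp add: inner_vec_def funY_def)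

lemma trace0_0 [simp]: "trace0 0 = 0" using trace0_scale[of 0 0] by simp

lemma vertex_sum_axis: "vertex_sum c (axis j \<psi>) = c $ j * trace0 \<psi>"
  unfolding vertex_sum_def by (rule axis_sum[of "\<lambda>i x. c $ i * trace0 x"]) simp

lemma inner_funY_axis: "f \<bullet> funY (axis j \<psi>) = f $ j \<bullet> h1_fun \<psi>"
  unfolding inner_funY by (rule axis_sum[of "\<lambda>i x. f $ i \<bullet> h1_fun x"]) (simp add: h1_linear)

lemma junction_form_axis:
  "junction_form c lam u (axis j \<psi>) = (c $ j)\<^sup>2 * (h1_deriv (u $ j) \<bullet> h1_deriv \<psi>) + 1 / lam * (vertex_sum c u * (c $ j * trace0 \<psi>))"
  unfolding junction_form_def vertex_sum_axis
  by (subst axis_sum[of "\<lambda>i x. (c $ i)\<^sup>2 * (h1_deriv (u $ i) \<bullet> h1_deriv x)"]) (simp_all add: h1_linear)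

text \<open>Collects the boundary terms edge by edge, so that the vertex conditions become the
  vanishing of each bracket in the last sum.\<close>

lemma junction_form_by_parts:
  assumes p: "funY p = derivY u"
  shows "junction_form c lam u \<phi> = - (\<Sum>j\<in>UNIV. (c $ j)\<^sup>2 * (h1_deriv (p $ j) \<bullet> h1_fun (\<phi> $ j)))
    + (\<Sum>j\<in>UNIV. (1 / lam * vertex_sum c u - c $ j * trace0 (p $ j)) * (c $ j * trace0 (\<phi> $ j)))"
proof -
  have "h1_fun (p $ j) = h1_deriv (u $ j)" for j
    using arg_cong[OF p, of "\<lambda>w. w $ j"] by (simp add: funY_def derivY_def)
  then have ibp: "h1_deriv (u $ j) \<bullet> h1_deriv (\<phi> $ j) = - (h1_deriv (p $ j) \<bullet> h1_fun (\<phi> $ j)) - trace0 (p $ j) * trace0 (\<phi> $ j)" for j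
    using h1_integration_by_parts[of "p $ j" "\<phi> $ j"] by simp
  show ?thesis
    unfolding junction_form_def ibp vertex_sum_def[of c \<phi>] sum_distrib_left sum_negf[symmetric] sum.distrib[symmetric]
    by (rule sum.cong) (auto simp: algebra_simps power2_eq_square)
qed

text \<open>The direction from operator to form is integration by parts. Conversely, test functions
  on one edge with zero trace give the second weak derivative, and one with trace 1 then shows that
  \<open>c $ j * trace0 (p $ j)\<close> has the same value on all edges.\<close>

lemma T_op_iff_form:
  assumes c: "\<And>j. c $ j > 0" and lam: "lam \<noteq> 0"
  shows "(funY u, f) \<in> T_op c lam \<longleftrightarrow> (\<forall>\<phi>. junction_form c lam u \<phi> = f \<bullet> funY \<phi>)"
proof
  assume "(funY u, f) \<in> T_op c lam"
  then obtain v p where vp: "funY u = funY v" "f = (\<chi> j. - ((c $ j)\<^sup>2 *\<^sub>R (derivY p $ j)))" "funY p = derivY v"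
     "c $ 1 * trace0 (p $ 1) = c $ 2 * trace0 (p $ 2)" "c $ 2 * trace0 (p $ 2) = c $ 3 * trace0 (p $ 3)"
     "(\<Sum>j\<in>UNIV. c $ j * trace0 (v $ j)) = lam * c $ 1 * trace0 (p $ 1)"
    unfolding T_op_def by blast
  have v: "v = u" using funY_inj[OF vp(1)] by simp
  have eq: "c $ j * trace0 (p $ j) = c $ 1 * trace0 (p $ 1)" for j
    using vp(4,5) exhaust_3[of j] by auto
  have "1 / lam * vertex_sum c u = c $ 1 * trace0 (p $ 1)"
    using vp(6) lam by (simp add: vertex_sum_def v)
  then have 0: "1 / lam * vertex_sum c u - c $ j * trace0 (p $ j) = 0" for j using eq[of j] by linarith
  show "\<forall>\<phi>. junction_form c lam u \<phi> = f \<bullet> funY \<phi>"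
  proof
    fix \<phi>
    have "junction_form c lam u \<phi> = - (\<Sum>j\<in>UNIV. (c $ j)\<^sup>2 * (h1_deriv (p $ j) \<bullet> h1_fun (\<phi> $ j)))"
      by (simp only: junction_form_by_parts[OF vp(3)[unfolded v]] 0 mult_zero_left sum.neutral_const add_0_right)
    then show "junction_form c lam u \<phi> = f \<bullet> funY \<phi>"
      by (simp add: inner_funY vp(2) derivY_def sum_negf)
  qed
next
  assume form: "\<forall>\<phi>. junction_form c lam u \<phi> = f \<bullet> funY \<phi>"
  \<comment> \<open>Regularity: the vertex term disappears for trace zero, and the form identity
    says that the derivative of u is itself in H^1.\<close>
  have "\<exists>q. h1_fun q = h1_deriv (u $ j) \<and> h1_deriv q = - (1 / (c $ j)\<^sup>2) *\<^sub>R f $ j" for j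
  proof (rule h1_ex, rule weak_derivativeI)
    fix \<psi> assume "trace0 \<psi> = 0"
    then have "(c $ j)\<^sup>2 * (h1_deriv (u $ j) \<bullet> h1_deriv \<psi>) = f $ j \<bullet> h1_fun \<psi>"
      using form[rule_format, of "axis j \<psi>"] by (simp add: junction_form_axis inner_funY_axis)
    then show "h1_deriv (u $ j) \<bullet> h1_deriv \<psi> = - ((- (1 / (c $ j)\<^sup>2) *\<^sub>R f $ j) \<bullet> h1_fun \<psi>)"
      using c[of j] by (simp add: field_simps)
  qed
  then obtain q where q: "\<And>j. h1_fun (q j) = h1_deriv (u $ j)" "\<And>j. h1_deriv (q j) = - (1 / (c $ j)\<^sup>2) *\<^sub>R f $ j" by metis
  define p :: H1Y where "p = (\<chi> j. q j)"
  have p: "funY p = derivY u" by (simp add: p_def funY_def derivY_def q)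
  have f: "f = (\<chi> j. - ((c $ j)\<^sup>2 *\<^sub>R (derivY p $ j)))"
    by (auto simp: vec_eq_iff derivY_def p_def q less_imp_neq[OF c] c[THEN less_imp_neq, symmetric])
  \<comment> \<open>Natural boundary conditions: with the interior terms already equal, a test
    function of trace 1 on edge j isolates the bracket.\<close>
  have tr: "c $ j * trace0 (p $ j) = 1 / lam * vertex_sum c u" for j
  proof -
    obtain \<psi> where \<psi>: "trace0 \<psi> = 1" using trace0_surj by blast
    let ?d = "\<lambda>i. 1 / lam * vertex_sum c u - c $ i * trace0 (p $ i)"
    have "junction_form c lam u (axis j \<psi>) = - ((c $ j)\<^sup>2 * (h1_deriv (p $ j) \<bullet> h1_fun \<psi>)) + ?d j * (c $ j * trace0 \<psi>)"
      unfolding junction_form_by_parts[OF p]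
      by (subst axis_sum[of "\<lambda>i x. (c $ i)\<^sup>2 * (h1_deriv (p $ i) \<bullet> h1_fun x)"], simp add: h1_linear)
        (subst axis_sum[of "\<lambda>i x. ?d i * (c $ i * trace0 x)"], simp_all)
    moreover have "junction_form c lam u (axis j \<psi>) = - ((c $ j)\<^sup>2 * (h1_deriv (p $ j) \<bullet> h1_fun \<psi>))"
      using form by (simp add: inner_funY_axis f derivY_def)
    ultimately show ?thesis using c[of j] \<psi> by simp
  qed
  have s: "(\<Sum>j\<in>UNIV. c $ j * trace0 (u $ j)) = lam * c $ 1 * trace0 (p $ 1)"
    using tr[of 1] lam by (simp add: vertex_sum_def mult.assoc)
  have q: "c $ 1 * trace0 (p $ 1) = c $ 2 * trace0 (p $ 2)" "c $ 2 * trace0 (p $ 2) = c $ 3 * trace0 (p $ 3)"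
    by (simp_all only: tr)
  show "(funY u, f) \<in> T_op c lam"
    unfolding T_op_def
  proof (rule CollectI, rule exI[of _ u], rule exI[of _ p], intro conjI)
    show "(funY u, f) = (funY u, (\<chi> j. - ((c $ j)\<^sup>2 *\<^sub>R (derivY p $ j))))"
      by (rule arg_cong[OF f])
  qed (rule p q s)+
qed

text \<open>As JE(u,v) = (v, -T u), the second component w is minus the image under T, which
  explains the sign in the form identity.\<close>

lemma JE_eq_form:
  assumes c: "\<And>j. c $ j > 0" and lam: "lam \<noteq> 0"
  shows "JE c lam = {((u, v), (z, w)). funY z = v \<and> (\<forall>\<phi>. junction_form c lam u \<phi> = - (w \<bullet> funY \<phi>))}"
proof -
  have "((u, v), (z, w)) \<in> JE c lam \<longleftrightarrow> funY z = v \<and> (funY u, - w) \<in> T_op c lam" for u z :: H1Y and v w :: L2Y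
    unfolding JE_def E_op_def J_op_def embX_def by auto
  then show ?thesis by (auto simp: T_op_iff_form[OF c lam])
qed

section \<open>Boundedness and coercivity of the junction form\<close>

lemma bounded_linear_vec_map:
  fixes f :: "'n::finite \<Rightarrow> 'a::real_normed_vector \<Rightarrow> 'b::real_normed_vector"
  assumes f: "\<And>j. bounded_linear (f j)"
  shows "bounded_linear (\<lambda>u. \<chi> j. f j (u $ j))"
proof -
  have "\<exists>K. \<forall>x. norm (f j x) \<le> norm x * K" for j using bounded_linear.bounded[OF f[of j]] by blast
  then obtain K where K: "\<And>j x. norm (f j x) \<le> norm x * K j" by metis
  show ?thesis
  proof (rule bounded_linear_intro[where K = "\<Sum>j\<in>UNIV. \<bar>K j\<bar>"])
    fix u :: "'a ^ 'n"
    have "norm (\<chi> j. f j (u $ j)) \<le> (\<Sum>j\<in>UNIV. norm (f j (u $ j)))"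
      unfolding norm_vec_def by (rule order_trans[OF L2_set_le_sum]) auto
    also have "\<dots> \<le> (\<Sum>j\<in>UNIV. norm u * \<bar>K j\<bar>)"
    proof (rule sum_mono)
      fix j
      have "norm (f j (u $ j)) \<le> norm (u $ j) * \<bar>K j\<bar>"
        using K[of j "u $ j"] mult_left_mono[OF abs_ge_self[of "K j"] norm_ge_zero[of "u $ j"]] by linarith
      also have "\<dots> \<le> norm u * \<bar>K j\<bar>" by (intro mult_right_mono Finite_Cartesian_Product.norm_nth_le) auto
      finally show "norm (f j (u $ j)) \<le> norm u * \<bar>K j\<bar>" .
    qed
    finally show "norm (\<chi> j. f j (u $ j)) \<le> norm u * (\<Sum>j\<in>UNIV. \<bar>K j\<bar>)" by (simp add: sum_distrib_left)
  qed (use f in \<open>simp_all add: vec_eq_iff linear_add linear_scale bounded_linear.linear\<close>)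
qed

lemma bounded_linear_funY: "bounded_linear funY"
  unfolding funY_def[abs_def] by (rule bounded_linear_vec_map[OF bounded_linear_h1_fun])

lemma bounded_linear_vertex_sum: "bounded_linear (vertex_sum c)"
  unfolding vertex_sum_def[abs_def]
  by (intro bounded_linear_sum bounded_linear_const_mult bounded_linear_compose[OF bounded_linear_trace0] bounded_linear_vec_nth)

lemma bounded_bilinear_junction_form: "bounded_bilinear (junction_form c lam)"
proof -
  have l: "bounded_linear (\<lambda>u :: H1Y. \<chi> j. c $ j *\<^sub>R h1_deriv (u $ j))"
    by (rule bounded_linear_vec_map) (intro bounded_linear_compose[OF bounded_linear_scaleR_right] bounded_linear_h1_deriv)
  have "junction_form c lam = (\<lambda>u \<phi>. (\<chi> j. c $ j *\<^sub>R h1_deriv (u $ j)) \<bullet> (\<chi> j. c $ j *\<^sub>R h1_deriv (\<phi> $ j))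
      + 1 / lam * (vertex_sum c u * vertex_sum c \<phi>))"
    by (intro ext) (simp add: junction_form_def inner_vec_def power2_eq_square mult.assoc)
  then show ?thesis
    using bounded_bilinear_add[OF bounded_bilinear.comp[OF bounded_bilinear_inner l l]
      bounded_bilinear_cmult[OF bounded_bilinear.comp[OF bounded_bilinear_mult bounded_linear_vertex_sum[of c] bounded_linear_vertex_sum[of c]], of "1 / lam"]]
    by simp
qed

lemma norm_funY: "(norm (funY u))\<^sup>2 = (\<Sum>j\<in>UNIV. (norm (h1_fun (u $ j)))\<^sup>2)"
  by (simp add: power2_norm_eq_inner inner_vec_def funY_def)

lemma norm_H1Y: "(norm (u :: H1Y))\<^sup>2 = (\<Sum>j\<in>UNIV. (norm (h1_fun (u $ j)))\<^sup>2) + (\<Sum>j\<in>UNIV. (norm (h1_deriv (u $ j)))\<^sup>2)"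
proof -
  have "(norm u)\<^sup>2 = (\<Sum>j\<in>UNIV. (norm (u $ j))\<^sup>2)"
    by (simp add: power2_norm_eq_inner inner_vec_def)
  then show ?thesis by (simp add: norm_h1 sum.distrib)
qed

text \<open>The vertex term may be negative; it is absorbed through $|u(0+)|^2 \le 2\|u\|\|u'\|$.\<close>

lemma junction_form_coercive:
  assumes c: "\<And>j. c $ j > 0" and lam: "lam \<noteq> 0"
  shows "\<exists>\<delta> \<mu>. 0 < \<delta> \<and> 0 \<le> \<mu> \<and> (\<forall>u. \<delta> * (norm u)\<^sup>2 \<le> junction_form c lam u u + \<mu> * (norm (funY u))\<^sup>2)"
proof -
  define m where "m = Min (range (\<lambda>j. (c $ j)\<^sup>2))"
  have m: "m > 0" "m \<le> (c $ j)\<^sup>2" for j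
    using c by (auto simp: m_def less_imp_neq[OF c] c[THEN less_imp_neq, symmetric])
  define k where "k = (\<Sum>j\<in>UNIV. (c $ j)\<^sup>2)"
  have k: "k > 0" using m by (auto simp: k_def intro!: sum_pos order_less_le_trans[OF m(1) m(2)])
  define l where "l = k / \<bar>lam\<bar>"
  have l: "l > 0" using k lam by (simp add: l_def)
  \<comment> \<open>With l \<epsilon> = m/2 the vertex term uses up half of the lower bound m for
    the derivative part. The price l/\<epsilon> in the L^2 norm goes into \<mu>, together with m/2
    to restore the full H^1 norm.\<close>
  define \<epsilon> where "\<epsilon> = m / (2 * l)"
  have \<epsilon>: "\<epsilon> > 0" "l * \<epsilon> = m / 2" using m l by (auto simp: \<epsilon>_def)
  define \<mu> where "\<mu> = l / \<epsilon> + m / 2"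
  have "m / 2 * (norm u)\<^sup>2 \<le> junction_form c lam u u + \<mu> * (norm (funY u))\<^sup>2" for u
  proof -
    define G where "G = (\<Sum>j\<in>UNIV. (norm (h1_fun (u $ j)))\<^sup>2)"
    define D where "D = (\<Sum>j\<in>UNIV. (norm (h1_deriv (u $ j)))\<^sup>2)"
    \<comment> \<open>Weighted arithmetic-geometric mean inequality applied to the trace estimate,
      with b rescaled by \<epsilon> so that it is a single square.\<close>
    have tr: "(trace0 w)\<^sup>2 \<le> \<epsilon> * (norm (h1_deriv w))\<^sup>2 + (norm (h1_fun w))\<^sup>2 / \<epsilon>" for w
    proof -
      define a b where "a = norm (h1_deriv w)" and "b = norm (h1_fun w) / \<epsilon>"
      have b: "norm (h1_fun w) = \<epsilon> * b" using \<epsilon>(1) by (simp add: b_def)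
      have "0 \<le> \<epsilon> * (a - b)\<^sup>2" using \<epsilon>(1) by simp
      then have "2 * (\<epsilon> * b * a) \<le> \<epsilon> * a\<^sup>2 + \<epsilon> * b\<^sup>2" by (simp add: power2_diff algebra_simps)
      moreover have "2 * (norm (h1_fun w) * norm (h1_deriv w)) = 2 * (\<epsilon> * b * a)"
        by (simp only: b a_def)
      moreover have "(norm (h1_fun w))\<^sup>2 / \<epsilon> = \<epsilon> * b\<^sup>2" unfolding b using \<epsilon>(1) by (simp add: power2_eq_square)
      ultimately show ?thesis using trace0_square_le[of w] by (simp only: a_def)
    qed
    have "(vertex_sum c u)\<^sup>2 \<le> k * (\<Sum>j\<in>UNIV. (trace0 (u $ j))\<^sup>2)"
      unfolding vertex_sum_def k_def by (rule Cauchy_Schwarz_ineq_sum)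
    also have "\<dots> \<le> k * (\<Sum>j\<in>UNIV. \<epsilon> * (norm (h1_deriv (u $ j)))\<^sup>2 + (norm (h1_fun (u $ j)))\<^sup>2 / \<epsilon>)"
      using k by (intro mult_left_mono sum_mono tr) auto
    also have "\<dots> = k * (\<epsilon> * D + G / \<epsilon>)"
      by (simp add: sum.distrib D_def G_def sum_distrib_left sum_divide_distrib)
    finally have v: "(vertex_sum c u)\<^sup>2 / \<bar>lam\<bar> \<le> k * (\<epsilon> * D + G / \<epsilon>) / \<bar>lam\<bar>" by (rule divide_right_mono) simp
    also have "\<dots> = l * (\<epsilon> * D + G / \<epsilon>)" by (simp add: l_def)
    also have "\<dots> = (l * \<epsilon>) * D + l / \<epsilon> * G" by (simp add: algebra_simps)
    finally have "(vertex_sum c u)\<^sup>2 / \<bar>lam\<bar> \<le> m / 2 * D + l / \<epsilon> * G" unfolding \<epsilon>(2) .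
    moreover have "- ((vertex_sum c u)\<^sup>2 / \<bar>lam\<bar>) \<le> 1 / lam * (vertex_sum c u * vertex_sum c u)"
    proof -
      have "\<bar>1 / lam * (vertex_sum c u * vertex_sum c u)\<bar> = (vertex_sum c u)\<^sup>2 / \<bar>lam\<bar>"
        by (simp add: abs_mult power2_eq_square)
      then show ?thesis by linarith
    qed
    moreover have "m * D \<le> (\<Sum>j\<in>UNIV. (c $ j)\<^sup>2 * (h1_deriv (u $ j) \<bullet> h1_deriv (u $ j)))"
      unfolding D_def sum_distrib_left power2_norm_eq_inner
      by (intro sum_mono mult_right_mono m(2)) simp
    ultimately have "m / 2 * D - l / \<epsilon> * G \<le> junction_form c lam u u"
      unfolding junction_form_def by linarith
    then show ?thesis
      unfolding norm_H1Y norm_funY G_def[symmetric] D_def[symmetric] \<mu>_def by (simp add: algebra_simps)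
  qed
  moreover have "0 < m / 2" "0 \<le> \<mu>" using m l \<epsilon> by (auto simp: \<mu>_def intro!: add_nonneg_nonneg divide_nonneg_pos)
  ultimately show ?thesis by blast
qed

lemma JE_generates:
  assumes c: "\<And>j. c $ j > 0" and lam: "lam \<noteq> 0"
  shows "\<exists>W. generates (JE c lam) W"
proof -
  obtain \<delta> \<mu> where \<delta>: "0 < \<delta>" "0 \<le> \<mu>" "\<And>u. \<delta> * (norm u)\<^sup>2 \<le> junction_form c lam u u + \<mu> * (norm (funY u))\<^sup>2"
    using junction_form_coercive[OF c lam] by blast
  show ?thesis
    unfolding JE_eq_form[OF c lam]
  proof (rule form_wave_generates[OF bounded_linear_funY _ _ bounded_bilinear_junction_form _ \<delta>])
    show "u = 0" if "funY u = 0" for u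
      using funY_inj[of u 0] that linear_0[OF bounded_linear.linear[OF bounded_linear_funY]] by simp
    show "f = 0" if "\<And>\<phi>. f \<bullet> funY \<phi> = 0" for f
    proof -
      have "f $ j = 0" for j
        by (rule h1_dense) (unfold inner_funY_axis[symmetric], rule that)
      then show ?thesis by (simp add: vec_eq_iff)
    qed
    show "junction_form c lam u v = junction_form c lam v u" for u v
      by (simp add: junction_form_def inner_commute mult.commute)
  qed
qed

theorem theorem3p2:
  fixes c :: "real ^ 3" and lam :: real
  assumes "\<And>j. c $ j > 0"
  shows "(lam \<noteq> 0 \<longrightarrow> (\<exists>W. generates (JE c lam) W)) \<and>
    (\<forall>W. generates (JE c lam) W \<longrightarrow>
      (\<forall>\<Psi> :: X. \<exists>T>0.
        (\<exists>!w. solution_on W F T w \<and> apply_bcontfun w 0 = \<Psi>) \<and>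
        (\<forall>T\<^sub>0. 0 < T\<^sub>0 \<and> T\<^sub>0 < T \<longrightarrow>
          (\<exists>S :: X \<Rightarrow> (real \<Rightarrow>\<^sub>C X).
            (\<forall>\<Phi> w. solution_on W F T\<^sub>0 w \<and> apply_bcontfun w 0 = \<Phi> \<longleftrightarrow> w = S \<Phi>) \<and> C2_map S))))"
proof (intro conjI impI allI)
  show "\<exists>W. generates (JE c lam) W" if "lam \<noteq> 0" by (rule JE_generates[OF assms that])
next
  fix W and \<Psi> :: X
  assume "generates (JE c lam) W"
  then have W: "C0_semigroup W" by (simp add: generates_def)
  obtain F' F'' C where "C2_bounded F F' F'' C" using C2_bounded_F by blast
  from semilinear_wellposed[OF W this] obtain T where "T > 0 \<and> (\<forall>T\<^sub>0. 0 < T\<^sub>0 \<and> T\<^sub>0 \<le> T \<longrightarrow> (\<exists>S :: X \<Rightarrow> (real \<Rightarrow>\<^sub>C X).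
      (\<forall>\<Phi> w. solution_on W F T\<^sub>0 w \<and> apply_bcontfun w 0 = \<Phi> \<longleftrightarrow> w = S \<Phi>) \<and> C2_map S))" ..
  then have T: "T > 0" and S: "\<And>T\<^sub>0. 0 < T\<^sub>0 \<and> T\<^sub>0 \<le> T \<Longrightarrow> \<exists>S :: X \<Rightarrow> (real \<Rightarrow>\<^sub>C X).
      (\<forall>\<Phi> w. solution_on W F T\<^sub>0 w \<and> apply_bcontfun w 0 = \<Phi> \<longleftrightarrow> w = S \<Phi>) \<and> C2_map S" by simp_all
  \<comment> \<open>The local result includes the endpoint, so unique solvability on all of [0,T] is
    the case T_0 = T, and this T does not depend on \<Psi>.\<close>
  from S[of T] T obtain S0 where "(\<forall>\<Phi> w. solution_on W F T w \<and> apply_bcontfun w 0 = \<Phi> \<longleftrightarrow> w = S0 \<Phi>) \<and> C2_map S0"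
    by auto
  note S0 = conjunct1[OF this, rule_format]
  have ex1: "\<exists>!w. solution_on W F T w \<and> apply_bcontfun w 0 = \<Psi>" unfolding S0 by (intro ex1I) (rule refl)
  show "\<exists>T>0. (\<exists>!w. solution_on W F T w \<and> apply_bcontfun w 0 = \<Psi>) \<and>
        (\<forall>T\<^sub>0. 0 < T\<^sub>0 \<and> T\<^sub>0 < T \<longrightarrow>
          (\<exists>S :: X \<Rightarrow> (real \<Rightarrow>\<^sub>C X).
            (\<forall>\<Phi> w. solution_on W F T\<^sub>0 w \<and> apply_bcontfun w 0 = \<Phi> \<longleftrightarrow> w = S \<Phi>) \<and> C2_map S))"
  proof (rule exI[of _ T], intro conjI T ex1 allI impI)
    fix T\<^sub>0 assume "0 < T\<^sub>0 \<and> T\<^sub>0 < T"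
    then show "\<exists>S :: X \<Rightarrow> (real \<Rightarrow>\<^sub>C X).
        (\<forall>\<Phi> w. solution_on W F T\<^sub>0 w \<and> apply_bcontfun w 0 = \<Phi> \<longleftrightarrow> w = S \<Phi>) \<and> C2_map S"
      by (intro S) simp
  qed
qed

end
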